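(* Let $0 < \alpha < n$ and let $q(\cdot) : \mathbb{R}^{n} \to (0, \infty)$ be a measurable function with $0 < q_{-} \leq q_{+} < \infty$. If $\omega \in \mathcal{W}_{q(\cdot)}$ and $\frac{1}{p(\cdot)} := \frac{1}{q(\cdot)} + \frac{\alpha}{n}$, then for any countable collection of cubes $\{ Q_j \}$ in $\mathbb{R}^n$ and any $\lambda_j > 0$, $$\left\Vert \sum_{j=1}^{\infty} \lambda_j |Q_j|^{\frac{\alpha}{n}} \chi_{Q_j} \right\Vert_{L^{q(\cdot)}_{\omega}(\mathbb{R}^n)} \leq C \left\Vert \sum_{j=1}^{\infty} \lambda_j \chi_{Q_j} \right\Vert_{L^{p(\cdot)}_{\omega}(\mathbb{R}^n)},$$ where $C$ is a positive constant independent of $\{Q_j\}$ and $\{\lambda_j\}$.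
   Context: **Exponents.** For a measurable function $p(\cdot):\mathbb{R}^n\to(0,\infty)$ put $p_- = \mathrm{ess\,inf}_{x\in\mathbb{R}^n}\, p(x)$ and $p_+ = \mathrm{ess\,sup}_{x\in\mathbb{R}^n}\, p(x)$. If $p(\cdot)$ takes values in $[1,\infty)$, its conjugate $p'(\cdot)$ is defined by $\frac1{p(x)}+\frac1{p'(x)}=1$. **Weighted variable Lebesgue spaces.** $\|f\|_{L^{p(\cdot)}} = \inf\{\lambda>0: \int_{\mathbb{R}^n} |f(x)/\lambda|^{p(x)}dx\le 1\}$. A weight is a locally integrable function $\omega$ on $\mathbb{R}^n$ with $0<\omega(x)<\infty$ a.e. The space $L^{p(\cdot)}_\omega(\mathbb{R}^n)$ consists of all measurable $f:\mathbb{R}^n\to\mathbb{C}$ with $\|f\|_{L^{p(\cdot)}_\omega} := \|f\omega\|_{L^{p(\cdot)}}<\infty$; the same notation is used with powers of $\omega$ in place of $\omega$. **Maximal operator.** $Mf(x)=\sup_{Q\ni x}|Q|^{-1}\int_Q|f(y)|\,dy$, the supremum being over all cubes $Q$ containing $x$ (Hardy–Littlewood maximal operator). **Weight class.** For measurable $p(\cdot):\mathbb{R}^n\to(0,\infty)$ with $0<p_-\le p_+<\infty$, $\mathcal{W}_{p(\cdot)}$ is the set of all weights $\omega$ such that: (i) there exists $0<p_*<\min\{1,p_-\}$ such that $\|\chi_Q\|_{L^{p(\cdot)/p_*}_{\omega^{p_*}}}<\infty$ and $\|\chi_Q\|_{L^{(p(\cdot)/p_* )'}_{\omega^{-p_*}}}<\infty$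 for every cube $Q$; (ii) there exist $\kappa>1$ and $s>\max\{1,1/p_-\}$ such that $M$ is bounded on $L^{(sp(\cdot))'/\kappa}_{\omega^{-\kappa/s}}$. Here $|Q|$ is the Lebesgue measure of $Q$ and $\chi_Q$ its characteristic function. *)

theory Defs
  imports "HOL-Analysis.Analysis" "HOL-Probability.Essential_Supremum"
begin

definition ess_inf :: "((real ^ 'n) \<Rightarrow> real) \<Rightarrow> ereal" where
  "ess_inf p = - esssup lebesgue (\<lambda>x. - ereal (p x))"

definition ess_sup :: "((real ^ 'n) \<Rightarrow> real) \<Rightarrow> ereal" where
  "ess_sup p = esssup lebesgue (\<lambda>x. ereal (p x))"

text \<open>The solution of \<open>1 / p x + 1 / p' x = 1\<close>. The value is meaningful only where \<open>p x > 1\<close>;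
  the exponents to which this is applied below satisfy that almost everywhere.\<close>

definition conj_exponent :: "('a \<Rightarrow> real) \<Rightarrow> 'a \<Rightarrow> real" where
  "conj_exponent p x = 1 / (1 - 1 / p x)"

text \<open>Real powers on \<open>[0, \<infinity>]\<close>: \<open>t\<^sup>0 = 1\<close>, \<open>0\<^sup>r = 0\<close> and \<open>\<infinity>\<^sup>r = \<infinity>\<close> for \<open>r > 0\<close>, and
  \<open>t\<^sup>r\<close> is the inverse of the \<open>(-r)\<close>-th power for \<open>r < 0\<close>.\<close>

definition ennreal_rpow :: "ennreal \<Rightarrow> real \<Rightarrow> ennreal" where
  "ennreal_rpow t r =
    (let u = (if r = 0 then 1 else if t = \<infinity> then \<infinity> else ennreal (enn2real t powr \<bar>r\<bar>))
     in if r < 0 then inverse u else u)"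

text \<open>Moduli of functions take values in \<open>[0, \<infinity>]\<close>, so that the norm applies also to pointwise
  divergent series and to maximal functions. The infimum of the empty set is \<open>\<infinity>\<close>.\<close>

definition Lp_norm :: "((real ^ 'n) \<Rightarrow> real) \<Rightarrow> ((real ^ 'n) \<Rightarrow> ennreal) \<Rightarrow> ennreal" where
  "Lp_norm p f =
    Inf {ennreal l |l. 0 < l \<and> (\<integral>\<^sup>+ x. ennreal_rpow (f x / ennreal l) (p x) \<partial>lebesgue) \<le> 1}"

definition weighted_norm ::
    "((real ^ 'n) \<Rightarrow> real) \<Rightarrow> ((real ^ 'n) \<Rightarrow> ennreal) \<Rightarrow> ((real ^ 'n) \<Rightarrow> ennreal) \<Rightarrow> ennreal" where
  "weighted_norm p \<omega> f = Lp_norm p (\<lambda>x. f x * \<omega> x)"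

definition weighted_Lp ::
    "((real ^ 'n) \<Rightarrow> real) \<Rightarrow> ((real ^ 'n) \<Rightarrow> ennreal) \<Rightarrow> ((real ^ 'n) \<Rightarrow> complex) set" where
  "weighted_Lp p \<omega> =
    {f \<in> borel_measurable lebesgue. weighted_norm p \<omega> (\<lambda>x. ennreal (cmod (f x))) < \<infinity>}"

definition is_weight :: "((real ^ 'n) \<Rightarrow> ennreal) \<Rightarrow> bool" where
  "is_weight \<omega> \<longleftrightarrow>
     \<omega> \<in> borel_measurable lebesgue \<and>
     (\<forall>K. compact K \<longrightarrow> (\<integral>\<^sup>+ x\<in>K. \<omega> x \<partial>lebesgue) < \<infinity>) \<and>
     (AE x in lebesgue. 0 < \<omega> x \<and> \<omega> x < \<infinity>)"

text \<open>Closed cubes with sides parallel to the axes and positive side length.\<close>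

definition cubes :: "(real ^ 'n) set set" where
  "cubes = {cbox a (a + vec l) |a l. 0 < l}"

definition maximal_fun :: "((real ^ 'n) \<Rightarrow> complex) \<Rightarrow> (real ^ 'n) \<Rightarrow> ennreal" where
  "maximal_fun f x =
    (SUP Q\<in>{Q \<in> cubes. x \<in> Q}. (\<integral>\<^sup>+ y\<in>Q. ennreal (cmod (f y)) \<partial>lebesgue) / emeasure lebesgue Q)"

definition maximal_bounded_on ::
    "((real ^ 'n) \<Rightarrow> real) \<Rightarrow> ((real ^ 'n) \<Rightarrow> ennreal) \<Rightarrow> bool" where
  "maximal_bounded_on p \<omega> \<longleftrightarrow>
    (\<exists>C::real. 0 < C \<and> (\<forall>f \<in> weighted_Lp p \<omega>.
       weighted_norm p \<omega> (maximal_fun f) \<le>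
         ennreal C * weighted_norm p \<omega> (\<lambda>x. ennreal (cmod (f x)))))"

definition weight_class :: "((real ^ 'n) \<Rightarrow> real) \<Rightarrow> ((real ^ 'n) \<Rightarrow> ennreal) set" where
  "weight_class p = {\<omega>. is_weight \<omega> \<and>
    (\<exists>r::real. 0 < r \<and> ereal r < min 1 (ess_inf p) \<and>
      (\<forall>Q\<in>cubes.
         weighted_norm (\<lambda>x. p x / r) (\<lambda>x. ennreal_rpow (\<omega> x) r) (indicator Q) < \<infinity> \<and>
         weighted_norm (conj_exponent (\<lambda>x. p x / r)) (\<lambda>x. ennreal_rpow (\<omega> x) (- r))
           (indicator Q) < \<infinity>)) \<and>
    (\<exists>\<kappa> s::real. 1 < \<kappa> \<and> max 1 (1 / ess_inf p) < ereal s \<and>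
      maximal_bounded_on (\<lambda>x. conj_exponent (\<lambda>y. s * p y) x / \<kappa>)
        (\<lambda>x. ennreal_rpow (\<omega> x) (- (\<kappa> / s))))}"

end

theory Submission
  imports Defs
begin

text \<open>
  Let \<open>a = \<alpha> / n\<close>, let \<open>f\<close> and \<open>g\<close> be the sums on the right and on the left, and let \<open>s\<close>, \<open>\<kappa>\<close>
  be the parameters for which the maximal operator \<open>M\<close> is bounded on the dual space. The proof is an
  extrapolation in the manner of Rubio de Francia: the variable exponents and the weight \<open>\<omega>\<close> are
  traded for the constant exponents \<open>1/s\<close> and \<open>1/(s+a)\<close> and an \<open>A\<^sub>1\<close> weight \<open>W\<close> built from \<open>f\<close>, \<open>g\<close>, \<open>\<omega>\<close>
  with constants that depend on none of the cubes and coefficients.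

  \<^emph>\<open>The weight.\<close> By homogeneity the modular of \<open>f\<omega>\<close> may be taken to be at most \<open>1\<close>, and the scale \<open>\<mu>\<close>
  at which the modular of \<open>X = g\<omega>/\<mu>\<close> is comparable to \<open>1\<close> has to be bounded. Writing
  \<open>X\<^sup>q = X^(1/s) k\<close>, the factor \<open>k\<close> has modular at most \<open>1\<close> for the conjugate exponent \<open>(sq)'\<close>, so that
  the modular of \<open>X\<close> is \<open>\<mu>^(-1/s)\<close> times the integral of \<open>g^(1/s) h\<close> with \<open>h = k \<omega>^(1/s)\<close>. Summing the
  iterates of \<open>M\<close> on \<open>h\<^sup>\<kappa>\<close> with geometric weights gives \<open>U \<ge> h\<^sup>\<kappa>\<close> with \<open>M U \<le> A U\<close> and a bound for \<open>U\<close> in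
  the dual space (\<open>rubio_de_francia\<close>). Its root \<open>W = U^(1/\<kappa>) \<ge> h\<close> is an \<open>A\<^sub>1\<close> weight
  (\<open>A1_weight_root\<close>).

  \<^emph>\<open>The exponents.\<close> The relation \<open>1/p = 1/q + a\<close> is exactly what makes the two factors of
  \<open>f^(1/(s+a)) W^(s/(s+a))\<close>, namely powers of \<open>f\<omega>\<close> and of \<open>W \<omega>^(-1/s)\<close>, conjugate in Young's inequality:
  its integral is bounded by the modulars of these two functions. It remains to bound the integral of
  \<open>g^(1/s) W\<close> in terms of the integral of \<open>f^(1/(s+a)) W^(s/(s+a))\<close> (\<open>A1_sum_of_cubes_estimate\<close>).

  \<^emph>\<open>The \<open>A\<^sub>1\<close> case.\<close> Put \<open>F = f W^(-a)\<close> and \<open>\<nu> = W dx\<close>; then the hypothesis is a bound for the integral of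
  \<open>F^(1/(s+a))\<close> with respect to \<open>\<nu>\<close>. If \<open>S\<close> is the sum of the coefficients of the cubes of side about \<open>L\<close>
  that contain \<open>x\<close>, and \<open>B\<close> is a ball of radius about \<open>L\<close> around \<open>x\<close>, then \<open>L^(na) S\<close> is at most a
  constant times \<open>\<nu>(B)\<^sup>a\<close> times the \<open>\<nu>\<close>-mean over \<open>B\<close> of \<open>F\<^sup>b\<close>, raised to the power \<open>1/b\<close>, for small \<open>b\<close>
  (\<open>one_scale_estimate\<close>). For small \<open>L\<close> the mean is bounded by the maximal function with respect to
  \<open>\<nu>\<close>, for large \<open>L\<close> by the total integral. As \<open>\<nu>(B)\<close> grows geometrically with the dyadic scale, both
  parts are geometric series, and the sum over all scales is bounded pointwise as in Hedberg's
  inequality for fractional integrals (\<open>hedberg_pointwise\<close>). The \<open>L\<^sup>2\<close> bound of the maximal operator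
  of the doubling measure \<open>\<nu>\<close> (\<open>max_op_L2_bound\<close>) concludes.

  Countable families follow from finite ones by monotone convergence.
\<close>

section \<open>Powers and modulars with values in the extended half-line\<close>

lemma ennreal_rpow_pos:
  "0 < r \<Longrightarrow> ennreal_rpow t r = (if t = \<infinity> then \<infinity> else ennreal (enn2real t powr r))"
  by (simp add: ennreal_rpow_def)

lemma ennreal_rpow_ennreal: "0 < a \<Longrightarrow> ennreal_rpow (ennreal a) r = ennreal (a powr r)"
  by (auto simp: ennreal_rpow_def Let_def inverse_ennreal powr_minus)

lemma ennreal_rpow_ennreal_nonneg: "0 \<le> a \<Longrightarrow> 0 < r \<Longrightarrow> ennreal_rpow (ennreal a) r = ennreal (a powr r)"
  by (simp add: ennreal_rpow_pos)

lemma ennreal_rpow_inverse: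
  assumes "0 < r"
  shows "ennreal_rpow (ennreal_rpow t r) (1 / r) = t"
  using assms by (cases t) (auto simp: ennreal_rpow_pos powr_powr)

lemma ennreal_rpow_mono:
  assumes "0 < r" "s \<le> t"
  shows "ennreal_rpow s r \<le> ennreal_rpow t r"
proof (cases t)
  case (real b)
  then have "s < \<infinity>" using assms(2) by (auto intro: order.strict_trans1)
  then obtain a where "0 \<le> a" "s = ennreal a" by (cases s) auto
  then show ?thesis using real assms
    by (simp add: ennreal_rpow_ennreal_nonneg powr_mono2 ennreal_leI)
qed (simp add: ennreal_rpow_pos assms)

lemma ennreal_rpow_le_iff:
  assumes "0 < r"
  shows "ennreal_rpow t r \<le> u \<longleftrightarrow> t \<le> ennreal_rpow u (1 / r)"
  using ennreal_rpow_mono[of r t "ennreal_rpow u (1 / r)"] ennreal_rpow_mono[of "1 / r" "ennreal_rpow t r" u]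
    ennreal_rpow_inverse[of r t] ennreal_rpow_inverse[of "1 / r" u] assms by auto

text \<open>A power with positive exponent is an order isomorphism of \<open>[0, \<infinity>]\<close>, so it commutes with suprema
  of arbitrary families.\<close>

lemma ennreal_rpow_SUP:
  assumes "0 < r"
  shows "ennreal_rpow (SUP i\<in>I. f i) r = (SUP i\<in>I. ennreal_rpow (f i) r)"
proof (rule antisym)
  have "f i \<le> ennreal_rpow (SUP i\<in>I. ennreal_rpow (f i) r) (1 / r)" if "i \<in> I" for i
    unfolding ennreal_rpow_le_iff[OF assms, symmetric] using that by (rule SUP_upper)
  then show "ennreal_rpow (SUP i\<in>I. f i) r \<le> (SUP i\<in>I. ennreal_rpow (f i) r)"
    unfolding ennreal_rpow_le_iff[OF assms] by (intro SUP_least)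
  show "(SUP i\<in>I. ennreal_rpow (f i) r) \<le> ennreal_rpow (SUP i\<in>I. f i) r"
    by (intro SUP_least ennreal_rpow_mono assms SUP_upper)
qed

lemma ennreal_rpow_mult:
  assumes "0 < r"
  shows "ennreal_rpow (s * t) r = ennreal_rpow s r * ennreal_rpow t r"
proof (cases s)
  case s: (real a)
  show ?thesis
  proof (cases t)
    case (real b)
    then show ?thesis using s assms
      by (simp add: ennreal_rpow_ennreal_nonneg powr_mult ennreal_mult'[symmetric])
  next
    case top
    then show ?thesis using s assms by (cases "a = 0") (auto simp: ennreal_rpow_pos ennreal_mult_top)
  qed
next
  case top
  then show ?thesis using assms
    by (cases "t = 0"; cases t) (auto simp: ennreal_rpow_pos ennreal_top_mult)
qed

lemma measurable_ennreal_rpow [measurable]: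
  assumes [measurable]: "f \<in> borel_measurable M" "p \<in> borel_measurable M"
  shows "(\<lambda>x. ennreal_rpow (f x) (p x)) \<in> borel_measurable M"
  unfolding ennreal_rpow_def Let_def by measurable

definition modular :: "(real ^ 'n \<Rightarrow> real) \<Rightarrow> (real ^ 'n \<Rightarrow> ennreal) \<Rightarrow> ennreal" where
  "modular p f = (\<integral>\<^sup>+x. ennreal_rpow (f x) (p x) \<partial>lebesgue)"

lemma modular_cong_AE: "AE x in lebesgue. f x = g x \<Longrightarrow> modular p f = modular p g"
  unfolding modular_def by (rule nn_integral_cong_AE) (auto elim: eventually_mono)

lemma modular_mono:
  assumes "AE x in lebesgue. 0 < p x" "AE x in lebesgue. f x \<le> g x"
  shows "modular p f \<le> modular p g"
  unfolding modular_def using assms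
  by (intro nn_integral_mono_AE) (auto elim!: eventually_elim2 intro: ennreal_rpow_mono)

lemma Lp_norm_cong_AE: 
  assumes "AE x in lebesgue. f x = g x"
  shows "Lp_norm p f = Lp_norm p g"
proof -
  have "modular p (\<lambda>x. f x / ennreal l) = modular p (\<lambda>x. g x / ennreal l)" for l
    using assms by (intro modular_cong_AE) (auto elim: eventually_mono)
  then show ?thesis by (simp add: Lp_norm_def modular_def)
qed

lemma Lp_norm_le: "0 < l \<Longrightarrow> modular p (\<lambda>x. f x / ennreal l) \<le> 1 \<Longrightarrow> Lp_norm p f \<le> ennreal l"
  unfolding Lp_norm_def modular_def by (intro Inf_lower) blast

lemma divide_ennreal_real: "0 < a \<Longrightarrow> x / ennreal a = x * ennreal (1 / a)"
  by (simp add: divide_ennreal_def inverse_ennreal inverse_eq_divide)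

text \<open>The infimum in the norm need not be attained at the norm itself, but every larger number
  qualifies because the modular is monotone.\<close>

lemma modular_le_1_of_Lp_norm_less:
  assumes p: "AE x in lebesgue. 0 < p x" and less: "Lp_norm p f < ennreal L"
  shows "modular p (\<lambda>x. f x / ennreal L) \<le> 1"
proof -
  obtain l where l: "0 < l" "ennreal l < ennreal L" "modular p (\<lambda>x. f x / ennreal l) \<le> 1"
    using less unfolding Lp_norm_def Inf_less_iff modular_def by blast
  have "f x / ennreal L \<le> f x / ennreal l" for x
    using l(1,2) by (simp add: divide_ennreal_real ennreal_less_iff mult_left_mono ennreal_leI frac_le)
  then have "modular p (\<lambda>x. f x / ennreal L) \<le> modular p (\<lambda>x. f x / ennreal l)"
    by (intro modular_mono p) auto
  then show ?thesis using l(3) by simp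
qed

lemma AE_finite_of_Lp_norm_finite:
  assumes [measurable]: "p \<in> borel_measurable lebesgue" "f \<in> borel_measurable lebesgue"
    and p: "AE x in lebesgue. 0 < p x" and fin: "Lp_norm p f < \<infinity>"
  shows "AE x in lebesgue. f x < \<infinity>"
proof -
  obtain l where l: "0 < l" "(\<integral>\<^sup>+ x. ennreal_rpow (f x / ennreal l) (p x) \<partial>lebesgue) \<le> 1"
    using fin unfolding Lp_norm_def Inf_less_iff by blast
  have "AE x in lebesgue. ennreal_rpow (f x / ennreal l) (p x) \<noteq> \<infinity>"
    using l(2) by (intro nn_integral_PInf_AE) (auto simp: top_unique)
  with p show ?thesis
  proof eventually_elim
    case (elim x)
    then show ?case using l(1)
      by (cases "f x = \<infinity>") (auto simp: ennreal_rpow_pos divide_ennreal_real ennreal_top_mult less_top)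
  qed
qed

section \<open>Elementary facts on sums, unions and cubes\<close>

text \<open>The largest index carries the largest term, and the terms below it decay geometrically; this
  holds for every finite set of indices, however sparse.\<close>

lemma geometric_sum_le:
  fixes Z :: "int \<Rightarrow> real"
  assumes "finite I" "0 \<le> r" "r < 1" "0 \<le> T"
    and step: "\<And>i j. i < j \<Longrightarrow> Z i \<le> r * Z j"
    and bound: "\<And>i. i \<in> I \<Longrightarrow> Z i \<le> T"
  shows "sum Z I \<le> T / (1 - r)"
  using assms(1,4) bound
proof (induction I arbitrary: T rule: finite_linorder_max_induct)
  case empty
  then show ?case using assms(3) by simp
next
  case (insert b A)
  show ?case
  proof (cases "0 \<le> r * Z b")
    case True
    have "sum Z A \<le> (r * Z b) / (1 - r)"
      using insert.hyps(2) step True by (intro insert.IH) auto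
    then have "sum Z (insert b A) \<le> Z b + r * Z b / (1 - r)"
      using insert.hyps by (subst sum.insert) auto
    also have "\<dots> = Z b / (1 - r)" using assms(3) by (simp add: field_simps)
    also have "\<dots> \<le> T / (1 - r)" using insert.prems assms(3) by (intro divide_right_mono) auto
    finally show ?thesis .
  next
    case False
    have "Z i \<le> 0" if "i \<in> A" for i
      using step[of i b] insert.hyps(2) that False by force
    then have "sum Z A \<le> 0" by (rule sum_nonpos)
    moreover have "Z b \<le> 0" using False assms(2) by (simp add: not_le mult_less_0_iff)
    ultimately have "sum Z (insert b A) \<le> 0"
      using insert.hyps by (subst sum.insert) auto
    also have "0 \<le> T / (1 - r)" using insert.prems assms(3) by simp
    finally show ?thesis .
  qed
qed

lemma geometric_sum_le_rev:
  fixes Z :: "int \<Rightarrow> real"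
  assumes "finite I" "0 \<le> r" "r < 1" "0 \<le> T"
    and step: "\<And>i j. i < j \<Longrightarrow> Z j \<le> r * Z i"
    and bound: "\<And>i. i \<in> I \<Longrightarrow> Z i \<le> T"
  shows "sum Z I \<le> T / (1 - r)"
proof -
  have "sum (\<lambda>i. Z (- i)) (uminus ` I) \<le> T / (1 - r)"
    using assms by (intro geometric_sum_le) auto
  then show ?thesis by (subst (asm) sum.reindex) auto
qed

lemma emeasure_UN_countable_le:
  assumes C: "countable C" and X: "\<And>i. i \<in> C \<Longrightarrow> X i \<in> sets M"
  shows "emeasure M (\<Union>i\<in>C. X i) \<le> (\<integral>\<^sup>+i. emeasure M (X i) \<partial>count_space C)"
proof -
  have "emeasure M (\<Union>i\<in>C. X i) = (\<integral>\<^sup>+x. indicator (\<Union>i\<in>C. X i) x \<partial>M)"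
    using C X by (intro nn_integral_indicator[symmetric] sets.countable_UN') auto
  also have "\<dots> \<le> (\<integral>\<^sup>+x. (\<integral>\<^sup>+i. indicator (X i) x \<partial>count_space C) \<partial>M)"
  proof (rule nn_integral_mono)
    fix x
    show "indicator (\<Union>i\<in>C. X i) x \<le> (\<integral>\<^sup>+i. indicator (X i) x \<partial>count_space C)"
    proof (cases "\<exists>i\<in>C. x \<in> X i")
      case True
      then obtain i where "i \<in> C" "x \<in> X i" by blast
      then show ?thesis
        using nn_integral_ge_point[of i C "\<lambda>i. indicator (X i) x"]
        by (auto simp: indicator_def of_bool_def)
    qed auto
  qed
  also have "\<dots> = (\<integral>\<^sup>+i. (\<integral>\<^sup>+x. indicator (X i) x \<partial>M) \<partial>count_space C)"
    using C X by (intro nn_integral_count_space_nn_integral) auto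
  also have "\<dots> = (\<integral>\<^sup>+i. emeasure M (X i) \<partial>count_space C)"
    using X by (intro nn_integral_cong) auto
  finally show ?thesis .
qed

text \<open>A layer cake bound up to the factor \<open>2\<close>: for finite \<open>m\<close> the part of the integral over
  \<open>(m/2, m)\<close> is at least half of the square.\<close>

lemma layer_cake_square: "(m :: ennreal)\<^sup>2 \<le> 2 * (\<integral>\<^sup>+t. ennreal (2 * t) * indicator {t. 0 < t \<and> ennreal t < m} t \<partial>lborel)"
    (is "_ \<le> 2 * ?I")
proof -
  have below: "ennreal (a * a / 2) \<le> ?I" if a: "0 \<le> a" "ennreal a \<le> m" for a
  proof -
    have "ennreal (a * a / 2) = (\<integral>\<^sup>+t. ennreal a * indicator {a / 2<..<a} t \<partial>lborel)"
      using a by (simp add: nn_integral_cmult_indicator ennreal_mult'[symmetric])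
    also have "\<dots> \<le> ?I"
    proof (rule nn_integral_mono)
      fix t
      show "ennreal a * indicator {a / 2<..<a} t \<le> ennreal (2 * t) * indicator {t. 0 < t \<and> ennreal t < m} t"
      proof (cases "t \<in> {a / 2<..<a}")
        case True
        then have "ennreal t < m" using a ennreal_lessI[of a t] by (auto intro: order.strict_trans2)
        then show ?thesis using True a by (auto intro: ennreal_leI)
      qed simp
    qed
    finally show ?thesis .
  qed
  show ?thesis
  proof (cases m)
    case (real a)
    have "2 * ennreal (a * a / 2) \<le> 2 * ?I"
      using below[of a] real by (intro mult_left_mono) auto
    moreover have "2 * ennreal (a * a / 2) = m\<^sup>2"
      using real by (simp add: ennreal_mult'[symmetric] ennreal_numeral[symmetric] power2_eq_square del: ennreal_numeral)
    ultimately show ?thesis by simp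
  next
    case top
    have "?I = top"
    proof (rule ccontr)
      assume "?I \<noteq> top"
      then obtain k where k: "?I < of_nat k" using ennreal_Ex_less_of_nat less_top by blast
      define a where "a = 2 * real k + 2"
      have "real k \<le> a * a / 2" by (simp add: a_def field_simps)
      then have "of_nat k \<le> ennreal (a * a / 2)" by (simp add: ennreal_of_nat_eq_real_of_nat ennreal_leI)
      also have "\<dots> \<le> ?I" using below[of a] top by (simp add: a_def)
      finally show False using k by simp
    qed
    then show ?thesis using top by (simp add: ennreal_mult_top)
  qed
qed

lemma layer_cake_linear: "(\<integral>\<^sup>+t. indicator {t. 0 < t \<and> ennreal (t / 2) < m} t \<partial>lborel) \<le> 2 * m"
proof (cases m)
  case (real a)
  have "(\<integral>\<^sup>+t. indicator {t. 0 < t \<and> ennreal (t / 2) < m} t \<partial>lborel) = (\<integral>\<^sup>+t. indicator {0<..<2*a} t \<partial>lborel)"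
    using real by (intro nn_integral_cong) (auto split: split_indicator simp: ennreal_less_iff)
  also have "\<dots> = 2 * m" using real by (simp add: ennreal_mult')
  finally show ?thesis by simp
qed (simp add: ennreal_mult_top)

text \<open>Young's inequality without its optimal constants: both factors are dominated by powers of the
  maximum.\<close>

lemma powr_interpolation_le_add:
  fixes x y :: real
  assumes "0 \<le> x" "0 \<le> y" "0 < \<theta>" "\<theta> < 1"
  shows "x powr \<theta> * y powr (1 - \<theta>) \<le> x + y"
proof -
  let ?m = "max x y"
  have "x powr \<theta> * y powr (1 - \<theta>) \<le> ?m powr \<theta> * ?m powr (1 - \<theta>)"
    using assms by (intro mult_mono powr_mono2) auto
  also have "\<dots> = ?m" using assms by (simp add: powr_add[symmetric])
  finally show ?thesis using assms by auto
qed

lemma cbox_sets_lebesgue [measurable]: "cbox a b \<in> sets lebesgue"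
  by simp

lemma emeasure_cube:
  fixes z :: "real ^ 'n"
  assumes "0 < l"
  shows "emeasure lebesgue (cbox z (z + vec l)) = ennreal (l ^ CARD('n))"
proof -
  have "z \<in> cbox z (z + vec l)" using assms by (simp add: mem_box_cart)
  then have "cbox z (z + vec l) \<noteq> {}" by blast
  then have "measure lborel (cbox z (z + vec l)) = l ^ CARD('n)"
    by (subst content_cbox_cart) auto
  moreover have "emeasure lborel (cbox z (z + vec l)) = ennreal (measure lborel (cbox z (z + vec l)))"
    using emeasure_lborel_cbox_finite[of z "z + vec l"] by (intro emeasure_eq_ennreal_measure) auto
  ultimately show ?thesis by simp
qed

text \<open>The \<open>l\<^sup>1\<close> norm is cruder than the Euclidean one, but costs only a constant.\<close>

lemma cube_diameter:
  fixes z :: "real ^ 'n"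
  assumes "0 < l" "x \<in> cbox z (z + vec l)" "y \<in> cbox z (z + vec l)"
  shows "dist x y \<le> real CARD('n) * l"
proof -
  have "dist x y = norm (x - y)" by (simp add: dist_norm)
  also have "\<dots> \<le> (\<Sum>i\<in>UNIV. \<bar>(x - y) $ i\<bar>)" by (rule norm_le_l1_cart)
  also have "\<dots> \<le> (\<Sum>i\<in>(UNIV :: 'n set). l)"
  proof (rule sum_mono)
    fix i
    have "z $ i \<le> x $ i" "x $ i \<le> z $ i + l" "z $ i \<le> y $ i" "y $ i \<le> z $ i + l"
      using assms by (auto simp: mem_box_cart)
    then show "\<bar>(x - y) $ i\<bar> \<le> l" by (simp add: abs_le_iff)
  qed
  finally show ?thesis by simp
qed

lemma nn_integral_sum_cubes:
  fixes z :: "'j \<Rightarrow> real ^ 'n" and d l :: "'j \<Rightarrow> real"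
  assumes "finite I" and "\<And>j. j \<in> I \<Longrightarrow> 0 \<le> d j" and "\<And>j. j \<in> I \<Longrightarrow> 0 < l j"
  shows "(\<integral>\<^sup>+y. ennreal (\<Sum>j\<in>I. d j * indicator (cbox (z j) (z j + vec (l j))) y) \<partial>lebesgue)
    = ennreal (\<Sum>j\<in>I. d j * l j ^ CARD('n))"
  using assms
proof (induction I rule: finite_induct)
  case (insert i I)
  let ?g = "\<lambda>y. \<Sum>j\<in>I. d j * indicator (cbox (z j) (z j + vec (l j))) y"
  have g: "0 \<le> ?g y" for y using insert.prems by (intro sum_nonneg mult_nonneg_nonneg) auto
  have d: "0 \<le> d i" and l: "0 < l i" using insert.prems by auto
  have "(\<integral>\<^sup>+y. ennreal (\<Sum>j\<in>insert i I. d j * indicator (cbox (z j) (z j + vec (l j))) y) \<partial>lebesgue)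
    = (\<integral>\<^sup>+y. ennreal (d i) * indicator (cbox (z i) (z i + vec (l i))) y + ennreal (?g y) \<partial>lebesgue)"
  proof (rule nn_integral_cong)
    fix y
    have "ennreal (d i * indicator (cbox (z i) (z i + vec (l i))) y) = ennreal (d i) * indicator (cbox (z i) (z i + vec (l i))) y"
      by (simp split: split_indicator)
    then show "ennreal (\<Sum>j\<in>insert i I. d j * indicator (cbox (z j) (z j + vec (l j))) y) =
        ennreal (d i) * indicator (cbox (z i) (z i + vec (l i))) y + ennreal (?g y)"
      unfolding sum.insert[OF insert.hyps] using d g[of y]
      by (subst ennreal_plus) (auto intro!: mult_nonneg_nonneg simp only: indicator_pos_le)
  qed
  also have "\<dots> = ennreal (d i) * emeasure lebesgue (cbox (z i) (z i + vec (l i))) + (\<integral>\<^sup>+y. ennreal (?g y) \<partial>lebesgue)"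
    by (subst nn_integral_add, measurable) (simp add: nn_integral_cmult_indicator del: sum_mult_indicator)
  also have "\<dots> = ennreal (d i) * ennreal (l i ^ CARD('n)) + ennreal (\<Sum>j\<in>I. d j * l j ^ CARD('n))"
    using insert by (simp only: emeasure_cube[OF l]) auto
  also have "\<dots> = ennreal (\<Sum>j\<in>insert i I. d j * l j ^ CARD('n))"
  proof -
    have "0 \<le> (\<Sum>j\<in>I. d j * l j ^ CARD('n))"
      using insert.prems by (intro sum_nonneg mult_nonneg_nonneg zero_le_power) (auto simp: less_imp_le)
    then show ?thesis using d l insert.hyps by (simp add: ennreal_mult'[symmetric] ennreal_plus)
  qed
  finally show ?case .
qed simp

lemma ball_subset_cube: "ball c r \<subseteq> cbox (c - vec r) (c - vec r + vec (2 * r))" for c :: "real ^ 'n"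
proof
  fix y assume "y \<in> ball c r"
  then have "\<bar>(c - y) $ i\<bar> < r" for i
    using component_le_norm_cart[of "c - y" i] by (simp add: dist_norm)
  then have "\<bar>c $ i - y $ i\<bar> < r" for i
    by simp
  then have "c $ i - r \<le> y $ i \<and> y $ i \<le> c $ i - r + 2 * r" for i
    by (smt (verit))
  then show "y \<in> cbox (c - vec r) (c - vec r + vec (2 * r))" by (simp add: mem_box_cart)
qed

lemma cube_sum_le:
  fixes d :: "'j \<Rightarrow> real"
  assumes "\<And>j. j \<in> J \<Longrightarrow> 0 \<le> d j"
  shows "(\<Sum>j\<in>J. d j * indicator (Q j) x) \<le> sum d J"
  using assms by (intro sum_mono) (auto split: split_indicator)

section \<open>Weights of class \<open>A\<^sub>1\<close> and their maximal operator\<close>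

text \<open>The \<open>A\<^sub>1\<close> condition is stated on balls, to which Vitali's covering lemma applies: the mean
  of \<open>W\<close> over a ball is at most a constant times almost every value of \<open>W\<close> on that ball. The exceptional
  null set does not depend on the ball. The dimension is a parameter \<open>N\<close>, so that the constants below
  are functions of \<open>A\<close> and \<open>N\<close> alone; this is essential because the weight will vary with the cubes and
  the coefficients.\<close>

locale A1_weight =
  fixes W :: "real ^ 'n \<Rightarrow> real" and A :: real and N :: nat
  assumes N: "N = CARD('n)"
    and measurable_W [measurable]: "W \<in> borel_measurable lebesgue"
    and W_pos: "\<And>x. 0 < W x"
    and A_pos: "0 < A"
    and A1: "AE y in lebesgue. \<forall>c r. y \<in> ball c r \<longrightarrow>
      (\<integral>\<^sup>+x\<in>ball c r. ennreal (W x) \<partial>lebesgue) \<le> ennreal (A * r ^ N * W y)"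
begin

definition \<nu> :: "(real ^ 'n) measure" where
  "\<nu> = density lebesgue (\<lambda>x. ennreal (W x))"

lemma sets_\<nu> [simp, measurable_cong]: "sets \<nu> = sets lebesgue"
  by (simp add: \<nu>_def)

lemma space_\<nu> [simp]: "space \<nu> = UNIV"
  by (simp add: \<nu>_def)

lemma ball_sets [measurable]: "ball (c :: real ^ 'n) r \<in> sets lebesgue"
  by simp

lemma emeasure_\<nu>: "S \<in> sets lebesgue \<Longrightarrow> emeasure \<nu> S = (\<integral>\<^sup>+x\<in>S. ennreal (W x) \<partial>lebesgue)"
  by (simp add: \<nu>_def emeasure_density)

lemma A1_ball: "AE y in lebesgue. \<forall>c r. y \<in> ball c r \<longrightarrow>
    emeasure \<nu> (ball c r) \<le> ennreal (A * r ^ N * W y)"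
  using A1 by (simp add: emeasure_\<nu>)

text \<open>Integration of the \<open>A\<^sub>1\<close> condition over \<open>S\<close>: a set that fills a fixed proportion of a ball also
  has a fixed proportion of its \<open>\<nu>\<close>-measure. Doubling and reverse doubling are the cases of a
  concentric ball and of an annulus.\<close>

lemma ball_subset_estimate:
  assumes S: "S \<in> sets lebesgue" "S \<subseteq> ball c r" and r: "0 < r"
  shows "emeasure \<nu> (ball c r) * emeasure lebesgue S \<le> ennreal (A * r ^ N) * emeasure \<nu> S"
proof -
  have "emeasure \<nu> (ball c r) * emeasure lebesgue S = (\<integral>\<^sup>+y\<in>S. emeasure \<nu> (ball c r) \<partial>lebesgue)"
    using S by (simp add: nn_integral_cmult_indicator)
  also have "\<dots> \<le> (\<integral>\<^sup>+y. ennreal (A * r ^ N) * (ennreal (W y) * indicator S y) \<partial>lebesgue)"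
    using A1_ball A_pos r W_pos S(2)
    by (intro nn_integral_mono_AE) (auto split: split_indicator simp: ennreal_mult'[symmetric] less_imp_le
      elim!: eventually_mono)
  also have "\<dots> = ennreal (A * r ^ N) * emeasure \<nu> S"
    using S by (simp add: nn_integral_cmult emeasure_\<nu>)
  finally show ?thesis .
qed

abbreviation "unit_vol \<equiv> unit_ball_vol (real N)"

lemma lborel_ball: "0 \<le> r \<Longrightarrow> emeasure lborel (ball (c :: real ^ 'n) r) = ennreal (unit_vol * r ^ N)"
  by (simp add: emeasure_ball N)

lemma ball_not_AE_empty: assumes "0 < r" shows "\<not> (AE y in lebesgue. y \<notin> ball (c :: real ^ 'n) r)"
proof
  assume "AE y in lebesgue. y \<notin> ball c r"
  then have "emeasure lebesgue (ball c r) = 0"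
    by (subst (asm) AE_iff_null_sets[symmetric]) auto
  then show False
    using lborel_ball[of r c] assms unit_ball_vol_pos[of N] by (simp del: unit_ball_vol_pos)
qed

lemma unit_vol_pos: "0 < unit_vol" by simp

lemma ball_finite: "emeasure \<nu> (ball c r) < \<infinity>"
proof (cases "0 < r")
  case True
  have "\<exists>y. y \<in> ball c r \<and> emeasure \<nu> (ball c r) \<le> ennreal (A * r ^ N * W y)"
  proof (rule ccontr)
    assume "\<not> ?thesis"
    then have "AE y in lebesgue. y \<notin> ball c r"
      using A1_ball by (auto simp del: mem_ball elim!: eventually_mono)
    then show False using ball_not_AE_empty[OF True] by blast
  qed
  then show ?thesis using ennreal_less_top order.strict_trans1 by (metis infinity_ennreal_def)
qed (simp add: ball_empty)

lemma ball_pos: assumes "0 < r" shows "0 < emeasure \<nu> (ball c r)"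
proof (rule ccontr)
  assume "\<not> ?thesis"
  then have "(\<integral>\<^sup>+x\<in>ball c r. ennreal (W x) \<partial>lebesgue) = 0"
    by (simp add: emeasure_\<nu>)
  then have "AE x in lebesgue. ennreal (W x) * indicator (ball c r) x = 0"
    by (subst (asm) nn_integral_0_iff_AE) auto
  then have "AE y in lebesgue. y \<notin> ball c r"
    using W_pos by (auto elim!: eventually_mono split: split_indicator_asm simp: ennreal_eq_0_iff not_le[symmetric]
      simp del: mem_ball)
  then show False using ball_not_AE_empty[OF assms] by blast
qed

definition V :: "real ^ 'n \<Rightarrow> real \<Rightarrow> real" where "V c r = measure \<nu> (ball c r)"

lemma emeasure_ball_V: "emeasure \<nu> (ball c r) = ennreal (V c r)"
  using ball_finite[of c r] by (simp add: V_def emeasure_eq_ennreal_measure)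

lemma V_pos: "0 < r \<Longrightarrow> 0 < V c r"
  using ball_pos[of r c] by (simp add: emeasure_ball_V)

definition doubling_const :: real where "doubling_const = A * 5 ^ N / unit_vol"

lemma doubling_const_pos: "0 < doubling_const" using A_pos unit_vol_pos by (simp add: doubling_const_def)

lemma doubling: assumes "0 < r" shows "V c (5 * r) \<le> doubling_const * V c r"
proof -
  have "ennreal (V c (5*r)) * ennreal (unit_vol * r ^ N) \<le> ennreal (A * (5*r) ^ N) * ennreal (V c r)"
    using ball_subset_estimate[of "ball c r" c "5*r"] assms
    by (simp add: lborel_ball emeasure_ball_V subset_ball)
  then have "V c (5*r) * (unit_vol * r ^ N) \<le> (A * (5*r) ^ N) * V c r"
    using assms A_pos V_pos[of r c] V_pos[of "5*r" c] by (simp add: ennreal_mult'[symmetric])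
  then have "r ^ N * (V c (5*r) * unit_vol) \<le> r ^ N * (A * 5 ^ N * V c r)"
    by (simp add: power_mult_distrib algebra_simps)
  then have "V c (5*r) * unit_vol \<le> A * 5 ^ N * V c r"
    using assms by (subst (asm) mult_le_cancel_left_pos) auto
  then show ?thesis using unit_vol_pos by (simp add: doubling_const_def field_simps)
qed

definition \<rho> :: real where "\<rho> = 1 - unit_vol / (2 * A)"

lemma \<rho>_less_1: "\<rho> < 1" using A_pos unit_vol_pos by (simp add: \<rho>_def)

text \<open>The annulus \<open>B(c, 2r) - B(c, r)\<close> fills at least half of the larger ball, hence has a fixed
  proportion of its \<open>\<nu>\<close>-measure.\<close>

lemma reverse_doubling: assumes "0 < r" shows "V c r \<le> \<rho> * V c (2 * r)"
proof -
  define n where "n = N"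
  have n: "0 < n" by (simp add: n_def N)
  let ?S = "ball c (2*r) - ball c r"
  have sub: "ball c r \<subseteq> ball c (2*r)" using assms by (simp add: subset_ball)
  have leb: "emeasure lebesgue ?S = ennreal (unit_vol * (2*r)^n - unit_vol * r^n)"
    using sub assms by (subst emeasure_Diff) (auto simp: lborel_ball n_def ennreal_minus)
  have nu: "emeasure \<nu> ?S = ennreal (V c (2*r) - V c r)"
    using sub assms ball_finite[of c r] V_pos[OF assms, of c]
    by (subst emeasure_Diff) (auto simp: emeasure_ball_V ennreal_minus)
  have mono: "V c r \<le> V c (2*r)"
  proof -
    have "emeasure \<nu> (ball c r) \<le> emeasure \<nu> (ball c (2*r))" by (intro emeasure_mono sub) auto
    then show ?thesis using V_pos[of r c] V_pos[of "2*r" c] assms by (simp add: emeasure_ball_V)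
  qed
  have pw: "2 * r^n \<le> (2*r)^n"
    using assms n self_le_power[of 2 n] by (simp add: power_mult_distrib)
  have "ennreal (V c (2*r)) * ennreal (unit_vol * (2*r)^n - unit_vol * r^n) \<le> ennreal (A * (2*r)^n) * ennreal (V c (2*r) - V c r)"
    using ball_subset_estimate[of ?S c "2*r"] assms leb nu by (auto simp: emeasure_ball_V n_def)
  moreover have "0 \<le> unit_vol * (2*r)^n - unit_vol * r^n"
    using pw unit_vol_pos assms by (simp add: mult_left_mono)
  ultimately have "V c (2*r) * (unit_vol * (2*r)^n - unit_vol * r^n) \<le> (A * (2*r)^n) * (V c (2*r) - V c r)"
    using assms A_pos V_pos[of "2*r" c] mono by (simp add: ennreal_mult'[symmetric])
  moreover have "V c (2*r) * (unit_vol * ((2*r)^n / 2)) \<le> V c (2*r) * (unit_vol * (2*r)^n - unit_vol * r^n)"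
    using pw unit_vol_pos V_pos[of "2*r" c] assms
    by (intro mult_left_mono) (auto simp: right_diff_distrib[symmetric] simp del: unit_ball_vol_pos intro!: mult_left_mono)
  ultimately have "(2*r)^n * (V c (2*r) * (unit_vol/2)) \<le> (2*r)^n * (A * (V c (2*r) - V c r))"
    by (simp add: algebra_simps)
  then have "V c (2*r) * (unit_vol/2) \<le> A * (V c (2*r) - V c r)"
    using assms by (subst (asm) mult_le_cancel_left_pos) auto
  then show ?thesis using A_pos by (simp add: \<rho>_def field_simps)
qed

lemma \<rho>_pos: "0 < \<rho>"
  using reverse_doubling[of 1 0] V_pos[of 1 0] V_pos[of 2 0] by (auto simp: zero_less_mult_iff dest: order.strict_trans2)

text \<open>The maximal operator over balls that contain \<open>x\<close> and need not be centred at it: its level sets are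
  unions of open balls, which settles measurability. The bound \<open>R\<close> on the radii is required by the
  covering lemma; no estimate depends on it.\<close>

definition max_op :: "real \<Rightarrow> (real ^ 'n \<Rightarrow> ennreal) \<Rightarrow> real ^ 'n \<Rightarrow> ennreal" where
  "max_op R \<phi> x = (SUP (c, r)\<in>{(c, r). 0 < r \<and> r \<le> R \<and> x \<in> ball c r}.
     (\<integral>\<^sup>+y\<in>ball c r. \<phi> y \<partial>\<nu>) / emeasure \<nu> (ball c r))"

lemma max_op_level:
  "{x. t < max_op R \<phi> x} = (\<Union>(c, r)\<in>{(c, r). 0 < r \<and> r \<le> R \<and>
      t < (\<integral>\<^sup>+y\<in>ball c r. \<phi> y \<partial>\<nu>) / emeasure \<nu> (ball c r)}. ball c r)" (is "?L = ?R")
proof (intro set_eqI iffI)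
  fix x
  show "x \<in> ?R" if "x \<in> ?L"
  proof -
    from that obtain i where "i \<in> {(c, r). 0 < r \<and> r \<le> R \<and> x \<in> ball c r}"
      "t < (case i of (c, r) \<Rightarrow> (\<integral>\<^sup>+y\<in>ball c r. \<phi> y \<partial>\<nu>) / emeasure \<nu> (ball c r))"
      unfolding max_op_def mem_Collect_eq less_SUP_iff by blast
    then show ?thesis by (intro UN_I[of i]) auto
  qed
  show "x \<in> ?L" if x: "x \<in> ?R"
  proof -
    from x obtain i where i: "i \<in> {(c, r). 0 < r \<and> r \<le> R \<and>
        t < (\<integral>\<^sup>+y\<in>ball c r. \<phi> y \<partial>\<nu>) / emeasure \<nu> (ball c r)}" "x \<in> (case i of (c, r) \<Rightarrow> ball c r)"
      by blast
    then show ?thesis unfolding max_op_def mem_Collect_eq less_SUP_iff by (intro bexI[of _ i]) auto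
  qed
qed

lemma open_max_op_level: "open {x. t < max_op R \<phi> x}"
  unfolding max_op_level by (intro open_UN) auto

lemma measurable_max_op [measurable]: "max_op R \<phi> \<in> borel_measurable borel"
  by (rule borel_measurableI_greater) (simp add: open_max_op_level borel_open)

lemma measurable_max_op' [measurable]: "max_op R \<phi> \<in> borel_measurable lebesgue"
  by (rule measurable_completion) (simp add: measurable_max_op)

text \<open>Vitali's covering argument. The part of \<open>\<phi>\<close> below \<open>t/2\<close> contributes at most \<open>t/2\<close> to a mean, so on each
  ball of the covering the part above \<open>t/2\<close> accounts for at least half of the mean. Restriction of the
  right-hand side to that part makes the layer cake integral for the \<open>L\<^sup>2\<close> bound converge.\<close>

lemma max_op_weak_type:
  assumes [measurable]: "\<phi> \<in> borel_measurable lebesgue" and t: "0 < t"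
  shows "emeasure \<nu> {x. ennreal t < max_op R \<phi> x} \<le>
    ennreal (2 * doubling_const / t) * (\<integral>\<^sup>+x\<in>{x. ennreal (t / 2) < \<phi> x}. \<phi> x \<partial>\<nu>)"
proof -
  define K where "K = {(c, r). 0 < r \<and> r \<le> R \<and>
      ennreal t < (\<integral>\<^sup>+y\<in>ball c r. \<phi> y \<partial>\<nu>) / emeasure \<nu> (ball c r)}"
  let ?B = "\<lambda>i. ball (fst i) (snd i)"
  let ?S = "{x. ennreal t < max_op R \<phi> x}"
  let ?\<psi> = "\<lambda>x. \<phi> x * indicator {x. ennreal (t / 2) < \<phi> x} x"
  have S: "?S = (\<Union>i\<in>K. ?B i)" unfolding max_op_level K_def by (simp only: case_prod_beta')
  obtain C where C: "countable C" "C \<subseteq> K" "pairwise (\<lambda>i j. disjnt (?B i) (?B j)) C"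
     "?S \<subseteq> (\<Union>i\<in>C. ball (fst i) (5 * snd i))"
  proof (rule Vitali_covering_lemma_balls[where S="?S" and K=K and a=fst and r=snd and B=R])
    show "?S \<subseteq> (\<Union>i\<in>K. ?B i)" using S by (rule equalityD1)
    show "0 < snd i \<and> snd i \<le> R" if "i \<in> K" for i
      using that by (simp add: K_def split_beta)
  qed (rule that)
  have one: "emeasure \<nu> (ball (fst i) (5 * snd i)) \<le> ennreal (2 * doubling_const / t) * (\<integral>\<^sup>+x. ?\<psi> x * indicator (?B i) x \<partial>\<nu>)"
    if "i \<in> C" for i
  proof -
    obtain c r where i: "i = (c, r)" by (cases i)
    have r: "0 < r" and big: "ennreal t < (\<integral>\<^sup>+y\<in>ball c r. \<phi> y \<partial>\<nu>) / emeasure \<nu> (ball c r)"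
      using that C(2) i by (auto simp: K_def)
    let ?v = "V c r"
    have v: "0 < ?v" by (rule V_pos[OF r])
    have "ennreal t * ennreal ?v \<le> (\<integral>\<^sup>+y\<in>ball c r. \<phi> y \<partial>\<nu>)"
    proof -
      have "ennreal t * ennreal ?v \<le> (\<integral>\<^sup>+y\<in>ball c r. \<phi> y \<partial>\<nu>) / ennreal ?v * ennreal ?v"
        using big by (intro mult_right_mono) (auto simp: emeasure_ball_V less_imp_le)
      also have "\<dots> = (\<integral>\<^sup>+y\<in>ball c r. \<phi> y \<partial>\<nu>) * ennreal ?v / ennreal ?v"
        by (simp only: mult.commute[of _ "ennreal ?v"] ennreal_times_divide)
      also have "\<dots> = (\<integral>\<^sup>+y\<in>ball c r. \<phi> y \<partial>\<nu>)"
        using v by (intro mult_divide_eq_ennreal) auto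
      finally show ?thesis .
    qed
    also have "\<dots> \<le> (\<integral>\<^sup>+y. ennreal (t/2) * indicator (ball c r) y + ?\<psi> y * indicator (ball c r) y \<partial>\<nu>)"
      by (intro nn_integral_mono) (auto split: split_indicator)
    also have "\<dots> = ennreal (t/2) * ennreal ?v + (\<integral>\<^sup>+y. ?\<psi> y * indicator (ball c r) y \<partial>\<nu>)"
      by (subst nn_integral_add) (auto simp: nn_integral_cmult_indicator emeasure_ball_V)
    finally have *: "ennreal (t * ?v) \<le> ennreal (t/2 * ?v) + (\<integral>\<^sup>+y. ?\<psi> y * indicator (ball c r) y \<partial>\<nu>)"
      using t v by (simp add: ennreal_mult'[symmetric] del: times_divide_eq_left)
    have "ennreal (t/2 * ?v) \<le> (\<integral>\<^sup>+y. ?\<psi> y * indicator (ball c r) y \<partial>\<nu>)"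
    proof (cases "(\<integral>\<^sup>+y. ?\<psi> y * indicator (ball c r) y \<partial>\<nu>)")
      case (real z)
      then show ?thesis using * t v
        by (simp add: ennreal_plus[symmetric] del: ennreal_plus)
    qed simp
    then have "ennreal (2 * doubling_const / t) * ennreal (t/2 * ?v) \<le> ennreal (2 * doubling_const / t) * (\<integral>\<^sup>+y. ?\<psi> y * indicator (ball c r) y \<partial>\<nu>)"
      by (intro mult_left_mono) auto
    moreover have "ennreal (V c (5*r)) \<le> ennreal (2 * doubling_const / t) * ennreal (t/2 * ?v)"
      using doubling[OF r, of c] t v doubling_const_pos by (simp add: ennreal_mult'[symmetric])
    ultimately show ?thesis by (simp add: i emeasure_ball_V)
  qed
  have "emeasure \<nu> ?S \<le> emeasure \<nu> (\<Union>i\<in>C. ball (fst i) (5 * snd i))"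
    using C by (intro emeasure_mono sets.countable_UN') auto
  also have "\<dots> \<le> (\<integral>\<^sup>+i. emeasure \<nu> (ball (fst i) (5 * snd i)) \<partial>count_space C)"
    using C(1) by (rule emeasure_UN_countable_le) auto
  also have "\<dots> \<le> (\<integral>\<^sup>+i. ennreal (2 * doubling_const / t) * (\<integral>\<^sup>+x. ?\<psi> x * indicator (?B i) x \<partial>\<nu>) \<partial>count_space C)"
    using one by (intro nn_integral_mono) auto
  also have "\<dots> = ennreal (2 * doubling_const / t) * (\<integral>\<^sup>+i. emeasure (density \<nu> ?\<psi>) (?B i) \<partial>count_space C)"
    by (simp add: nn_integral_cmult emeasure_density)
  also have "(\<integral>\<^sup>+i. emeasure (density \<nu> ?\<psi>) (?B i) \<partial>count_space C) = emeasure (density \<nu> ?\<psi>) (\<Union>i\<in>C. ?B i)"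
    using C by (subst emeasure_UN_countable)
      (auto simp: disjoint_family_on_def pairwise_def disjnt_def)
  also have "\<dots> \<le> emeasure (density \<nu> ?\<psi>) UNIV"
    using emeasure_space[of "density \<nu> ?\<psi>"] by simp
  also have "\<dots> = (\<integral>\<^sup>+x. ?\<psi> x \<partial>\<nu>)"
    by (subst emeasure_density) (auto intro!: nn_integral_cong)
  finally show ?thesis by - (erule meta_mp, erule mult_left_mono, rule zero_le)
qed

lemma sigma_finite_\<nu>: "sigma_finite_measure \<nu>"
proof
  show "\<exists>A. countable A \<and> A \<subseteq> sets \<nu> \<and> \<Union> A = space \<nu> \<and> (\<forall>a\<in>A. emeasure \<nu> a \<noteq> \<infinity>)"
    using ball_finite
    by (intro exI[of _ "range (\<lambda>k::nat. ball 0 (real k))"])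
      (auto simp: \<nu>_def less_top[symmetric] reals_Archimedean2)
qed

text \<open>Marcinkiewicz interpolation between the weak type estimate and the trivial \<open>L\<^sup>\<infinity>\<close> bound, in the form of a
  layer cake integral and Tonelli's theorem.\<close>

lemma max_op_L2_bound:
  assumes [measurable]: "\<phi> \<in> borel_measurable lebesgue"
  shows "(\<integral>\<^sup>+x. (max_op R \<phi> x)\<^sup>2 \<partial>\<nu>) \<le> ennreal (16 * doubling_const) * (\<integral>\<^sup>+x. (\<phi> x)\<^sup>2 \<partial>\<nu>)"
proof -
  interpret sigma_finite_measure \<nu> by (rule sigma_finite_\<nu>)
  interpret pair_sigma_finite lborel \<nu> by unfold_locales
  let ?M = "max_op R \<phi>"
  have M[measurable]: "?M \<in> borel_measurable \<nu>" using measurable_max_op' by (simp add: measurable_cong_sets[OF sets_\<nu> refl])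
  have \<phi>[measurable]: "\<phi> \<in> borel_measurable \<nu>" by (simp add: measurable_cong_sets[OF sets_\<nu> refl])
  have "(\<integral>\<^sup>+x. (?M x)\<^sup>2 \<partial>\<nu>) \<le> (\<integral>\<^sup>+x. 2 * (\<integral>\<^sup>+t. ennreal (2 * t) * indicator {t. 0 < t \<and> ennreal t < ?M x} t \<partial>lborel) \<partial>\<nu>)"
    by (intro nn_integral_mono layer_cake_square)
  also have "\<dots> = 2 * (\<integral>\<^sup>+x. (\<integral>\<^sup>+t. ennreal (2 * t) * indicator {t. 0 < t \<and> ennreal t < ?M x} t \<partial>lborel) \<partial>\<nu>)"
    by (rule nn_integral_cmult) measurable
  also have "(\<integral>\<^sup>+x. (\<integral>\<^sup>+t. ennreal (2 * t) * indicator {t. 0 < t \<and> ennreal t < ?M x} t \<partial>lborel) \<partial>\<nu>)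
    = (\<integral>\<^sup>+t. (\<integral>\<^sup>+x. ennreal (2 * t) * indicator {t. 0 < t \<and> ennreal t < ?M x} t \<partial>\<nu>) \<partial>lborel)"
    by (rule Fubini') measurable
  also have "\<dots> \<le> (\<integral>\<^sup>+t. (\<integral>\<^sup>+x. ennreal (4 * doubling_const) * (\<phi> x * indicator {t. 0 < t \<and> ennreal (t/2) < \<phi> x} t) \<partial>\<nu>) \<partial>lborel)"
  proof (rule nn_integral_mono)
    fix t :: real
    show "(\<integral>\<^sup>+x. ennreal (2 * t) * indicator {t. 0 < t \<and> ennreal t < ?M x} t \<partial>\<nu>)
      \<le> (\<integral>\<^sup>+x. ennreal (4 * doubling_const) * (\<phi> x * indicator {t. 0 < t \<and> ennreal (t/2) < \<phi> x} t) \<partial>\<nu>)"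
    proof (cases "0 < t")
      case True
      have set: "{x. ennreal t < ?M x} \<in> sets \<nu>"
        using open_max_op_level[of "ennreal t" R \<phi>] by simp
      have "(\<integral>\<^sup>+x. ennreal (2 * t) * indicator {t. 0 < t \<and> ennreal t < ?M x} t \<partial>\<nu>)
        = (\<integral>\<^sup>+x. ennreal (2 * t) * indicator {x. ennreal t < ?M x} x \<partial>\<nu>)"
        using True by (intro nn_integral_cong) (auto split: split_indicator)
      also have "\<dots> = ennreal (2 * t) * emeasure \<nu> {x. ennreal t < ?M x}"
        using set by (rule nn_integral_cmult_indicator)
      also have "\<dots> \<le> ennreal (2 * t) * (ennreal (2 * doubling_const / t) * (\<integral>\<^sup>+x\<in>{x. ennreal (t / 2) < \<phi> x}. \<phi> x \<partial>\<nu>))"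
        by (intro mult_left_mono max_op_weak_type True) auto
      also have "\<dots> = ennreal (4 * doubling_const) * (\<integral>\<^sup>+x\<in>{x. ennreal (t / 2) < \<phi> x}. \<phi> x \<partial>\<nu>)"
        using True doubling_const_pos by (simp add: mult.assoc[symmetric] ennreal_mult'[symmetric])
      also have "\<dots> = (\<integral>\<^sup>+x. ennreal (4 * doubling_const) * (\<phi> x * indicator {t. 0 < t \<and> ennreal (t/2) < \<phi> x} t) \<partial>\<nu>)"
        using True by (subst nn_integral_cmult[symmetric]) (auto intro!: nn_integral_cong split: split_indicator)
      finally show ?thesis .
    qed simp
  qed
  also have "\<dots> = (\<integral>\<^sup>+x. (\<integral>\<^sup>+t. ennreal (4 * doubling_const) * (\<phi> x * indicator {t. 0 < t \<and> ennreal (t/2) < \<phi> x} t) \<partial>lborel) \<partial>\<nu>)"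
    by (rule Fubini'[symmetric]) measurable
  also have "\<dots> = (\<integral>\<^sup>+x. ennreal (4 * doubling_const) * (\<phi> x * (\<integral>\<^sup>+t. indicator {t. 0 < t \<and> ennreal (t/2) < \<phi> x} t \<partial>lborel)) \<partial>\<nu>)"
    by (simp add: nn_integral_cmult)
  also have "\<dots> \<le> (\<integral>\<^sup>+x. ennreal (4 * doubling_const) * (\<phi> x * (2 * \<phi> x)) \<partial>\<nu>)"
    by (intro nn_integral_mono mult_left_mono layer_cake_linear) auto
  also have "\<dots> = (\<integral>\<^sup>+x. (ennreal (4 * doubling_const) * 2) * (\<phi> x)\<^sup>2 \<partial>\<nu>)"
    by (simp add: power2_eq_square algebra_simps)
  also have "\<dots> = (ennreal (4 * doubling_const) * 2) * (\<integral>\<^sup>+x. (\<phi> x)\<^sup>2 \<partial>\<nu>)"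
    by (rule nn_integral_cmult) measurable
  finally have "(\<integral>\<^sup>+x. (?M x)\<^sup>2 \<partial>\<nu>) \<le> 2 * (ennreal (4 * doubling_const) * 2 * (\<integral>\<^sup>+x. (\<phi> x)\<^sup>2 \<partial>\<nu>))"
    by (simp add: mult_left_mono)
  moreover have "ennreal (16 * doubling_const) = 2 * (ennreal (4 * doubling_const) * 2)"
    using doubling_const_pos by (simp add: ennreal_mult'[symmetric] ennreal_numeral[symmetric] del: ennreal_numeral)
  ultimately show ?thesis by (simp add: mult.assoc)
qed

subsection \<open>A weighted inequality for sums of cubes with constant exponents\<close>

definition scale_const :: "real \<Rightarrow> real \<Rightarrow> real" where
  "scale_const a b = 2 ^ N * (A * (2 * real N) ^ N) powr (1 - a * b)"

lemma N_pos: "0 < N" by (simp add: N)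

text \<open>For \<open>b \<le> 1\<close> and \<open>0 \<le> u \<le> 1\<close> one has \<open>u \<le> u\<^sup>b\<close>. Applied to \<open>u = (\<Sum>j\<in>I. c j / S * indicator (Q j))\<close> this gives
  \<open>S\<^sup>b u \<le> f\<^sup>b\<close> although \<open>f\<^sup>b\<close> is not additive in the cubes, and integration of \<open>u\<close> costs only the volume of
  a single cube. On the right, the \<open>A\<^sub>1\<close> lower bound for \<open>W\<close> on the ball turns Lebesgue measure into \<open>\<nu>\<close>:
  the power of \<open>W\<close> that compensates the factor \<open>W^(-a)\<close> has the negative exponent \<open>a b - 1\<close>.\<close>

lemma one_scale_estimate:
  fixes z :: "'j \<Rightarrow> real ^ 'n" and L :: real and f :: "real ^ 'n \<Rightarrow> real"
  assumes I: "finite I" and b: "0 < b" "b \<le> 1" and ab: "0 < a" "a * b < 1" and L: "0 < L"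
    and l: "\<And>j. j \<in> I \<Longrightarrow> L / 2 < l j \<and> l j \<le> L"
    and x: "\<And>j. j \<in> I \<Longrightarrow> x \<in> cbox (z j) (z j + vec (l j))"
    and c: "\<And>j. j \<in> I \<Longrightarrow> 0 \<le> c j"
    and [measurable]: "f \<in> borel_measurable lebesgue"
    and f: "\<And>y. (\<Sum>j\<in>I. c j * indicator (cbox (z j) (z j + vec (l j))) y) \<le> f y"
  shows "ennreal (((L ^ N) powr a * (\<Sum>j\<in>I. c j)) powr b) \<le>
    ennreal (scale_const a b * V x (2 * real N * L) powr (a * b - 1)) *
    (\<integral>\<^sup>+y\<in>ball x (2 * real N * L). ennreal ((f y * W y powr (- a)) powr b) \<partial>\<nu>)"
proof (cases "(\<Sum>j\<in>I. c j) = 0")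
  case True
  then show ?thesis using b by simp
next
  case False
  define S where "S = (\<Sum>j\<in>I. c j)"
  have S: "0 < S" using False sum_nonneg[of I c] c by (force simp: S_def)
  let ?Q = "\<lambda>j. cbox (z j) (z j + vec (l j))"
  define R :: real where "R = 2 * real N * L"
  have R: "0 < R" using L N_pos by (simp add: R_def)
  define v where "v = V x R"
  have v: "0 < v" using V_pos[OF R] by (simp add: v_def)
  define \<phi> where "\<phi> y = (f y * W y powr (- a)) powr b" for y
  have [measurable]: "\<phi> \<in> borel_measurable lebesgue" unfolding \<phi>_def by measurable
  define k where "k = (v / (A * R ^ N)) powr (a * b - 1)"
  have k: "0 < k" using v A_pos R by (simp add: k_def)
  have f0: "0 \<le> f y" for y
    by (rule order_trans[OF _ f]) (auto intro!: sum_nonneg c mult_nonneg_nonneg)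
  have lpos: "0 < l j" if "j \<in> I" for j using l[OF that] L by auto
  have sub: "?Q j \<subseteq> ball x R" if "j \<in> I" for j
  proof
    fix y assume "y \<in> ?Q j"
    then have "dist x y \<le> N * l j" using cube_diameter[OF lpos x] that by (auto simp: N)
    also have "\<dots> \<le> N * L" using l[OF that] by (intro mult_left_mono) auto
    also have "\<dots> < R" using L N_pos by (simp add: R_def)
    finally show "y \<in> ball x R" by simp
  qed
  \<comment> \<open>Here \<open>u \<le> u powr b\<close> replaces the missing additivity of the power.\<close>
  have conc: "S powr b * (\<Sum>j\<in>I. c j / S * indicator (?Q j) y) \<le> f y powr b" for y
  proof -
    define u where "u = (\<Sum>j\<in>I. c j / S * indicator (?Q j) y)"
    have u0: "0 \<le> u" unfolding u_def using c S by (intro sum_nonneg) auto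
    have "u \<le> (\<Sum>j\<in>I. c j / S)" unfolding u_def using c S
      by (intro sum_mono) (auto split: split_indicator)
    also have "\<dots> = 1" using S by (simp add: S_def sum_divide_distrib[symmetric])
    finally have u1: "u \<le> 1" .
    have "u \<le> u powr b"
    proof (cases "u = 0")
      case False
      then show ?thesis using powr_mono'[of b 1 u] u0 u1 b by simp
    qed simp
    then have "S powr b * u \<le> S powr b * u powr b" using S by simp
    also have "\<dots> = (S * u) powr b" using S u0 by (simp add: powr_mult)
    also have "S * u = (\<Sum>j\<in>I. c j * indicator (?Q j) y)"
      using S by (simp add: u_def sum_distrib_left)
    also have "(\<Sum>j\<in>I. c j * indicator (?Q j) y) powr b \<le> f y powr b"
      using b by (intro powr_mono2 f sum_nonneg mult_nonneg_nonneg) (auto intro!: c)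
    finally show ?thesis by (simp add: u_def)
  qed
  have weight: "f y powr b \<le> k * (W y * \<phi> y)" if "v \<le> A * R ^ N * W y" for y
  proof -
    have "\<phi> y = f y powr b * W y powr (- (a * b))"
      using f0[of y] W_pos[of y] by (simp add: \<phi>_def powr_mult powr_powr)
    then have "f y powr b = \<phi> y * W y powr (a * b)"
      using W_pos[of y] by (simp add: powr_minus field_simps)
    also have "W y powr (a * b) = W y powr (a * b - 1) * W y"
      using W_pos[of y] powr_add[of "W y" "a * b - 1" 1] by simp
    also have "\<phi> y * (W y powr (a * b - 1) * W y) \<le> \<phi> y * (k * W y)"
    proof -
      have "v / (A * R ^ N) \<le> W y"
        using that A_pos R by (simp add: divide_le_eq mult.commute)
      then have "W y powr (a * b - 1) \<le> k"
        unfolding k_def using ab v A_pos R by (intro powr_mono2') auto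
      then show ?thesis using W_pos[of y] by (intro mult_left_mono mult_right_mono) (auto simp: \<phi>_def)
    qed
    finally show ?thesis by (simp add: algebra_simps)
  qed
  have AE1: "AE y in lebesgue. ennreal (S powr b * (\<Sum>j\<in>I. c j / S * indicator (?Q j) y)) \<le>
      ennreal k * (ennreal (W y) * (ennreal (\<phi> y) * indicator (ball x R) y))"
    using A1_ball
  proof eventually_elim
    fix y assume *: "\<forall>c r. y \<in> ball c r \<longrightarrow> emeasure \<nu> (ball c r) \<le> ennreal (A * r ^ N * W y)"
    show "ennreal (S powr b * (\<Sum>j\<in>I. c j / S * indicator (?Q j) y)) \<le>
      ennreal k * (ennreal (W y) * (ennreal (\<phi> y) * indicator (ball x R) y))"
    proof (cases "y \<in> ball x R")
      case True
      then have "ennreal v \<le> ennreal (A * R ^ N * W y)"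
        using * by (auto simp: v_def emeasure_ball_V[symmetric])
      then have "v \<le> A * R ^ N * W y" using A_pos R W_pos[of y] by (simp add: less_imp_le)
      then have "S powr b * (\<Sum>j\<in>I. c j / S * indicator (?Q j) y) \<le> k * (W y * \<phi> y)"
        using weight conc order_trans by blast
      then show ?thesis using True k W_pos[of y]
        by (simp add: ennreal_mult'[symmetric] ennreal_leI)
    next
      case False
      then have "y \<notin> ?Q j" if "j \<in> I" for j using sub[OF that] by blast
      then show ?thesis by simp
    qed
  qed
  have low: "ennreal (S powr b * (L / 2) ^ N) \<le> (\<integral>\<^sup>+y. ennreal (S powr b * (\<Sum>j\<in>I. c j / S * indicator (?Q j) y)) \<partial>lebesgue)"
  proof -
    have "(\<integral>\<^sup>+y. ennreal (S powr b * (\<Sum>j\<in>I. c j / S * indicator (?Q j) y)) \<partial>lebesgue)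
      = (\<integral>\<^sup>+y. ennreal (\<Sum>j\<in>I. (S powr b * (c j / S)) * indicator (?Q j) y) \<partial>lebesgue)"
      by (simp only: sum_distrib_left mult.assoc)
    then have eq: "(\<integral>\<^sup>+y. ennreal (S powr b * (\<Sum>j\<in>I. c j / S * indicator (?Q j) y)) \<partial>lebesgue)
      = ennreal (\<Sum>j\<in>I. (S powr b * (c j / S)) * l j ^ N)"
      using nn_integral_sum_cubes[OF I, of "\<lambda>j. S powr b * (c j / S)" l z] c S lpos by (simp add: N)
    have "S powr b * (L / 2) ^ N = (\<Sum>j\<in>I. S powr b * (c j / S) * (L / 2) ^ N)"
      using S by (simp add: S_def sum_distrib_right[symmetric] sum_distrib_left[symmetric] sum_divide_distrib[symmetric])
    also have "\<dots> \<le> (\<Sum>j\<in>I. S powr b * (c j / S) * l j ^ N)"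
      using l c S L by (intro sum_mono mult_left_mono power_mono) (auto simp: less_imp_le)
    finally show ?thesis unfolding eq by (rule ennreal_leI)
  qed
  have up: "(\<integral>\<^sup>+y. ennreal k * (ennreal (W y) * (ennreal (\<phi> y) * indicator (ball x R) y)) \<partial>lebesgue)
      = ennreal k * (\<integral>\<^sup>+y\<in>ball x R. ennreal (\<phi> y) \<partial>\<nu>)"
    unfolding \<nu>_def by (subst nn_integral_density) (auto simp: nn_integral_cmult)
  have main: "ennreal (S powr b * (L / 2) ^ N) \<le> ennreal k * (\<integral>\<^sup>+y\<in>ball x R. ennreal (\<phi> y) \<partial>\<nu>)"
    using order_trans[OF low nn_integral_mono_AE[OF AE1]] unfolding up .
  \<comment> \<open>The factor that turns \<open>S powr b * (L / 2) ^ N\<close> into the left-hand side of the claim.\<close>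
  define e where "e = 2 ^ N * (L ^ N) powr (a * b - 1)"
  have e: "0 < e" using L by (simp add: e_def)
  have "((L ^ N) powr a * S) powr b = e * (S powr b * (L / 2) ^ N)"
  proof -
    have "((L ^ N) powr a * S) powr b = (L ^ N) powr (a * b) * S powr b"
      using L S by (simp add: powr_mult powr_powr)
    also have "(L ^ N) powr (a * b) = (L ^ N) powr (a * b - 1) * L ^ N"
      using L powr_add[of "L ^ N" "a * b - 1" 1] by simp
    also have "\<dots> = e * (L / 2) ^ N" by (simp add: e_def power_divide)
    finally show ?thesis by (simp add: algebra_simps)
  qed
  moreover have "e * k = scale_const a b * v powr (a * b - 1)"
  proof -
    define X where "X = A * (2 * real N) ^ N"
    have X: "0 < X" using A_pos N_pos by (simp add: X_def)
    have "k = (v / (X * L ^ N)) powr (a * b - 1)"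
      by (simp add: k_def R_def X_def power_mult_distrib mult.assoc)
    also have "\<dots> = v powr (a * b - 1) / (X powr (a * b - 1) * (L ^ N) powr (a * b - 1))"
      using v X L by (simp only: powr_divide powr_mult less_imp_le mult_pos_pos zero_less_power)
    finally have "e * k = 2 ^ N * (v powr (a * b - 1) / X powr (a * b - 1))"
      using L by (simp add: e_def)
    also have "v powr (a * b - 1) / X powr (a * b - 1) = v powr (a * b - 1) * X powr (1 - a * b)"
      using powr_minus_divide[of X "a * b - 1"] by simp
    finally show ?thesis by (simp add: scale_const_def X_def)
  qed
  ultimately show ?thesis
    using mult_left_mono[OF main, of "ennreal e"] e k S
    unfolding \<phi>_def[symmetric] S_def[symmetric] R_def[symmetric] v_def[symmetric]
    by (simp add: ennreal_mult'[symmetric] mult.assoc[symmetric])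
qed

definition hedberg_const :: "real \<Rightarrow> real \<Rightarrow> real \<Rightarrow> real" where
  "hedberg_const a s K = (scale_const a (1 / (2 * (s + a))) powr (2 * (s + a)) * K powr a *
     (1 / (1 - \<rho> powr a) + 1 / (1 - \<rho> powr s))) powr (1 / s)"

lemma scale_const_pos: "0 < scale_const a b"
  using A_pos N_pos by (simp add: scale_const_def)

lemma \<rho>_powr_less_1: "0 < t \<Longrightarrow> \<rho> powr t < 1"
  using \<rho>_pos \<rho>_less_1 powr_less_mono2[of t \<rho> 1] by simp

lemma hedberg_const_pos:
  assumes "0 < a" "0 < s" "0 < K"
  shows "0 < hedberg_const a s K"
proof -
  have "0 < 1 / (1 - \<rho> powr a) + 1 / (1 - \<rho> powr s)"
    using \<rho>_powr_less_1[of a] \<rho>_powr_less_1[of s] assms by (intro add_pos_pos) auto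
  moreover have "0 < scale_const a (1 / (2 * (s + a))) powr (2 * (s + a)) * K powr a"
    using scale_const_pos[of a "1 / (2 * (s + a))"] assms by (intro mult_pos_pos) auto
  ultimately have "0 < scale_const a (1 / (2 * (s + a))) powr (2 * (s + a)) * K powr a *
     (1 / (1 - \<rho> powr a) + 1 / (1 - \<rho> powr s))" by (metis mult_pos_pos)
  then show ?thesis unfolding hedberg_const_def by (simp only: powr_gt_zero)
qed

lemma V_mono: assumes "0 < r" "r \<le> r'" shows "V c r \<le> V c r'"
proof -
  have "emeasure \<nu> (ball c r) \<le> emeasure \<nu> (ball c r')"
    using assms by (intro emeasure_mono subset_ball) auto
  then show ?thesis using V_pos[of r' c] assms by (simp add: emeasure_ball_V)
qed

lemma V_geometric:
  assumes L: "0 < L" and ij: "i < j"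
  shows "V x (L * 2 powr of_int i) \<le> \<rho> * V x (L * 2 powr of_int j)"
proof -
  have "V x (L * 2 powr of_int i) \<le> \<rho> * V x (2 * (L * 2 powr of_int i))"
    using L by (intro reverse_doubling) auto
  also have "2 * (L * 2 powr of_int i) = L * 2 powr of_int (i + 1)"
    by (simp add: powr_add)
  also have "\<rho> * V x (L * 2 powr of_int (i + 1)) \<le> \<rho> * V x (L * 2 powr of_int j)"
    using L ij \<rho>_pos by (intro mult_left_mono V_mono) (auto intro!: mult_left_mono powr_mono simp flip: of_int_add)
  finally show ?thesis .
qed

lemma ball_average_le_max_op:
  assumes r: "0 < r" "r \<le> R"
  shows "(\<integral>\<^sup>+y\<in>ball x r. \<phi> y \<partial>\<nu>) \<le> max_op R \<phi> x * ennreal (V x r)"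
proof -
  have v: "0 < V x r" by (rule V_pos[OF r(1)])
  have "(\<integral>\<^sup>+y\<in>ball x r. \<phi> y \<partial>\<nu>) / emeasure \<nu> (ball x r) \<le> max_op R \<phi> x"
    unfolding max_op_def using r by (intro SUP_upper2[of "(x, r)"]) auto
  then have "(\<integral>\<^sup>+y\<in>ball x r. \<phi> y \<partial>\<nu>) / ennreal (V x r) * ennreal (V x r) \<le> max_op R \<phi> x * ennreal (V x r)"
    unfolding emeasure_ball_V by (rule mult_right_mono) simp
  moreover have "(\<integral>\<^sup>+y\<in>ball x r. \<phi> y \<partial>\<nu>) / ennreal (V x r) * ennreal (V x r) = (\<integral>\<^sup>+y\<in>ball x r. \<phi> y \<partial>\<nu>)"
    using v by (simp only: mult.commute[of _ "ennreal (V x r)"] ennreal_times_divide)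
      (subst mult.commute, rule mult_divide_eq_ennreal, auto)
  ultimately show ?thesis by simp
qed

text \<open>The Cauchy--Schwarz inequality, from \<open>h \<le> t/2 + h\<^sup>2/(2t)\<close> with the optimal \<open>t\<close>.\<close>

lemma ball_integral_le_L2:
  fixes h :: "real ^ 'n \<Rightarrow> real"
  assumes r: "0 < r" and K: "0 < K" and [measurable]: "h \<in> borel_measurable lebesgue"
    and h: "\<And>y. 0 \<le> h y"
    and hK: "(\<integral>\<^sup>+y. (ennreal (h y))\<^sup>2 \<partial>\<nu>) \<le> ennreal K"
  shows "(\<integral>\<^sup>+y\<in>ball x r. ennreal (h y) \<partial>\<nu>) \<le> ennreal (sqrt (K * V x r))"
proof -
  define v where "v = V x r"
  have v: "0 < v" unfolding v_def by (rule V_pos[OF r])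
  define t where "t = sqrt (K / v)"
  have t: "0 < t" using K v by (simp add: t_def)
  have "(\<integral>\<^sup>+y\<in>ball x r. ennreal (h y) \<partial>\<nu>)
    \<le> (\<integral>\<^sup>+y. ennreal (t / 2) * indicator (ball x r) y + ennreal (1 / (2 * t)) * (ennreal (h y))\<^sup>2 \<partial>\<nu>)"
  proof (rule nn_integral_mono)
    fix y
    have "0 \<le> (h y - t)\<^sup>2" by simp
    then have "h y \<le> t / 2 + 1 / (2 * t) * (h y)\<^sup>2"
      using t by (simp add: field_simps power2_eq_square)
    then have "ennreal (h y) \<le> ennreal (t / 2) + ennreal (1 / (2 * t)) * (ennreal (h y))\<^sup>2"
      using t h[of y] by (simp add: ennreal_power ennreal_leI ennreal_mult'[symmetric] flip: ennreal_plus)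
    then show "ennreal (h y) * indicator (ball x r) y \<le>
        ennreal (t / 2) * indicator (ball x r) y + ennreal (1 / (2 * t)) * (ennreal (h y))\<^sup>2"
      by (simp split: split_indicator)
  qed
  also have "\<dots> = ennreal (t / 2) * ennreal v + ennreal (1 / (2 * t)) * (\<integral>\<^sup>+y. (ennreal (h y))\<^sup>2 \<partial>\<nu>)"
    by (subst nn_integral_add, measurable)
      (simp add: nn_integral_cmult_indicator nn_integral_cmult emeasure_ball_V v_def)
  also have "\<dots> \<le> ennreal (t / 2) * ennreal v + ennreal (1 / (2 * t)) * ennreal K"
    by (intro add_left_mono mult_left_mono hK) auto
  also have "\<dots> = ennreal (t / 2 * v + 1 / (2 * t) * K)"
    using t v K by (simp add: ennreal_mult'[symmetric] flip: ennreal_plus)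
  also have "t / 2 * v + 1 / (2 * t) * K = sqrt (K * v)"
  proof -
    have "t * v = sqrt (K * v)"
      using v by (simp add: t_def real_sqrt_divide real_sqrt_mult) (simp add: field_simps)
    moreover have "K / t = sqrt (K * v)"
      using v K by (simp add: t_def real_sqrt_divide real_sqrt_mult) (simp add: field_simps)
    ultimately show ?thesis by (simp add: field_simps)
  qed
  finally show ?thesis by (simp add: v_def)
qed

text \<open>The cubes that contain \<open>x\<close> are grouped by the dyadic size \<open>2\<^sup>k\<close> of their sides. With \<open>Z k\<close> the \<open>\<nu>\<close>-measure of
  the corresponding ball and \<open>m\<close> the maximal function at \<open>x\<close>, the group \<open>T k\<close> satisfies
  \<open>T k \<le> P m^(2(s+a)) (Z k)\<^sup>a\<close> (\<open>small\<close>) and \<open>T k \<le> P K^(s+a) (Z k)^(-s)\<close> (\<open>large\<close>). The exponents of \<open>Z k\<close> have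
  opposite signs and \<open>Z\<close> grows geometrically, so the sum over \<open>k\<close> is governed by the value \<open>\<tau>\<close> of \<open>Z k\<close>
  at which the two bounds agree. The exponent \<open>b = 1/(2(s+a))\<close> is chosen so that the hypothesis on
  \<open>F = f W^(-a)\<close> becomes an \<open>L\<^sup>2\<close> bound for \<open>\<phi> = F\<^sup>b\<close>.\<close>

lemma hedberg_pointwise:
  fixes z :: "'j \<Rightarrow> real ^ 'n" and l c :: "'j \<Rightarrow> real" and J :: "'j set"
  defines "Q \<equiv> \<lambda>j. cbox (z j) (z j + vec (l j))"
  defines "f \<equiv> \<lambda>y. \<Sum>j\<in>J. c j * indicator (Q j) y"
  assumes J: "finite J" and a: "0 < a" and s: "1 \<le> s" and K: "0 < K"
    and l: "\<And>j. j \<in> J \<Longrightarrow> 0 < l j" and c: "\<And>j. j \<in> J \<Longrightarrow> 0 \<le> c j"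
    and R: "\<And>j. j \<in> J \<Longrightarrow> 4 * real N * l j \<le> R"
  defines "\<phi> \<equiv> \<lambda>y. (f y * W y powr (- a)) powr (1 / (2 * (s + a)))"
  assumes \<phi>K: "(\<integral>\<^sup>+y. (ennreal (\<phi> y))\<^sup>2 \<partial>\<nu>) \<le> ennreal K"
  shows "ennreal ((\<Sum>j\<in>J. c j * (l j ^ N) powr a * indicator (Q j) x) powr (1 / s))
    \<le> ennreal (hedberg_const a s K) * (max_op R (\<lambda>y. ennreal (\<phi> y)) x)\<^sup>2"
proof (cases "max_op R (\<lambda>y. ennreal (\<phi> y)) x")
  case top
  have "0 < hedberg_const a s K"
    using a s K by (intro hedberg_const_pos) auto
  then show ?thesis using top by (simp add: ennreal_mult_top)
next
  case (real m)
  define b where "b = 1 / (2 * (s + a))"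
  have b: "0 < b" "b \<le> 1" "a * b < 1" "1 / b = 2 * (s + a)"
    using a s by (auto simp: b_def field_simps)
  have [measurable]: "f \<in> borel_measurable lebesgue"
    unfolding f_def Q_def by measurable
  have [measurable]: "\<phi> \<in> borel_measurable lebesgue"
    unfolding \<phi>_def by measurable
  define i where "i j = \<lceil>log 2 (l j)\<rceil>" for j
  define L :: "int \<Rightarrow> real" where "L k = 2 powr of_int k" for k
  have L: "0 < L k" for k by (simp add: L_def)
  have li: "L (i j) / 2 < l j" "l j \<le> L (i j)" if "j \<in> J" for j
  proof -
    have "of_int (i j) - 1 < log 2 (l j)" "log 2 (l j) \<le> of_int (i j)"
      unfolding i_def by linarith+
    then have "2 powr (of_int (i j) - 1) < l j" "l j \<le> 2 powr of_int (i j)"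
      using l[OF that] by (auto simp: less_log_iff log_le_iff)
    then show "L (i j) / 2 < l j" "l j \<le> L (i j)" by (auto simp: L_def powr_diff)
  qed
  define Jx where "Jx = {j\<in>J. x \<in> Q j}"
  have Jx: "finite Jx" using J by (simp add: Jx_def)
  define S where "S k = (\<Sum>j\<in>{j\<in>Jx. i j = k}. c j)" for k
  define T where "T k = (L k ^ N) powr a * S k" for k
  have T0: "0 \<le> T k" for k unfolding T_def S_def using c by (intro mult_nonneg_nonneg sum_nonneg) (auto simp: Jx_def)
  define Z where "Z k = V x (2 * real N * L k)" for k
  have Z: "0 < Z k" for k unfolding Z_def using L[of k] N_pos by (intro V_pos) auto
  have Zstep: "Z k \<le> \<rho> * Z k'" if "k < k'" for k k'
    unfolding Z_def L_def using V_geometric[of "2 * real N" k k'] N_pos that by simp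
  let ?g = "\<Sum>j\<in>J. c j * (l j ^ N) powr a * indicator (Q j) x"
  have g0: "0 \<le> ?g" using c by (intro sum_nonneg mult_nonneg_nonneg) auto
  have gT: "?g \<le> (\<Sum>k\<in>i ` Jx. T k)"
  proof -
    have "?g = (\<Sum>j\<in>Jx. c j * (l j ^ N) powr a)"
      using J by (intro sum.mono_neutral_cong_right) (auto simp: Jx_def)
    also have "\<dots> \<le> (\<Sum>j\<in>Jx. (L (i j) ^ N) powr a * c j)"
    proof (rule sum_mono)
      fix j assume "j \<in> Jx"
      then have j: "j \<in> J" by (simp add: Jx_def)
      have "(l j ^ N) powr a \<le> (L (i j) ^ N) powr a"
        using li[OF j] l[OF j] a by (intro powr_mono2 power_mono) auto
      then show "c j * (l j ^ N) powr a \<le> (L (i j) ^ N) powr a * c j"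
        using c[OF j] by (simp add: mult.commute[of _ "c j"] mult_left_mono)
    qed
    also have "\<dots> = (\<Sum>k\<in>i ` Jx. \<Sum>j\<in>{j\<in>Jx. i j = k}. (L (i j) ^ N) powr a * c j)"
      by (rule sum.image_gen[OF Jx])
    also have "\<dots> = (\<Sum>k\<in>i ` Jx. T k)"
      unfolding T_def S_def sum_distrib_left by (intro sum.cong refl) auto
    finally show ?thesis .
  qed
  define P where "P = scale_const a b powr (2 * (s + a))"
  have P: "0 < P" using scale_const_pos[of a b] by (simp add: P_def)
  have raise: "T k \<le> P * X powr (2 * (s + a))"
    if "T k powr b \<le> scale_const a b * X" "0 \<le> X" for k X
  proof -
    have "T k = (T k powr b) powr (1 / b)" using T0[of k] b(1) by (simp add: powr_powr)
    also have "\<dots> \<le> (scale_const a b * X) powr (1 / b)" using that b(1) by (intro powr_mono2) auto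
    also have "\<dots> = P * X powr (2 * (s + a))"
      unfolding P_def b(4) using scale_const_pos[of a b] that(2) by (simp add: powr_mult)
    finally show ?thesis .
  qed
  have scale: "ennreal (T k powr b) \<le> ennreal (scale_const a b * Z k powr (a * b - 1)) *
      (\<integral>\<^sup>+y\<in>ball x (2 * real N * L k). ennreal (\<phi> y) \<partial>\<nu>)" for k
    unfolding T_def S_def Z_def \<phi>_def b_def[symmetric]
  proof (rule one_scale_estimate)
    show "L k / 2 < l j \<and> l j \<le> L k" if "j \<in> {j\<in>Jx. i j = k}" for j
      using that li[of j] by (auto simp: Jx_def)
    show "(\<Sum>j\<in>{j\<in>Jx. i j = k}. c j * indicator (cbox (z j) (z j + vec (l j))) y) \<le> f y" for y
      unfolding f_def Q_def using J c by (intro sum_mono2 mult_nonneg_nonneg) (auto simp: Jx_def)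
  qed (use J b(1-3) a L c in \<open>auto simp: Jx_def Q_def\<close>)
  have Tb: "T k powr b \<le> scale_const a b * Z k powr (a * b - 1) * X"
    if "(\<integral>\<^sup>+y\<in>ball x (2 * real N * L k). ennreal (\<phi> y) \<partial>\<nu>) \<le> ennreal X" "0 \<le> X" for k X
  proof -
    have "ennreal (T k powr b) \<le> ennreal (scale_const a b * Z k powr (a * b - 1)) * ennreal X"
      by (rule order_trans[OF scale mult_left_mono[OF that(1)]]) simp
    then show ?thesis using that(2) scale_const_pos[of a b]
      by (simp add: ennreal_mult'[symmetric])
  qed
  have small: "T k \<le> P * m powr (2 * (s + a)) * Z k powr a" if k: "k \<in> i ` Jx" for k
  proof -
    have rad: "2 * real N * L k \<le> R" "0 < 2 * real N * L k"
    proof -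
      obtain j where j: "j \<in> J" "k = i j" using k by (auto simp: Jx_def)
      have "2 * real N * L k \<le> 2 * real N * (2 * l j)"
        using li[OF j(1)] j(2) by (intro mult_left_mono) auto
      also have "\<dots> = 4 * real N * l j" by simp
      finally show "2 * real N * L k \<le> R" using R[OF j(1)] by (rule order_trans)
      show "0 < 2 * real N * L k" using N_pos L by simp
    qed
    have "(\<integral>\<^sup>+y\<in>ball x (2 * real N * L k). ennreal (\<phi> y) \<partial>\<nu>) \<le> ennreal (m * Z k)"
      using ball_average_le_max_op[OF rad(2,1), of "\<lambda>y. ennreal (\<phi> y)" x] real Z[of k]
      by (simp add: Z_def ennreal_mult')
    then have "T k powr b \<le> scale_const a b * Z k powr (a * b - 1) * (m * Z k)"
      using real Z[of k] by (intro Tb) (auto simp: less_imp_le)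
    also have "\<dots> = scale_const a b * (m * Z k powr (a * b))"
      using Z[of k] powr_add[of "Z k" "a * b - 1" 1] by simp
    finally have "T k \<le> P * (m * Z k powr (a * b)) powr (2 * (s + a))"
      using real by (intro raise) auto
    also have "(m * Z k powr (a * b)) powr (2 * (s + a)) = m powr (2 * (s + a)) * Z k powr a"
      using real b a s by (simp add: powr_mult powr_powr b_def)
    finally show ?thesis by (simp add: mult.assoc)
  qed
  have large: "T k \<le> P * K powr (s + a) * Z k powr (- s)" for k
  proof -
    have "(\<integral>\<^sup>+y\<in>ball x (2 * real N * L k). ennreal (\<phi> y) \<partial>\<nu>) \<le> ennreal (sqrt (K * Z k))"
      unfolding Z_def using \<phi>K K N_pos L by (intro ball_integral_le_L2) (auto simp: \<phi>_def)
    then have "T k powr b \<le> scale_const a b * Z k powr (a * b - 1) * sqrt (K * Z k)"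
      using K Z[of k] by (intro Tb) auto
    also have "\<dots> = scale_const a b * (K powr (1/2) * Z k powr (a * b - 1 / 2))"
      using Z[of k] K powr_add[of "Z k" "a * b - 1" "1/2"]
      by (simp add: powr_half_sqrt real_sqrt_mult algebra_simps)
    finally have "T k \<le> P * (K powr (1/2) * Z k powr (a * b - 1 / 2)) powr (2 * (s + a))"
      by (intro raise) auto
    also have "(K powr (1/2) * Z k powr (a * b - 1 / 2)) powr (2 * (s + a)) = K powr (s + a) * Z k powr (- s)"
    proof -
      have "(a * b - 1 / 2) * (2 * (s + a)) = - s"
        using a s by (simp add: b_def field_simps)
      moreover have "1 / 2 * (2 * (s + a)) = s + a" by simp
      ultimately show ?thesis by (simp only: powr_mult powr_powr)
    qed
    finally show ?thesis by (simp add: mult.assoc)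
  qed
  define G where "G = 1 / (1 - \<rho> powr a) + 1 / (1 - \<rho> powr s)"
  have \<rho>1: "\<rho> powr a < 1" "\<rho> powr s < 1"
    using \<rho>_powr_less_1 a s by auto
  have G: "0 < G" unfolding G_def using \<rho>1 by (intro add_pos_pos) auto
  have sumT: "(\<Sum>k\<in>i ` Jx. T k) \<le> P * K powr a * G * m powr (2 * s)"
  proof (cases "m = 0")
    case True
    then have "T k \<le> 0" if "k \<in> i ` Jx" for k using small[OF that] by simp
    then show ?thesis using True by (simp add: sum_nonpos)
  next
    case False
    then have m: "0 < m" using real by simp
    \<comment> \<open>At \<open>Z k = \<tau>\<close> the bounds \<open>small\<close> and \<open>large\<close> coincide.\<close>
    define \<tau> where "\<tau> = K / m powr 2"
    have \<tau>: "0 < \<tau>" using K m by (simp add: \<tau>_def)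
    let ?I = "i ` Jx"
    have fin: "finite ?I" using Jx by simp
    have "(\<Sum>k\<in>?I. T k) = (\<Sum>k\<in>{k\<in>?I. Z k \<le> \<tau>}. T k) + (\<Sum>k\<in>{k\<in>?I. \<not> Z k \<le> \<tau>}. T k)"
      using fin by (subst sum.union_disjoint[symmetric]) (auto intro!: sum.cong)
    also have "\<dots> \<le> (\<Sum>k\<in>{k\<in>?I. Z k \<le> \<tau>}. P * m powr (2 * (s + a)) * Z k powr a)
        + (\<Sum>k\<in>{k\<in>?I. \<not> Z k \<le> \<tau>}. P * K powr (s + a) * Z k powr (- s))"
      using small large by (intro add_mono sum_mono) auto
    also have "\<dots> = P * m powr (2 * (s + a)) * (\<Sum>k\<in>{k\<in>?I. Z k \<le> \<tau>}. Z k powr a)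
        + P * K powr (s + a) * (\<Sum>k\<in>{k\<in>?I. \<not> Z k \<le> \<tau>}. Z k powr (- s))"
      by (simp add: sum_distrib_left)
    also have "\<dots> \<le> P * m powr (2 * (s + a)) * (\<tau> powr a / (1 - \<rho> powr a))
        + P * K powr (s + a) * (\<tau> powr (- s) / (1 - \<rho> powr s))"
    proof (intro add_mono mult_left_mono)
      show "(\<Sum>k\<in>{k\<in>?I. Z k \<le> \<tau>}. Z k powr a) \<le> \<tau> powr a / (1 - \<rho> powr a)"
      proof (rule geometric_sum_le)
        show "Z k powr a \<le> \<rho> powr a * Z k' powr a" if "k < k'" for k k'
        proof -
          have "Z k powr a \<le> (\<rho> * Z k') powr a"
            using Zstep[OF that] Z[of k] a by (intro powr_mono2) auto
          then show ?thesis using \<rho>_pos Z[of k'] by (simp add: powr_mult)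
        qed
        show "Z k powr a \<le> \<tau> powr a" if "k \<in> {k\<in>?I. Z k \<le> \<tau>}" for k
          using that Z[of k] a by (intro powr_mono2) auto
      qed (use fin \<rho>1 \<tau> in auto)
      show "(\<Sum>k\<in>{k\<in>?I. \<not> Z k \<le> \<tau>}. Z k powr (- s)) \<le> \<tau> powr (- s) / (1 - \<rho> powr s)"
      proof (rule geometric_sum_le_rev)
        show "Z k' powr (- s) \<le> \<rho> powr s * Z k powr (- s)" if "k < k'" for k k'
        proof -
          have "(\<rho> * Z k') powr (- s) \<le> Z k powr (- s)"
            using Zstep[OF that] Z[of k] s by (intro powr_mono2') auto
          then have "\<rho> powr s * (\<rho> powr (- s) * Z k' powr (- s)) \<le> \<rho> powr s * Z k powr (- s)"
            using \<rho>_pos Z[of k'] by (intro mult_left_mono) (auto simp: powr_mult)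
          moreover have "\<rho> powr s * (\<rho> powr (- s) * Z k' powr (- s)) = Z k' powr (- s)"
            using \<rho>_pos by (simp add: powr_minus field_simps)
          ultimately show ?thesis by simp
        qed
        show "Z k powr (- s) \<le> \<tau> powr (- s)" if "k \<in> {k\<in>?I. \<not> Z k \<le> \<tau>}" for k
          using that \<tau> s by (intro powr_mono2') auto
      qed (use fin \<rho>1 \<tau> in auto)
    qed (use P in auto)
    also have "P * m powr (2 * (s + a)) * (\<tau> powr a / (1 - \<rho> powr a)) =
        P * (K powr a * m powr (2 * s)) * (1 / (1 - \<rho> powr a))"
    proof -
      have "\<tau> powr a = K powr a / m powr (2 * a)"
        using K m by (simp add: \<tau>_def powr_divide powr_powr del: powr_numeral)
      moreover have "m powr (2 * (s + a)) = m powr (2 * s) * m powr (2 * a)"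
        by (simp add: distrib_left powr_add)
      ultimately show ?thesis using m by simp
    qed
    also have "P * K powr (s + a) * (\<tau> powr (- s) / (1 - \<rho> powr s)) =
        P * (K powr a * m powr (2 * s)) * (1 / (1 - \<rho> powr s))"
    proof -
      have "\<tau> powr (- s) = K powr (- s) / m powr (- (2 * s))"
        using K m by (simp add: \<tau>_def powr_divide powr_powr del: powr_numeral)
      also have "\<dots> = m powr (2 * s) / K powr s" using K m by (simp add: powr_minus field_simps)
      finally have "\<tau> powr (- s) = m powr (2 * s) / K powr s" .
      moreover have "K powr (s + a) = K powr s * K powr a" by (simp add: powr_add)
      ultimately show ?thesis using K by simp
    qed
    finally show ?thesis by (simp add: G_def algebra_simps)
  qed
  have "?g powr (1 / s) \<le> (P * K powr a * G * m powr (2 * s)) powr (1 / s)"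
    using g0 order_trans[OF gT sumT] s by (intro powr_mono2) auto
  also have "\<dots> = (P * K powr a * G) powr (1 / s) * m powr 2"
    using P K G real s by (simp add: powr_mult powr_powr)
  also have "(P * K powr a * G) powr (1 / s) = hedberg_const a s K"
    by (simp add: hedberg_const_def P_def G_def b_def)
  also have "m powr 2 = m\<^sup>2" using real by simp
  finally have "ennreal (?g powr (1 / s)) \<le> ennreal (hedberg_const a s K * m\<^sup>2)" by (rule ennreal_leI)
  then show ?thesis using real by (simp add: ennreal_mult' ennreal_power hedberg_const_def)
qed

text \<open>The exponents fit because \<open>\<phi>\<^sup>2 W = f^(1/(s+a)) W^(1-a/(s+a))\<close> for the function \<open>\<phi>\<close> of the pointwise bound.\<close>

lemma A1_sum_of_cubes_estimate:
  fixes z :: "'j \<Rightarrow> real ^ 'n" and l c :: "'j \<Rightarrow> real" and J :: "'j set"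
  defines "Q \<equiv> \<lambda>j. cbox (z j) (z j + vec (l j))"
  assumes J: "finite J" and a: "0 < a" and s: "1 \<le> s" and K: "0 < K"
    and l: "\<And>j. j \<in> J \<Longrightarrow> 0 < l j" and c: "\<And>j. j \<in> J \<Longrightarrow> 0 \<le> c j"
    and fK: "(\<integral>\<^sup>+y. ennreal ((\<Sum>j\<in>J. c j * indicator (Q j) y) powr (1 / (s + a)) * W y powr (s / (s + a))) \<partial>lebesgue)
      \<le> ennreal K"
  shows "(\<integral>\<^sup>+x. ennreal ((\<Sum>j\<in>J. c j * (l j ^ N) powr a * indicator (Q j) x) powr (1 / s) * W x) \<partial>lebesgue)
    \<le> ennreal (hedberg_const a s K * (16 * doubling_const * K))"
proof -
  let ?f = "\<lambda>y. \<Sum>j\<in>J. c j * indicator (Q j) y"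
  let ?g = "\<lambda>x. \<Sum>j\<in>J. c j * (l j ^ N) powr a * indicator (Q j) x"
  define \<phi> where "\<phi> y = (?f y * W y powr (- a)) powr (1 / (2 * (s + a)))" for y
  have [measurable]: "?f \<in> borel_measurable lebesgue" "?g \<in> borel_measurable lebesgue"
    unfolding Q_def by measurable
  have [measurable]: "\<phi> \<in> borel_measurable lebesgue" unfolding \<phi>_def by measurable
  have f0: "0 \<le> ?f y" for y using c by (intro sum_nonneg mult_nonneg_nonneg) auto
  have "(\<integral>\<^sup>+y. (ennreal (\<phi> y))\<^sup>2 \<partial>\<nu>) = (\<integral>\<^sup>+y. ennreal (W y) * (ennreal (\<phi> y))\<^sup>2 \<partial>lebesgue)"
    unfolding \<nu>_def by (rule nn_integral_density) measurable
  also have "\<dots> = (\<integral>\<^sup>+y. ennreal (?f y powr (1 / (s + a)) * W y powr (s / (s + a))) \<partial>lebesgue)"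
  proof (rule nn_integral_cong)
    fix y
    have "(\<phi> y)\<^sup>2 = \<phi> y powr 2" by (simp add: \<phi>_def)
    also have "\<dots> = (?f y * W y powr (- a)) powr (1 / (s + a))" 
    proof -
      have "1 / (2 * (s + a)) * 2 = 1 / (s + a)" using a s by (simp add: field_simps)
      then show ?thesis by (simp only: \<phi>_def powr_powr)
    qed
    also have "\<dots> = ?f y powr (1 / (s + a)) * W y powr (- a / (s + a))"
      using f0[of y] by (simp only: powr_mult powr_ge_zero powr_powr) simp
    finally have "W y * (\<phi> y)\<^sup>2 = ?f y powr (1 / (s + a)) * (W y powr 1 * W y powr (- a / (s + a)))"
      using W_pos[of y] by (simp only: powr_one less_imp_le mult_ac)
    also have "W y powr 1 * W y powr (- a / (s + a)) = W y powr (s / (s + a))"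
      using a s unfolding powr_add[symmetric] by (simp add: field_simps)
    finally show "ennreal (W y) * (ennreal (\<phi> y))\<^sup>2 = ennreal (?f y powr (1 / (s + a)) * W y powr (s / (s + a)))"
      using W_pos[of y] by (simp add: ennreal_power ennreal_mult'[symmetric] \<phi>_def less_imp_le)
  qed
  finally have \<phi>K: "(\<integral>\<^sup>+y. (ennreal (\<phi> y))\<^sup>2 \<partial>\<nu>) \<le> ennreal K" using fK by simp
  define R where "R = (\<Sum>j\<in>J. 4 * real N * l j)"
  have R: "4 * real N * l j \<le> R" if "j \<in> J" for j
    unfolding R_def using J l that by (intro member_le_sum) (auto simp: less_imp_le)
  let ?M = "max_op R (\<lambda>y. ennreal (\<phi> y))"
  have [measurable]: "?M \<in> borel_measurable lebesgue" by (rule measurable_max_op')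
  have "(\<integral>\<^sup>+x. ennreal (?g x powr (1 / s) * W x) \<partial>lebesgue)
    \<le> (\<integral>\<^sup>+x. ennreal (W x) * (ennreal (hedberg_const a s K) * (?M x)\<^sup>2) \<partial>lebesgue)"
  proof (rule nn_integral_mono)
    fix x
    have "ennreal (?g x powr (1 / s)) \<le> ennreal (hedberg_const a s K) * (?M x)\<^sup>2"
      using hedberg_pointwise[OF J a s K l c R, where z = z and x = x] \<phi>K unfolding \<phi>_def Q_def by simp
    then have "ennreal (W x) * ennreal (?g x powr (1 / s)) \<le> ennreal (W x) * (ennreal (hedberg_const a s K) * (?M x)\<^sup>2)"
      by (rule mult_left_mono) simp
    then show "ennreal (?g x powr (1 / s) * W x) \<le> ennreal (W x) * (ennreal (hedberg_const a s K) * (?M x)\<^sup>2)"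
      using W_pos[of x] by (simp only: mult.commute[of _ "W x"] ennreal_mult' less_imp_le)
  qed
  also have "\<dots> = (\<integral>\<^sup>+x. ennreal (hedberg_const a s K) * (?M x)\<^sup>2 \<partial>\<nu>)"
    unfolding \<nu>_def by (rule nn_integral_density[symmetric]) measurable
  also have "\<dots> = ennreal (hedberg_const a s K) * (\<integral>\<^sup>+x. (?M x)\<^sup>2 \<partial>\<nu>)"
    by (rule nn_integral_cmult) measurable
  also have "\<dots> \<le> ennreal (hedberg_const a s K) * (ennreal (16 * doubling_const) * ennreal K)"
    by (intro mult_left_mono order_trans[OF max_op_L2_bound mult_left_mono[OF \<phi>K]]) auto
  also have "\<dots> = ennreal (hedberg_const a s K * (16 * doubling_const * K))"
    using doubling_const_pos K by (simp only: ennreal_mult'[symmetric] hedberg_const_def powr_ge_zero)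
  finally show ?thesis .
qed

end

section \<open>The Hardy--Littlewood operator and majorants of Rubio de Francia type\<close>

text \<open>The operator \<open>maximal_fun\<close> extended to functions with values in \<open>[0, \<infinity>]\<close>, so that it can be
  iterated.\<close>

definition HL_max :: "(real ^ 'n \<Rightarrow> ennreal) \<Rightarrow> real ^ 'n \<Rightarrow> ennreal" where
  "HL_max \<phi> x = (SUP Q\<in>{Q \<in> cubes. x \<in> Q}. (\<integral>\<^sup>+ y\<in>Q. \<phi> y \<partial>lebesgue) / emeasure lebesgue Q)"

lemma maximal_fun_eq_HL_max: "maximal_fun f = HL_max (\<lambda>y. ennreal (cmod (f y)))"
  by (simp add: fun_eq_iff maximal_fun_def HL_max_def)

lemma HL_max_cong_AE:
  assumes "AE x in lebesgue. \<phi> x = \<psi> x"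
  shows "HL_max \<phi> = HL_max \<psi>"
proof -
  have "(\<integral>\<^sup>+ y\<in>Q. \<phi> y \<partial>lebesgue) = (\<integral>\<^sup>+ y\<in>Q. \<psi> y \<partial>lebesgue)" for Q
    using assms by (intro nn_integral_cong_AE) (auto elim: eventually_mono)
  then show ?thesis by (simp add: fun_eq_iff HL_max_def)
qed

lemma cubes_sets: "Q \<in> cubes \<Longrightarrow> Q \<in> sets lebesgue"
  by (auto simp: cubes_def)

lemma cube_average_le_HL_max:
  fixes a :: "real ^ 'n"
  assumes "0 < l" "x \<in> cbox a (a + vec l)"
  shows "(\<integral>\<^sup>+y\<in>cbox a (a + vec l). \<phi> y \<partial>lebesgue) \<le> ennreal (l ^ CARD('n)) * HL_max \<phi> x"
proof -
  let ?Q = "cbox a (a + vec l)"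
  have e: "emeasure lebesgue ?Q = ennreal (l ^ CARD('n))" by (rule emeasure_cube[OF assms(1)])
  have "(\<integral>\<^sup>+y\<in>?Q. \<phi> y \<partial>lebesgue) / emeasure lebesgue ?Q \<le> HL_max \<phi> x"
    unfolding HL_max_def using assms by (intro SUP_upper) (auto simp: cubes_def)
  then have "ennreal (l ^ CARD('n)) * ((\<integral>\<^sup>+y\<in>?Q. \<phi> y \<partial>lebesgue) * ennreal (1 / l ^ CARD('n)))
      \<le> ennreal (l ^ CARD('n)) * HL_max \<phi> x"
    unfolding e using assms(1) by (subst (asm) divide_ennreal_real) (auto intro: mult_left_mono)
  moreover have "ennreal (l ^ CARD('n)) * ((\<integral>\<^sup>+y\<in>?Q. \<phi> y \<partial>lebesgue) * ennreal (1 / l ^ CARD('n)))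
      = (\<integral>\<^sup>+y\<in>?Q. \<phi> y \<partial>lebesgue) * (ennreal (l ^ CARD('n)) * ennreal (1 / l ^ CARD('n)))"
    by (simp only: mult_ac)
  moreover have "ennreal (l ^ CARD('n)) * ennreal (1 / l ^ CARD('n)) = 1"
    using assms(1) by (simp add: ennreal_mult'[symmetric] del: ennreal_power)
  ultimately show ?thesis by simp
qed

text \<open>The cubes are closed, but a slightly larger cube, whose interior contains \<open>x\<close>, still has a mean above
  \<open>t\<close>. Hence \<open>HL_max \<phi>\<close> is lower semicontinuous.\<close>

lemma open_HL_max_level:
  fixes \<phi> :: "real ^ 'n \<Rightarrow> ennreal"
  shows "open {x. t < HL_max \<phi> x}"
proof (subst open_subopen, intro ballI)
  fix x assume "x \<in> {x. t < HL_max \<phi> x}"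
  then obtain Q where Q: "Q \<in> cubes" "x \<in> Q" "t < (\<integral>\<^sup>+ y\<in>Q. \<phi> y \<partial>lebesgue) / emeasure lebesgue Q"
    unfolding HL_max_def mem_Collect_eq less_SUP_iff by blast
  then obtain a l where l: "0 < l" and Qa: "Q = cbox a (a + vec l)" by (auto simp: cubes_def)
  let ?I = "\<integral>\<^sup>+ y\<in>Q. \<phi> y \<partial>lebesgue"
  have e: "emeasure lebesgue Q = ennreal (l ^ CARD('n))" unfolding Qa by (rule emeasure_cube[OF l])
  obtain \<tau> where \<tau>: "0 \<le> \<tau>" "t = ennreal \<tau>"
    using Q(3) by (cases t) auto
  have tI: "ennreal (\<tau> * l ^ CARD('n)) < ?I"
  proof (rule ccontr)
    assume "\<not> ?thesis"
    then have "?I * ennreal (1 / l ^ CARD('n)) \<le> ennreal (\<tau> * l ^ CARD('n)) * ennreal (1 / l ^ CARD('n))"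
      by (intro mult_right_mono) auto
    also have "\<dots> = t" using \<tau> l by (simp add: ennreal_mult'[symmetric] del: ennreal_power)
    finally show False using Q(3) l unfolding e by (simp add: divide_ennreal_real del: ennreal_power)
  qed
  obtain \<delta> where \<delta>: "0 < \<delta>" "ennreal (\<tau> * (l + 2 * \<delta>) ^ CARD('n)) < ?I"
  proof (cases ?I)
    case (real i)
    have "((\<lambda>\<delta>. \<tau> * (l + 2 * \<delta>) ^ CARD('n)) \<longlongrightarrow> \<tau> * (l + 2 * 0) ^ CARD('n)) (at_right 0)"
      by (intro tendsto_intros)
    moreover have "\<tau> * (l + 2 * 0) ^ CARD('n) < i"
      using tI real l \<tau>(1) by (simp add: ennreal_less_iff)
    ultimately have "\<forall>\<^sub>F \<delta> in at_right 0. \<tau> * (l + 2 * \<delta>) ^ CARD('n) < i"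
      by (rule order_tendstoD(2))
    then have "\<forall>\<^sub>F \<delta> in at_right 0. 0 < \<delta> \<and> \<tau> * (l + 2 * \<delta>) ^ CARD('n) < i"
      using eventually_at_right_less[of "0::real"] by (rule eventually_elim2) auto
    then obtain \<delta> where "0 < \<delta>" "\<tau> * (l + 2 * \<delta>) ^ CARD('n) < i"
      using eventually_happens[of _ "at_right (0::real)"] by (auto simp: trivial_limit_at_right_real)
    then show thesis using that[of \<delta>] real l \<tau>(1) by (simp add: ennreal_less_iff)
  next
    case top
    then show thesis using that[of 1] by simp
  qed
  let ?T = "box (a - vec \<delta>) (a + vec (l + \<delta>))"
  have vec: "a - vec \<delta> + vec (l + 2 * \<delta>) = a + vec (l + \<delta>)"
    by (simp add: vec_eq_iff)
  have "?T \<subseteq> {x. t < HL_max \<phi> x}"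
  proof
    fix y assume y: "y \<in> ?T"
    have sub: "Q \<subseteq> cbox (a - vec \<delta>) (a - vec \<delta> + vec (l + 2 * \<delta>))"
    proof
      fix w assume "w \<in> Q"
      then have "a $ i \<le> w $ i \<and> w $ i \<le> a $ i + l" for i
        unfolding Qa by (simp add: mem_box_cart)
      then have "a $ i - \<delta> \<le> w $ i \<and> w $ i \<le> a $ i + (l + \<delta>)" for i
        using \<delta>(1) by (smt (verit))
      then show "w \<in> cbox (a - vec \<delta>) (a - vec \<delta> + vec (l + 2 * \<delta>))"
        unfolding vec by (simp add: mem_box_cart)
    qed
    have "?I \<le> (\<integral>\<^sup>+ y\<in>cbox (a - vec \<delta>) (a - vec \<delta> + vec (l + 2 * \<delta>)). \<phi> y \<partial>lebesgue)"
      using sub by (intro nn_integral_mono) (auto split: split_indicator)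
    also have "\<dots> \<le> ennreal ((l + 2 * \<delta>) ^ CARD('n)) * HL_max \<phi> y"
      using l \<delta>(1) y box_subset_cbox[of "a - vec \<delta>" "a + vec (l + \<delta>)"]
      by (intro cube_average_le_HL_max) (auto simp: vec)
    finally have "?I \<le> ennreal ((l + 2 * \<delta>) ^ CARD('n)) * HL_max \<phi> y" .
    with \<delta>(2) have less: "ennreal (\<tau> * (l + 2 * \<delta>) ^ CARD('n)) < ennreal ((l + 2 * \<delta>) ^ CARD('n)) * HL_max \<phi> y"
      by (rule order.strict_trans2)
    show "y \<in> {x. t < HL_max \<phi> x}"
    proof (rule ccontr)
      assume "y \<notin> {x. t < HL_max \<phi> x}"
      then have "ennreal ((l + 2 * \<delta>) ^ CARD('n)) * HL_max \<phi> y \<le> ennreal ((l + 2 * \<delta>) ^ CARD('n)) * ennreal \<tau>"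
        using \<tau> by (intro mult_left_mono) auto
      also have "\<dots> = ennreal (\<tau> * (l + 2 * \<delta>) ^ CARD('n))"
        using \<tau>(1) by (simp only: ennreal_mult'[symmetric] mult.commute)
      finally show False using less by simp
    qed
  qed
  moreover have "x \<in> ?T"
  proof -
    have "a $ i \<le> x $ i \<and> x $ i \<le> a $ i + l" for i
      using Q(2) unfolding Qa by (simp add: mem_box_cart)
    then have "a $ i - \<delta> < x $ i \<and> x $ i < a $ i + (l + \<delta>)" for i
      using \<delta>(1) by (smt (verit))
    then show ?thesis by (simp add: mem_box_cart)
  qed
  ultimately show "\<exists>T. open T \<and> x \<in> T \<and> T \<subseteq> {x. t < HL_max \<phi> x}"
    using open_box by blast
qed

lemma measurable_HL_max [measurable]: "HL_max \<phi> \<in> borel_measurable lebesgue"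
proof (rule measurable_completion)
  show "HL_max \<phi> \<in> borel_measurable lborel"
    by (simp, rule borel_measurableI_greater) (simp add: open_HL_max_level borel_open)
qed

lemma HL_max_cmult_le:
  "HL_max (\<lambda>x. ennreal a * \<phi> x) x \<le> ennreal a * HL_max \<phi> x" if "\<phi> \<in> borel_measurable lebesgue"
  unfolding HL_max_def
proof (rule SUP_least)
  fix Q assume Q: "Q \<in> {Q \<in> cubes. x \<in> Q}"
  have [measurable]: "Q \<in> sets lebesgue" using Q cubes_sets by blast
  note that [measurable]
  have "(\<integral>\<^sup>+ y\<in>Q. ennreal a * \<phi> y \<partial>lebesgue) = ennreal a * (\<integral>\<^sup>+ y\<in>Q. \<phi> y \<partial>lebesgue)"
    unfolding mult.assoc by (rule nn_integral_cmult) measurable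
  then have "(\<integral>\<^sup>+ y\<in>Q. ennreal a * \<phi> y \<partial>lebesgue) / emeasure lebesgue Q
      = ennreal a * ((\<integral>\<^sup>+ y\<in>Q. \<phi> y \<partial>lebesgue) / emeasure lebesgue Q)"
    by (simp add: ennreal_times_divide)
  also have "\<dots> \<le> ennreal a * (SUP Q\<in>{Q \<in> cubes. x \<in> Q}. (\<integral>\<^sup>+ y\<in>Q. \<phi> y \<partial>lebesgue) / emeasure lebesgue Q)"
    using Q by (intro mult_left_mono SUP_upper) auto
  finally show "(\<integral>\<^sup>+ y\<in>Q. ennreal a * \<phi> y \<partial>lebesgue) / emeasure lebesgue Q \<le> \<dots>" .
qed

lemma HL_max_suminf_le:
  fixes \<phi> :: "nat \<Rightarrow> real ^ 'n \<Rightarrow> ennreal"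
  assumes [measurable]: "\<And>k. \<phi> k \<in> borel_measurable lebesgue"
  shows "HL_max (\<lambda>y. \<Sum>k. \<phi> k y) x \<le> (\<Sum>k. HL_max (\<phi> k) x)"
  unfolding HL_max_def[of "\<lambda>y. \<Sum>k. \<phi> k y"]
proof (rule SUP_least)
  fix Q :: "(real ^ 'n) set" assume Q: "Q \<in> {Q \<in> cubes. x \<in> Q}"
  then have [measurable]: "Q \<in> sets lebesgue" using cubes_sets by auto
  have "(\<integral>\<^sup>+ y\<in>Q. (\<Sum>k. \<phi> k y) \<partial>lebesgue) / emeasure lebesgue Q
      = (\<Sum>k. \<integral>\<^sup>+ y\<in>Q. \<phi> k y \<partial>lebesgue) * inverse (emeasure lebesgue Q)"
    by (simp add: nn_integral_suminf[symmetric] ennreal_suminf_multc divide_ennreal_def)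
  also have "\<dots> = (\<Sum>k. (\<integral>\<^sup>+ y\<in>Q. \<phi> k y \<partial>lebesgue) / emeasure lebesgue Q)"
    by (simp add: ennreal_suminf_multc divide_ennreal_def)
  also have "\<dots> \<le> (\<Sum>k. HL_max (\<phi> k) x)"
    using Q unfolding HL_max_def by (intro suminf_le SUP_upper) auto
  finally show "(\<integral>\<^sup>+ y\<in>Q. (\<Sum>k. \<phi> k y) \<partial>lebesgue) / emeasure lebesgue Q \<le> (\<Sum>k. HL_max (\<phi> k) x)" .
qed

text \<open>A function of finite norm is finite almost everywhere, so it agrees there with the modulus of a
  complex function, to which the hypothesis applies.\<close>

lemma weighted_norm_HL_max_le:
  assumes bd: "\<forall>f \<in> weighted_Lp r v. weighted_norm r v (maximal_fun f) \<le>
         ennreal C * weighted_norm r v (\<lambda>x. ennreal (cmod (f x)))"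
    and [measurable]: "r \<in> borel_measurable lebesgue" "v \<in> borel_measurable lebesgue" "\<phi> \<in> borel_measurable lebesgue"
    and r: "AE x in lebesgue. 0 < r x" and v: "AE x in lebesgue. 0 < v x"
    and fin: "weighted_norm r v \<phi> < \<infinity>"
  shows "weighted_norm r v (HL_max \<phi>) \<le> ennreal C * weighted_norm r v \<phi>"
proof -
  define f where "f x = complex_of_real (enn2real (\<phi> x))" for x
  have "AE x in lebesgue. \<phi> x * v x < \<infinity>"
    by (rule AE_finite_of_Lp_norm_finite[where p = r, OF _ _ r fin[unfolded weighted_norm_def]]) measurable
  with v have eq: "AE x in lebesgue. ennreal (cmod (f x)) = \<phi> x"
  proof eventually_elim
    case (elim x)
    then have "\<phi> x \<noteq> \<infinity>" by (auto simp: ennreal_top_mult split: if_splits)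
    then show ?case by (simp add: f_def less_top)
  qed
  then have n: "weighted_norm r v (\<lambda>x. ennreal (cmod (f x))) = weighted_norm r v \<phi>"
    unfolding weighted_norm_def by (intro Lp_norm_cong_AE) (auto elim: eventually_mono)
  have "f \<in> borel_measurable lebesgue" unfolding f_def by measurable
  then have "f \<in> weighted_Lp r v"
    using n fin by (simp add: weighted_Lp_def)
  then show ?thesis
    using bd unfolding maximal_fun_eq_HL_max by (auto simp only: n HL_max_cong_AE[OF eq] dest!: bspec)
qed

text \<open>The majorant is \<open>U = (\<Sum>k. \<epsilon>\<^sup>k M\<^sup>k \<phi>)\<close>; one application of \<open>M\<close> shifts the series, whence \<open>M U \<le> U / \<epsilon>\<close>. The
  exponent \<open>r\<close> may be smaller than \<open>1\<close>, where the norm has no triangle inequality. Instead, \<open>U v / 4\<close> is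
  written as an average with weights \<open>2^(-k-1)\<close> of functions \<open>c k\<close>; it is bounded by their supremum, and the
  modular of the supremum by the sum of the modulars, which converges when \<open>\<epsilon>\<close> is small enough.\<close>

theorem rubio_de_francia:
  fixes r :: "real ^ 'n \<Rightarrow> real" and v :: "real ^ 'n \<Rightarrow> ennreal"
  assumes bd: "maximal_bounded_on r v"
    and [measurable]: "r \<in> borel_measurable lebesgue" "v \<in> borel_measurable lebesgue"
    and r0: "0 < r0" "AE x in lebesgue. r0 \<le> r x" and v: "AE x in lebesgue. 0 < v x"
  obtains A :: real where "0 < A"
    "\<And>\<phi>. \<phi> \<in> borel_measurable lebesgue \<Longrightarrow> modular r (\<lambda>x. \<phi> x * v x) \<le> 1 \<Longrightarrow>
      \<exists>U\<in>borel_measurable lebesgue. (\<forall>x. \<phi> x \<le> U x) \<and> modular r (\<lambda>x. U x * v x / 4) \<le> 2 \<and>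
        (\<forall>x. HL_max U x \<le> ennreal A * U x)"
proof -
  obtain C where C: "0 < C" "\<forall>f \<in> weighted_Lp r v. weighted_norm r v (maximal_fun f) \<le>
         ennreal C * weighted_norm r v (\<lambda>x. ennreal (cmod (f x)))"
    using bd unfolding maximal_bounded_on_def by blast
  have rpos: "AE x in lebesgue. 0 < r x" using r0(2) r0(1) by (auto elim: eventually_mono)
  \<comment> \<open>\<open>B\<close> is chosen so that \<open>B powr (- r x) \<le> 1 / 2\<close> for \<open>r x \<ge> r0\<close>, which makes the modulars of the iterates summable.\<close>
  define B where "B = 2 powr (1 / r0)"
  have B: "0 < B" "1 \<le> B" "B powr r0 = 2" using r0(1) by (auto simp: B_def powr_powr ge_one_powr_ge_zero)
  define \<epsilon> where "\<epsilon> = 1 / (2 * B * C)"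
  have \<epsilon>: "0 < \<epsilon>" using B C by (simp add: \<epsilon>_def)
  show thesis
  proof (rule that)
    show "0 < 1 / \<epsilon>" using \<epsilon> by simp
    fix \<phi> :: "real ^ 'n \<Rightarrow> ennreal"
    assume \<phi>[measurable]: "\<phi> \<in> borel_measurable lebesgue" and mod: "modular r (\<lambda>x. \<phi> x * v x) \<le> 1"
    define u where "u k = (HL_max ^^ k) \<phi>" for k
    have u0: "u 0 = \<phi>" and uSuc: "u (Suc k) = HL_max (u k)" for k by (simp_all add: u_def)
    have u[measurable]: "u k \<in> borel_measurable lebesgue" for k
      by (cases k) (simp_all add: u0 uSuc measurable_HL_max)
    have norm: "weighted_norm r v (u k) \<le> ennreal (C ^ k)" for k
    proof (induction k)
      case 0
      have "Lp_norm r (\<lambda>x. \<phi> x * v x) \<le> ennreal 1"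
        using mod by (intro Lp_norm_le) (auto simp: divide_ennreal_def)
      then show ?case by (simp add: u0 weighted_norm_def)
    next
      case (Suc k)
      have fin: "weighted_norm r v (u k) < \<infinity>" using Suc.IH by (rule order.strict_trans1) simp
      have "weighted_norm r v (u (Suc k)) \<le> ennreal C * weighted_norm r v (u k)"
        unfolding uSuc by (rule weighted_norm_HL_max_le[OF C(2) _ _ _ rpos v fin]) measurable
      also have "\<dots> \<le> ennreal C * ennreal (C ^ k)" by (intro mult_left_mono Suc.IH) simp
      also have "\<dots> = ennreal (C ^ Suc k)" using C(1) by (simp only: ennreal_mult'[symmetric] less_imp_le power_Suc)
      finally show ?case .
    qed
    \<comment> \<open>The factor \<open>2\<close> gives the strict inequality that is needed to pass from the norm to the modular.\<close>
    have modk: "modular r (\<lambda>x. u k x * v x / ennreal (2 * C ^ k)) \<le> 1" for k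
    proof (rule modular_le_1_of_Lp_norm_less[OF rpos])
      have "Lp_norm r (\<lambda>x. u k x * v x) \<le> ennreal (C ^ k)" using norm[of k] by (simp add: weighted_norm_def)
      also have "\<dots> < ennreal (2 * C ^ k)" using C(1) by (intro ennreal_lessI) auto
      finally show "Lp_norm r (\<lambda>x. u k x * v x) < ennreal (2 * C ^ k)" .
    qed
    define U where "U x = (\<Sum>k. ennreal (\<epsilon> ^ k) * u k x)" for x
    have [measurable]: "U \<in> borel_measurable lebesgue" unfolding U_def by measurable
    define c where "c k x = (u k x * v x / ennreal (2 * C ^ k)) * ennreal (1 / B ^ k)" for k x
    have [measurable]: "c k \<in> borel_measurable lebesgue" for k unfolding c_def by measurable
    have Uc: "U x * v x / 4 \<le> (SUP k. c k x)" for x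
    proof -
      have "U x * v x / 4 = (\<Sum>k. ennreal (\<epsilon> ^ k) * u k x * v x / 4)"
        by (simp add: U_def ennreal_suminf_multc divide_ennreal_def)
      also have "\<dots> = (\<Sum>k. ennreal ((1/2) ^ Suc k) * c k x)"
      proof (intro suminf_cong)
        fix k
        have "ennreal (\<epsilon> ^ k) * u k x * v x / 4 = (u k x * v x) * (ennreal (\<epsilon> ^ k) * ennreal (1 / 4))"
          using divide_ennreal_real[of 4] by (simp add: mult_ac)
        also have "ennreal (\<epsilon> ^ k) * ennreal (1 / 4) = ennreal ((1/2) ^ Suc k) * (ennreal (1 / (2 * C ^ k)) * ennreal (1 / B ^ k))"
          using \<epsilon> B C by (simp add: ennreal_mult'[symmetric] \<epsilon>_def power_divide power_mult_distrib field_simps del: ennreal_power)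
        finally show "ennreal (\<epsilon> ^ k) * u k x * v x / 4 = ennreal ((1/2) ^ Suc k) * c k x"
          using C(1) by (simp add: c_def divide_ennreal_real mult_ac)
      qed
      also have "\<dots> \<le> (\<Sum>k. ennreal ((1/2) ^ Suc k) * (SUP k. c k x))"
        by (intro suminf_le mult_left_mono SUP_upper) auto
      also have "\<dots> = (\<Sum>k. ennreal ((1/2) ^ Suc k)) * (SUP k. c k x)" by (rule ennreal_suminf_multc)
      also have "(\<Sum>k. ennreal ((1/2) ^ Suc k)) = 1"
        using power_half_series by (subst suminf_ennreal2) (auto simp: sums_iff simp del: power_Suc)
      finally show ?thesis by simp
    qed
    have "modular r (\<lambda>x. U x * v x / 4) \<le> (\<integral>\<^sup>+x. (\<Sum>k. ennreal_rpow (c k x) (r x)) \<partial>lebesgue)"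
      unfolding modular_def
    proof (rule nn_integral_mono_AE)
      show "AE x in lebesgue. ennreal_rpow (U x * v x / 4) (r x) \<le> (\<Sum>k. ennreal_rpow (c k x) (r x))"
        using rpos
      proof eventually_elim
        case (elim x)
        have "ennreal_rpow (U x * v x / 4) (r x) \<le> ennreal_rpow (SUP k. c k x) (r x)"
          by (intro ennreal_rpow_mono elim Uc)
        also have "\<dots> = (SUP k. ennreal_rpow (c k x) (r x))" by (rule ennreal_rpow_SUP[OF elim])
        also have "\<dots> \<le> (\<Sum>k. ennreal_rpow (c k x) (r x))"
        proof (rule SUP_least)
          fix k
          have "sum (\<lambda>k. ennreal_rpow (c k x) (r x)) {k} \<le> (\<Sum>k. ennreal_rpow (c k x) (r x))"
            by (intro sum_le_suminf) auto
          then show "ennreal_rpow (c k x) (r x) \<le> (\<Sum>k. ennreal_rpow (c k x) (r x))" by simp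
        qed
        finally show ?case .
      qed
    qed
    also have "\<dots> = (\<Sum>k. \<integral>\<^sup>+x. ennreal_rpow (c k x) (r x) \<partial>lebesgue)"
      by (rule nn_integral_suminf) measurable
    also have "\<dots> \<le> (\<Sum>k. ennreal ((1/2) ^ k))"
    proof (rule suminf_le)
      fix k
      have "(\<integral>\<^sup>+x. ennreal_rpow (c k x) (r x) \<partial>lebesgue)
        \<le> (\<integral>\<^sup>+x. ennreal ((1/2) ^ k) * ennreal_rpow (u k x * v x / ennreal (2 * C ^ k)) (r x) \<partial>lebesgue)"
      proof (rule nn_integral_mono_AE)
        show "AE x in lebesgue. ennreal_rpow (c k x) (r x)
            \<le> ennreal ((1/2) ^ k) * ennreal_rpow (u k x * v x / ennreal (2 * C ^ k)) (r x)"
          using r0(2) rpos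
        proof eventually_elim
          case (elim x)
          have "(1 / B ^ k) powr r x \<le> (1 / B ^ k) powr r0"
            using B elim by (intro powr_mono') (auto simp: divide_le_eq)
          also have "\<dots> = (1/2) ^ k"
          proof -
            have "B ^ k = B powr real k" using B by (simp add: powr_realpow)
            then have "(B ^ k) powr r0 = (B powr r0) powr real k" by (simp add: powr_powr mult.commute)
            also have "\<dots> = 2 ^ k" using B by (simp add: powr_realpow)
            finally show ?thesis using B by (simp add: powr_divide power_divide)
          qed
          finally have "ennreal_rpow (ennreal (1 / B ^ k)) (r x) \<le> ennreal ((1/2) ^ k)"
            using B by (simp add: ennreal_rpow_ennreal ennreal_leI del: ennreal_power)
          then show ?case unfolding c_def ennreal_rpow_mult[OF elim(2)]
            by (subst mult.commute) (rule mult_right_mono, auto)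
        qed
      qed
      also have "\<dots> = ennreal ((1/2) ^ k) * modular r (\<lambda>x. u k x * v x / ennreal (2 * C ^ k))"
        unfolding modular_def by (rule nn_integral_cmult) measurable
      also have "\<dots> \<le> ennreal ((1/2) ^ k) * 1" by (intro mult_left_mono modk) simp
      finally show "(\<integral>\<^sup>+x. ennreal_rpow (c k x) (r x) \<partial>lebesgue) \<le> ennreal ((1/2) ^ k)" by simp
    qed auto
    also have "\<dots> = 2"
      using geometric_sums[of "1/2 :: real"] by (subst suminf_ennreal2) (auto simp: sums_iff simp del: ennreal_power)
    finally have m2: "modular r (\<lambda>x. U x * v x / 4) \<le> 2" .
    have ge: "\<phi> x \<le> U x" for x
    proof -
      have "sum (\<lambda>k. ennreal (\<epsilon> ^ k) * u k x) {0} \<le> U x"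
        unfolding U_def by (intro sum_le_suminf) auto
      then show ?thesis by (simp add: u0)
    qed
    have A1: "HL_max U x \<le> ennreal (1 / \<epsilon>) * U x" for x
    proof -
      have "HL_max U x \<le> (\<Sum>k. HL_max (\<lambda>y. ennreal (\<epsilon> ^ k) * u k y) x)"
        unfolding U_def by (rule HL_max_suminf_le) measurable
      also have "\<dots> \<le> (\<Sum>k. ennreal (\<epsilon> ^ k) * u (Suc k) x)"
        unfolding uSuc by (intro suminf_le HL_max_cmult_le u) auto
      also have "\<dots> = (\<Sum>k. ennreal (1 / \<epsilon>) * (ennreal (\<epsilon> ^ Suc k) * u (Suc k) x))"
      proof (intro suminf_cong)
        fix k
        have "ennreal (\<epsilon> ^ k) = ennreal (1 / \<epsilon>) * ennreal (\<epsilon> ^ Suc k)"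
          using \<epsilon> by (simp add: ennreal_mult'[symmetric] del: ennreal_power)
        then show "ennreal (\<epsilon> ^ k) * u (Suc k) x = ennreal (1 / \<epsilon>) * (ennreal (\<epsilon> ^ Suc k) * u (Suc k) x)"
          by (simp only: mult.assoc)
      qed
      also have "\<dots> = ennreal (1 / \<epsilon>) * (\<Sum>k. ennreal (\<epsilon> ^ Suc k) * u (Suc k) x)"
        by (rule ennreal_suminf_cmult)
      also have "(\<Sum>k. ennreal (\<epsilon> ^ Suc k) * u (Suc k) x) \<le> U x"
        unfolding U_def using suminf_offset[of "\<lambda>k. ennreal (\<epsilon> ^ k) * u k x" 1] by simp
      finally show ?thesis by (simp add: mult_left_mono)
    qed
    show "\<exists>U\<in>borel_measurable lebesgue. (\<forall>x. \<phi> x \<le> U x) \<and> modular r (\<lambda>x. U x * v x / 4) \<le> 2 \<and>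
        (\<forall>x. HL_max U x \<le> ennreal (1 / \<epsilon>) * U x)"
      using m2 ge A1 by (intro bexI[of _ U]) auto
  qed
qed

text \<open>The cubes around \<open>y\<close> exhaust the space, and \<open>U\<close> has mean \<open>0\<close> on each of them.\<close>

lemma AE_zero_of_HL_max_zero:
  fixes U :: "real ^ 'n \<Rightarrow> ennreal"
  assumes [measurable]: "U \<in> borel_measurable lebesgue" and 0: "HL_max U y = 0"
  shows "AE x in lebesgue. U x = 0"
proof -
  let ?Q = "\<lambda>k::nat. cbox (y - vec (real (Suc k))) (y - vec (real (Suc k)) + vec (2 * real (Suc k)))"
  have "AE x in lebesgue. U x * indicator (?Q k) x = 0" for k
  proof -
    have "y \<in> ball y (real (Suc k))" by simp
    then have "y \<in> ?Q k" using ball_subset_cube[of y "real (Suc k)"] by blast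
    then have "(\<integral>\<^sup>+x\<in>?Q k. U x \<partial>lebesgue) \<le> ennreal ((2 * real (Suc k)) ^ CARD('n)) * HL_max U y"
      by (intro cube_average_le_HL_max) auto
    then have "(\<integral>\<^sup>+x\<in>?Q k. U x \<partial>lebesgue) = 0" using 0 by simp
    then show ?thesis by (subst (asm) nn_integral_0_iff_AE) auto
  qed
  then have "AE x in lebesgue. \<forall>k. U x * indicator (?Q k) x = 0" by (subst AE_all_countable) blast
  then show ?thesis
  proof eventually_elim
    case (elim x)
    obtain k where "dist y x < real k" using reals_Archimedean2 by blast
    then have "x \<in> ball y (real (Suc k))" by simp
    then have "x \<in> ?Q k" using ball_subset_cube[of y "real (Suc k)"] by blast
    with elim[rule_format, of k] show ?case by simp
  qed
qed

text \<open>For \<open>d > 0\<close> and \<open>\<kappa> \<ge> 1\<close> one has \<open>t \<le> d + d^(1-\<kappa>) t\<^sup>\<kappa>\<close>. With \<open>t = W x\<close> and \<open>d = W y\<close> a mean of \<open>W\<close> is thus bounded by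
  \<open>W y\<close> and the mean of \<open>U = W\<^sup>\<kappa>\<close>, which is at most \<open>A (W y)\<^sup>\<kappa>\<close>. If \<open>U\<close> is not trivial, it vanishes at no
  point; at the points where it is infinite, a null set, \<open>W\<close> gets the value \<open>1\<close>.\<close>

lemma A1_weight_root:
  fixes U :: "real ^ 'n \<Rightarrow> ennreal"
  assumes [measurable]: "U \<in> borel_measurable lebesgue" and A: "0 < A"
    and UA: "\<And>x. HL_max U x \<le> ennreal A * U x"
    and fin: "AE x in lebesgue. U x < \<infinity>" and nz: "\<not> (AE x in lebesgue. U x = 0)" and \<kappa>: "1 \<le> \<kappa>"
  obtains W where "A1_weight W ((1 + A) * 2 ^ CARD('n)) CARD('n)"
    "AE x in lebesgue. U x = ennreal (W x powr \<kappa>)"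
proof -
  have Upos: "0 < U x" for x
  proof (rule ccontr)
    assume "\<not> ?thesis"
    then have "HL_max U x = 0" using UA[of x] by simp
    then show False using AE_zero_of_HL_max_zero[of U x] nz by simp
  qed
  define W where "W x = (if U x < \<infinity> then enn2real (U x) powr (1 / \<kappa>) else 1)" for x
  have W: "0 < W x" for x
    using Upos[of x] by (cases "U x") (auto simp: W_def)
  have WU: "U x = ennreal (W x powr \<kappa>)" if "U x < \<infinity>" for x
    using that \<kappa> by (cases "U x") (auto simp: W_def powr_powr)
  have AEW: "AE x in lebesgue. U x = ennreal (W x powr \<kappa>)"
    using fin by (rule eventually_mono) (rule WU)
  have [measurable]: "W \<in> borel_measurable lebesgue" unfolding W_def by measurable
  show thesis
  proof (rule that[OF _ AEW])
    show "A1_weight W ((1 + A) * 2 ^ CARD('n)) CARD('n)"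
    proof
      show "0 < W x" for x by (rule W)
      show "0 < (1 + A) * 2 ^ CARD('n)" using A by simp
      show "AE y in lebesgue. \<forall>c r. y \<in> ball c r \<longrightarrow>
        (\<integral>\<^sup>+x\<in>ball c r. ennreal (W x) \<partial>lebesgue) \<le> ennreal ((1 + A) * 2 ^ CARD('n) * r ^ CARD('n) * W y)"
        using fin
      proof eventually_elim
        case (elim y)
        show ?case
        proof (intro allI impI)
          fix c r assume y: "y \<in> ball c r"
          then have r: "0 < r" using le_less_trans[OF zero_le_dist] by auto
          define d where "d = W y"
          have d: "0 < d" by (simp add: d_def W)
          let ?Q = "cbox (c - vec r) (c - vec r + vec (2 * r))"
          have "(\<integral>\<^sup>+x\<in>ball c r. ennreal (W x) \<partial>lebesgue)
            \<le> (\<integral>\<^sup>+x. ennreal d * indicator ?Q x + ennreal (d powr (1 - \<kappa>)) * (U x * indicator ?Q x) \<partial>lebesgue)"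
          proof (rule nn_integral_mono_AE)
            show "AE x in lebesgue. ennreal (W x) * indicator (ball c r) x
              \<le> ennreal d * indicator ?Q x + ennreal (d powr (1 - \<kappa>)) * (U x * indicator ?Q x)"
              using AEW
            proof eventually_elim
              case (elim x)
              have "W x \<le> d + d powr (1 - \<kappa>) * W x powr \<kappa>"
              proof (cases "W x \<le> d")
                case False
                have "W x = W x powr (1 - \<kappa>) * W x powr \<kappa>" using W[of x] by (simp add: powr_add[symmetric])
                also have "\<dots> \<le> d powr (1 - \<kappa>) * W x powr \<kappa>"
                  using False d \<kappa> by (intro mult_right_mono powr_mono2') auto
                finally show ?thesis using d by simp
              qed (simp add: add_increasing2)
              then have "ennreal (W x) \<le> ennreal d + ennreal (d powr (1 - \<kappa>)) * U x"
                using d unfolding elim by (simp add: ennreal_leI ennreal_mult'[symmetric] flip: ennreal_plus)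
              then show ?case using ball_subset_cube[of c r]
                by (auto split: split_indicator)
            qed
          qed
          also have "\<dots> = ennreal d * emeasure lebesgue ?Q + ennreal (d powr (1 - \<kappa>)) * (\<integral>\<^sup>+x\<in>?Q. U x \<partial>lebesgue)"
            by (subst nn_integral_add, measurable, subst nn_integral_cmult_indicator, measurable, subst nn_integral_cmult) measurable
          also have "emeasure lebesgue ?Q = ennreal ((2 * r) ^ CARD('n))"
            using r by (intro emeasure_cube) simp
          also have "(\<integral>\<^sup>+x\<in>?Q. U x \<partial>lebesgue) \<le> ennreal ((2 * r) ^ CARD('n)) * (ennreal A * ennreal (d powr \<kappa>))"
          proof -
            have "y \<in> ?Q" using y ball_subset_cube by blast
            then have "(\<integral>\<^sup>+x\<in>?Q. U x \<partial>lebesgue) \<le> ennreal ((2 * r) ^ CARD('n)) * HL_max U y"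
              using r by (intro cube_average_le_HL_max) auto
            also have "\<dots> \<le> ennreal ((2 * r) ^ CARD('n)) * (ennreal A * U y)"
              by (intro mult_left_mono UA) simp
            finally show ?thesis using WU[OF elim] by (simp only: d_def)
          qed
          finally have "(\<integral>\<^sup>+x\<in>ball c r. ennreal (W x) \<partial>lebesgue) \<le> ennreal d * ennreal ((2 * r) ^ CARD('n)) +
             ennreal (d powr (1 - \<kappa>)) * (ennreal ((2 * r) ^ CARD('n)) * (ennreal A * ennreal (d powr \<kappa>)))"
            by (simp add: mult_left_mono add_left_mono del: ennreal_power)
          also have "\<dots> = ennreal (d * (2 * r) ^ CARD('n) + d powr (1 - \<kappa>) * ((2 * r) ^ CARD('n) * (A * d powr \<kappa>)))"
            using d r A by (simp add: ennreal_mult'[symmetric] del: ennreal_power flip: ennreal_plus)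
          also have "d * (2 * r) ^ CARD('n) + d powr (1 - \<kappa>) * ((2 * r) ^ CARD('n) * (A * d powr \<kappa>))
              = (1 + A) * 2 ^ CARD('n) * r ^ CARD('n) * W y"
          proof -
            have "d powr (1 - \<kappa>) * d powr \<kappa> = d" using d by (simp add: powr_add[symmetric])
            then have "d powr (1 - \<kappa>) * ((2 * r) ^ CARD('n) * (A * d powr \<kappa>)) = (2 * r) ^ CARD('n) * A * d"
              by (simp add: algebra_simps)
            then show ?thesis by (simp add: d_def power_mult_distrib algebra_simps)
          qed
          finally show "(\<integral>\<^sup>+x\<in>ball c r. ennreal (W x) \<partial>lebesgue) \<le> ennreal ((1 + A) * 2 ^ CARD('n) * r ^ CARD('n) * W y)" .
        qed
      qed
    qed (auto intro: \<open>W \<in> borel_measurable lebesgue\<close>)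
  qed
qed

section \<open>Transfer to variable exponents\<close>

text \<open>The extrapolation step. A scale \<open>\<mu>\<close> at which the modular of \<open>g w / \<mu>\<close> is neither large nor small is
  bounded in terms of the data of the weight class; \<open>w\<close> is a real-valued version of \<open>\<omega>\<close>. The lower bound
  \<open>2^(-q2)\<close> with \<open>q2\<close> the upper bound of \<open>q\<close> is what is lost when \<open>\<mu>\<close> is doubled.\<close>

lemma scaling_bound_of_critical_modular:
  fixes \<omega> :: "real ^ 'n \<Rightarrow> ennreal" and p q w :: "real ^ 'n \<Rightarrow> real" and a s \<kappa> :: real
  assumes a: "0 < a" and s: "1 < s" and q1: "1 < s * q1" and \<kappa>: "1 < \<kappa>"
    and q[measurable]: "q \<in> borel_measurable lebesgue"
    and qb: "AE x in lebesgue. q1 \<le> q x \<and> q x \<le> q2"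
    and \<omega>[measurable]: "\<omega> \<in> borel_measurable lebesgue"
    and w[measurable]: "w \<in> borel_measurable lebesgue"
    and w\<omega>: "AE x in lebesgue. 0 < w x \<and> \<omega> x = ennreal (w x)"
    and p: "\<And>x. 1 / p x = 1 / q x + a"
    and bd: "maximal_bounded_on (\<lambda>x. conj_exponent (\<lambda>y. s * q y) x / \<kappa>) (\<lambda>x. ennreal_rpow (\<omega> x) (- (\<kappa> / s)))"
  obtains C :: real where "0 < C"
    "\<And>(J :: nat set) z l c \<mu>. finite J \<Longrightarrow> (\<And>j. j \<in> J \<Longrightarrow> 0 < l j) \<Longrightarrow> (\<And>j. j \<in> J \<Longrightarrow> 0 \<le> c j) \<Longrightarrow> 0 < \<mu> \<Longrightarrow>
      (\<integral>\<^sup>+x. ennreal (((\<Sum>j\<in>J. c j * indicator (cbox (z j) (z j + vec (l j))) x) * w x) powr p x) \<partial>lebesgue) \<le> 1 \<Longrightarrow>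
      (\<integral>\<^sup>+x. ennreal (((\<Sum>j\<in>J. c j * (l j ^ CARD('n)) powr a * indicator (cbox (z j) (z j + vec (l j))) x) * w x / \<mu>) powr q x) \<partial>lebesgue) \<le> 1 \<Longrightarrow>
      ennreal (2 powr (- q2)) \<le> (\<integral>\<^sup>+x. ennreal (((\<Sum>j\<in>J. c j * (l j ^ CARD('n)) powr a * indicator (cbox (z j) (z j + vec (l j))) x) * w x / \<mu>) powr q x) \<partial>lebesgue) \<Longrightarrow>
      \<mu> \<le> C"
proof -
  have "0 < s * q1" using q1 by linarith
  then have q1pos: "0 < q1" using s by (simp add: zero_less_mult_iff)
  define t where "t = conj_exponent (\<lambda>y. s * q y)"
  define v where "v x = ennreal_rpow (\<omega> x) (- (\<kappa> / s))" for x
  define T where "T = 1 / (1 - 1 / (s * q1))"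
  have [measurable]: "t \<in> borel_measurable lebesgue" unfolding t_def conj_exponent_def[abs_def] by measurable
  have [measurable]: "v \<in> borel_measurable lebesgue" unfolding v_def by measurable
  have tb: "AE x in lebesgue. 1 \<le> t x \<and> t x \<le> T \<and> 0 < q x \<and> 1 < s * q x \<and> q x \<le> q2"
    using qb
  proof eventually_elim
    case (elim x)
    have sq: "s * q1 \<le> s * q x" using elim s by (intro mult_left_mono) auto
    then have "1 / (s * q x) \<le> 1 / (s * q1)" using q1 by (intro divide_left_mono) auto
    moreover have "1 / (s * q1) < 1" "0 < 1 / (s * q x)" using q1 sq by auto
    ultimately have "1 \<le> 1 / (1 - 1 / (s * q x))" "1 / (1 - 1 / (s * q x)) \<le> 1 / (1 - 1 / (s * q1))"
      by (intro le_divide_eq_1_pos[THEN iffD2] frac_le; linarith)+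
    then have "1 \<le> t x" "t x \<le> T"
      unfolding t_def conj_exponent_def T_def by auto
    then show ?case using elim q1pos q1 sq by auto
  qed
  have vpos: "AE x in lebesgue. 0 < v x \<and> v x = ennreal (w x powr (- (\<kappa> / s)))"
    using w\<omega> by (rule eventually_mono) (auto simp: v_def ennreal_rpow_ennreal)
  have tpos: "AE x in lebesgue. 1 / \<kappa> \<le> t x / \<kappa>"
    using tb \<kappa> by (auto intro: divide_right_mono elim!: eventually_mono)
  obtain A where A: "0 < A" "\<And>\<phi>. \<phi> \<in> borel_measurable lebesgue \<Longrightarrow> modular (\<lambda>x. t x / \<kappa>) (\<lambda>x. \<phi> x * v x) \<le> 1 \<Longrightarrow>
      \<exists>U\<in>borel_measurable lebesgue. (\<forall>x. \<phi> x \<le> U x) \<and> modular (\<lambda>x. t x / \<kappa>) (\<lambda>x. U x * v x / 4) \<le> 2 \<and>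
        (\<forall>x. HL_max U x \<le> ennreal A * U x)"
  proof (rule rubio_de_francia[where r = "\<lambda>x. t x / \<kappa>" and v = v and ?r0.0 = "1 / \<kappa>"])
    show "maximal_bounded_on (\<lambda>x. t x / \<kappa>) v" using bd unfolding t_def v_def[abs_def] .
    show "AE x in lebesgue. 0 < v x" using vpos by (auto elim: eventually_mono)
    show "0 < 1 / \<kappa>" using \<kappa> by simp
    show "(\<lambda>x. t x / \<kappa>) \<in> borel_measurable lebesgue" by measurable
    show "v \<in> borel_measurable lebesgue" by measurable
  qed (use tpos in blast)+
  define A' where "A' = (1 + A) * 2 ^ CARD('n)"
  define K where "K = 1 + 4 powr T * 2"
  have K: "0 < K" by (simp add: K_def add_pos_nonneg)
  define E where "E = A1_weight.hedberg_const A' CARD('n) a s K * (16 * A1_weight.doubling_const A' CARD('n) * K)"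
  define C where "C = (2 powr q2 * (\<bar>E\<bar> + 1)) powr s"
  show thesis
  proof (rule that)
    show "0 < C" by (simp add: C_def)
    fix J :: "nat set" and z :: "nat \<Rightarrow> real ^ 'n" and l c :: "nat \<Rightarrow> real" and \<mu> :: real
    assume J: "finite J" and l: "\<And>j. j \<in> J \<Longrightarrow> 0 < l j" and c: "\<And>j. j \<in> J \<Longrightarrow> 0 \<le> c j" and \<mu>: "0 < \<mu>"
    let ?Q = "\<lambda>j. cbox (z j) (z j + vec (l j))"
    define f where "f x = (\<Sum>j\<in>J. c j * indicator (?Q j) x)" for x
    define g where "g x = (\<Sum>j\<in>J. c j * (l j ^ CARD('n)) powr a * indicator (?Q j) x)" for x
    define X where "X x = g x * w x / \<mu>" for x
    assume "(\<integral>\<^sup>+x. ennreal (((\<Sum>j\<in>J. c j * indicator (?Q j) x) * w x) powr p x) \<partial>lebesgue) \<le> 1"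
    then have fp: "(\<integral>\<^sup>+x. ennreal ((f x * w x) powr p x) \<partial>lebesgue) \<le> 1" by (simp only: f_def)
    assume "(\<integral>\<^sup>+x. ennreal (((\<Sum>j\<in>J. c j * (l j ^ CARD('n)) powr a * indicator (?Q j) x) * w x / \<mu>) powr q x) \<partial>lebesgue) \<le> 1"
    then have X1: "(\<integral>\<^sup>+x. ennreal (X x powr q x) \<partial>lebesgue) \<le> 1" by (simp only: X_def g_def)
    assume "ennreal (2 powr (- q2)) \<le> (\<integral>\<^sup>+x. ennreal (((\<Sum>j\<in>J. c j * (l j ^ CARD('n)) powr a * indicator (?Q j) x) * w x / \<mu>) powr q x) \<partial>lebesgue)"
    then have X2: "ennreal (2 powr (- q2)) \<le> (\<integral>\<^sup>+x. ennreal (X x powr q x) \<partial>lebesgue)" by (simp only: X_def g_def)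
    have [measurable]: "f \<in> borel_measurable lebesgue" "g \<in> borel_measurable lebesgue"
      unfolding f_def g_def by measurable
    have [measurable]: "X \<in> borel_measurable lebesgue" unfolding X_def by measurable
    have [measurable]: "p \<in> borel_measurable lebesgue"
    proof -
      have "p = (\<lambda>x. 1 / (1 / q x + a))" using p by (simp add: fun_eq_iff flip: p)
      then show ?thesis by simp
    qed
    have f0: "0 \<le> f x" for x unfolding f_def using c by (intro sum_nonneg mult_nonneg_nonneg) auto
    have g0: "0 \<le> g x" for x unfolding g_def using c by (intro sum_nonneg mult_nonneg_nonneg) auto
    \<comment> \<open>The first factor of \<open>h\<close> is the extremal function for the duality between \<open>s q\<close> and its conjugate.\<close>
    define h where "h x = X x powr (q x - 1 / s) * w x powr (1 / s)" for x
    have h0: "0 \<le> h x" for x by (simp add: h_def)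
    have [measurable]: "h \<in> borel_measurable lebesgue" unfolding h_def by measurable
    have X0: "AE x in lebesgue. 0 \<le> X x"
      using w\<omega> by (rule eventually_mono) (auto simp: X_def g0 \<mu> intro!: divide_nonneg_pos mult_nonneg_nonneg)
    have "modular (\<lambda>x. t x / \<kappa>) (\<lambda>x. ennreal (h x powr \<kappa>) * v x) = (\<integral>\<^sup>+x. ennreal (X x powr q x) \<partial>lebesgue)"
      unfolding modular_def
    proof (rule nn_integral_cong_AE)
      show "AE x in lebesgue. ennreal_rpow (ennreal (h x powr \<kappa>) * v x) (t x / \<kappa>) = ennreal (X x powr q x)"
        using vpos w\<omega> tb
      proof eventually_elim
        case (elim x)
        define k where "k = X x powr (q x - 1 / s)"
        have w0: "0 < w x" using elim by simp
        have "ennreal (h x powr \<kappa>) * v x = ennreal (h x powr \<kappa> * w x powr (- (\<kappa> / s)))"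
          using elim by (simp add: ennreal_mult'[symmetric])
        also have "h x powr \<kappa> * w x powr (- (\<kappa> / s)) = k powr \<kappa>"
        proof -
          have "h x powr \<kappa> = k powr \<kappa> * w x powr (\<kappa> / s)"
            unfolding h_def k_def[symmetric] by (simp add: powr_mult powr_powr k_def)
          then show ?thesis using w0 by (simp add: mult.assoc powr_add[symmetric])
        qed
        finally have "ennreal_rpow (ennreal (h x powr \<kappa>) * v x) (t x / \<kappa>) = ennreal ((k powr \<kappa>) powr (t x / \<kappa>))"
          using elim \<kappa> by (simp add: ennreal_rpow_ennreal_nonneg)
        also have "(k powr \<kappa>) powr (t x / \<kappa>) = X x powr ((q x - 1 / s) * t x)"
          using \<kappa> by (simp add: powr_powr k_def)
        also have "(q x - 1 / s) * t x = q x"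
        proof -
          have "s * q x \<noteq> 0" "s * q x - 1 \<noteq> 0" "s \<noteq> 0" "q x \<noteq> 0" using elim s by auto
          then show ?thesis unfolding t_def conj_exponent_def by (simp add: field_simps)
        qed
        finally show ?case .
      qed
    qed
    with X1 have "modular (\<lambda>x. t x / \<kappa>) (\<lambda>x. ennreal (h x powr \<kappa>) * v x) \<le> 1" by simp
    then obtain U where U[measurable]: "U \<in> borel_measurable lebesgue" and hU: "\<And>x. ennreal (h x powr \<kappa>) \<le> U x"
      and Um: "modular (\<lambda>x. t x / \<kappa>) (\<lambda>x. U x * v x / 4) \<le> 2" and UA: "\<And>x. HL_max U x \<le> ennreal A * U x"
      using A(2)[of "\<lambda>x. ennreal (h x powr \<kappa>)"] by auto
    have Ufin: "AE x in lebesgue. U x < \<infinity>"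
    proof -
      have "AE x in lebesgue. ennreal_rpow (U x * v x / 4) (t x / \<kappa>) \<noteq> \<infinity>"
        using Um unfolding modular_def by (intro nn_integral_PInf_AE) (auto simp: top_unique)
      then show ?thesis using vpos tb
      proof eventually_elim
        case (elim x)
        have "0 < t x / \<kappa>" using elim \<kappa> by simp
        moreover have "U x * v x / 4 = \<infinity>" if "U x = \<infinity>"
          using that elim divide_ennreal_real[of 4 top] by (auto simp: ennreal_top_mult)
        ultimately show ?case using elim by (cases "U x = \<infinity>") (auto simp: ennreal_rpow_pos less_top)
      qed
    qed
    have Unz: "\<not> (AE x in lebesgue. U x = 0)"
    proof
      assume "AE x in lebesgue. U x = 0"
      then have "AE x in lebesgue. ennreal (X x powr q x) = 0"
        using w\<omega> tb
      proof eventually_elim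
        case (elim x)
        then have "h x powr \<kappa> = 0" using hU[of x] by (simp add: ennreal_eq_0_iff)
        then have "X x = 0" using elim by (auto simp: h_def)
        then show ?case by simp
      qed
      then have "(\<integral>\<^sup>+x. ennreal (X x powr q x) \<partial>lebesgue) = 0" by (subst nn_integral_0_iff_AE) auto
      then show False using X2 by (simp add: ennreal_eq_0_iff not_le)
    qed
    obtain W where W: "A1_weight W A' CARD('n)" and UW: "AE x in lebesgue. U x = ennreal (W x powr \<kappa>)"
      using A1_weight_root[OF U A(1) UA Ufin Unz, of \<kappa>] \<kappa> unfolding A'_def by auto
    have W0: "0 < W x" for x using W by (rule A1_weight.W_pos)
    have Wm[measurable]: "W \<in> borel_measurable lebesgue" using W by (rule A1_weight.measurable_W)
    have hW: "AE x in lebesgue. h x \<le> W x"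
      using UW
    proof eventually_elim
      case (elim x)
      then have "h x powr \<kappa> \<le> W x powr \<kappa>" using hU[of x] by simp
      then show ?case using h0[of x] W0[of x] \<kappa> powr_less_mono2[of \<kappa> "W x" "h x"] by (smt (verit))
    qed
    \<comment> \<open>The factor that \<open>U v\<close> controls: \<open>b powr \<kappa> = U v\<close> almost everywhere.\<close>
    define b where "b x = W x * w x powr (- (1 / s))" for x
    have [measurable]: "b \<in> borel_measurable lebesgue" unfolding b_def by measurable
    have bt: "(\<integral>\<^sup>+x. ennreal (b x powr t x) \<partial>lebesgue) \<le> ennreal (4 powr T * 2)"
    proof -
      have "(\<integral>\<^sup>+x. ennreal (b x powr t x) \<partial>lebesgue)
        \<le> (\<integral>\<^sup>+x. ennreal (4 powr T) * ennreal_rpow (U x * v x / 4) (t x / \<kappa>) \<partial>lebesgue)"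
      proof (rule nn_integral_mono_AE)
        show "AE x in lebesgue. ennreal (b x powr t x) \<le> ennreal (4 powr T) * ennreal_rpow (U x * v x / 4) (t x / \<kappa>)"
          using UW vpos w\<omega> tb
        proof eventually_elim
          case (elim x)
          have w0: "0 < w x" using elim by simp
          have b0: "0 < b x" using W0[of x] w0 by (simp add: b_def)
          have "b x powr \<kappa> = W x powr \<kappa> * w x powr (- (\<kappa> / s))"
            using W0[of x] by (simp add: b_def powr_mult powr_powr)
          then have "U x * v x = ennreal (b x powr \<kappa>)"
            using elim by (simp add: ennreal_mult'[symmetric])
          then have "U x * v x / 4 = ennreal (b x powr \<kappa> / 4)"
            using divide_ennreal_real[of 4 "U x * v x"] by (simp add: ennreal_mult'[symmetric])
          then have "ennreal_rpow (U x * v x / 4) (t x / \<kappa>) = ennreal ((b x powr \<kappa> / 4) powr (t x / \<kappa>))"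
            using b0 by (simp add: ennreal_rpow_ennreal)
          also have "(b x powr \<kappa> / 4) powr (t x / \<kappa>) = b x powr t x / 4 powr (t x / \<kappa>)"
            using \<kappa> by (simp add: powr_divide powr_powr)
          finally have eq: "ennreal_rpow (U x * v x / 4) (t x / \<kappa>) = ennreal (b x powr t x / 4 powr (t x / \<kappa>))" .
          have "t x / \<kappa> \<le> t x" using elim \<kappa> mult_left_mono[of 1 \<kappa> "t x"] by (simp add: divide_le_eq)
          then have "t x / \<kappa> \<le> T" using elim by simp
          then have "4 powr (t x / \<kappa>) \<le> 4 powr T" by (intro powr_mono) auto
          then have "b x powr t x \<le> 4 powr T * (b x powr t x / 4 powr (t x / \<kappa>))"
            using b0 by (simp add: le_divide_eq mult.commute mult_right_mono)
          then show ?case unfolding eq by (simp add: ennreal_mult'[symmetric] ennreal_leI)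
        qed
      qed
      also have "\<dots> = ennreal (4 powr T) * modular (\<lambda>x. t x / \<kappa>) (\<lambda>x. U x * v x / 4)"
        unfolding modular_def by (rule nn_integral_cmult) measurable
      also have "\<dots> \<le> ennreal (4 powr T) * 2" by (intro mult_left_mono Um) simp
      also have "\<dots> = ennreal (4 powr T * 2)" by (simp add: ennreal_mult')
      finally show ?thesis .
    qed
    have fK: "(\<integral>\<^sup>+x. ennreal (f x powr (1 / (s + a)) * W x powr (s / (s + a))) \<partial>lebesgue) \<le> ennreal K"
    proof -
      have "(\<integral>\<^sup>+x. ennreal (f x powr (1 / (s + a)) * W x powr (s / (s + a))) \<partial>lebesgue)
        \<le> (\<integral>\<^sup>+x. ennreal ((f x * w x) powr p x) + ennreal (b x powr t x) \<partial>lebesgue)"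
      proof (rule nn_integral_mono_AE)
        show "AE x in lebesgue. ennreal (f x powr (1 / (s + a)) * W x powr (s / (s + a)))
            \<le> ennreal ((f x * w x) powr p x) + ennreal (b x powr t x)"
          using w\<omega> tb
        proof eventually_elim
          case (elim x)
          have w0: "0 < w x" and qx: "0 < q x" and sq: "1 < s * q x" and tx: "0 < t x" using elim by auto
          \<comment> \<open>The weight of \<open>f w\<close> in Young's inequality; the relation between \<open>p\<close> and \<open>q\<close> gives \<open>\<theta>'\<close>.\<close>
          define \<theta> where "\<theta> = (1 / (s + a)) * (1 / p x)"
          have ppos: "0 < p x"
          proof -
            have "0 < 1 / p x" using p[of x] qx a by (simp add: add_pos_pos)
            then show ?thesis by simp
          qed
          have sqx: "1 / q x < s" using sq qx by (simp add: divide_less_eq mult.commute)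
          have \<theta>: "0 < \<theta>" "\<theta> < 1"
          proof -
            have "0 < 1 / q x" using qx by simp
            then have "0 < (1 / q x + a) / (s + a)" using s a by (intro divide_pos_pos add_pos_pos) auto
            moreover have "(1 / q x + a) / (s + a) < 1" using sqx s a by (subst divide_less_eq_1_pos) auto
            ultimately show "0 < \<theta>" "\<theta> < 1" unfolding \<theta>_def p by auto
          qed
          have \<theta>': "1 - \<theta> = (s / (s + a)) * (1 / t x)"
          proof -
            have "1 / t x = 1 - 1 / (s * q x)" by (simp add: t_def conj_exponent_def)
            moreover have "s * (1 / (s * q x)) = 1 / q x" using s by simp
            ultimately have "s * (1 / t x) = s - 1 / q x" by (simp add: right_diff_distrib)
            moreover have "(s + a) * \<theta> = 1 / q x + a"
              unfolding \<theta>_def p using s a by simp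
            ultimately have "(s + a) * (1 - \<theta>) = s * (1 / t x)" by (simp add: right_diff_distrib)
            then have "(s + a) * (1 - \<theta>) / (s + a) = s * (1 / t x) / (s + a)" by (simp only:)
            moreover have "(s + a) * (1 - \<theta>) / (s + a) = 1 - \<theta>"
              using s a by (intro nonzero_mult_div_cancel_left) auto
            ultimately have "1 - \<theta> = s * (1 / t x) / (s + a)" by (simp only:)
            then show ?thesis by simp
          qed
          have "f x powr (1 / (s + a)) * W x powr (s / (s + a))
            = (f x * w x) powr (1 / (s + a)) * b x powr (s / (s + a))"
          proof -
            have "b x powr (s / (s + a)) = W x powr (s / (s + a)) * w x powr (- (1 / (s + a)))"
            proof -
              have "- (1 / s) * (s / (s + a)) = - (1 / (s + a))" using s by simp
              then show ?thesis using W0[of x] by (simp only: b_def powr_mult powr_powr)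
            qed
            moreover have "(f x * w x) powr (1 / (s + a)) = f x powr (1 / (s + a)) * w x powr (1 / (s + a))"
              using f0[of x] w0 by (simp add: powr_mult)
            moreover have "w x powr (1 / (s + a)) * w x powr (- (1 / (s + a))) = 1"
              using w0 by (simp add: powr_add[symmetric])
            ultimately show ?thesis by (simp add: algebra_simps)
          qed
          also have "(f x * w x) powr (1 / (s + a)) = ((f x * w x) powr p x) powr \<theta>"
          proof -
            have "p x * \<theta> = 1 / (s + a)" using ppos by (simp add: \<theta>_def)
            then show ?thesis by (simp only: powr_powr)
          qed
          also have "b x powr (s / (s + a)) = (b x powr t x) powr (1 - \<theta>)"
          proof -
            have "t x * (1 - \<theta>) = s / (s + a)" unfolding \<theta>' using tx by simp
            then show ?thesis by (simp only: powr_powr)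
          qed
          also have "((f x * w x) powr p x) powr \<theta> * (b x powr t x) powr (1 - \<theta>) \<le> (f x * w x) powr p x + b x powr t x"
            by (intro powr_interpolation_le_add \<theta>) auto
          finally show ?case by (simp add: ennreal_leI flip: ennreal_plus)
        qed
      qed
      also have "\<dots> = (\<integral>\<^sup>+x. ennreal ((f x * w x) powr p x) \<partial>lebesgue) + (\<integral>\<^sup>+x. ennreal (b x powr t x) \<partial>lebesgue)"
        by (rule nn_integral_add) measurable
      also have "\<dots> \<le> 1 + ennreal (4 powr T * 2)" by (intro add_mono fp bt)
      also have "\<dots> = ennreal K" unfolding K_def by (subst ennreal_plus) auto
      finally show ?thesis .
    qed
    have key: "(\<integral>\<^sup>+x. ennreal (g x powr (1 / s) * W x) \<partial>lebesgue) \<le> ennreal E"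
      unfolding g_def E_def
      using A1_weight.A1_sum_of_cubes_estimate[OF W J a _ K l c fK[unfolded f_def]] s by simp
    have "ennreal (2 powr (- q2)) \<le> ennreal (\<mu> powr (- (1 / s))) * ennreal E"
    proof -
      have "(\<integral>\<^sup>+x. ennreal (X x powr q x) \<partial>lebesgue)
        \<le> (\<integral>\<^sup>+x. ennreal (\<mu> powr (- (1 / s))) * ennreal (g x powr (1 / s) * W x) \<partial>lebesgue)"
      proof (rule nn_integral_mono_AE)
        show "AE x in lebesgue. ennreal (X x powr q x) \<le> ennreal (\<mu> powr (- (1 / s))) * ennreal (g x powr (1 / s) * W x)"
          using hW w\<omega>
        proof eventually_elim
          case (elim x)
          have w0: "0 < w x" using elim by simp
          have "X x powr q x = X x powr (1 / s) * X x powr (q x - 1 / s)" by (simp add: powr_add[symmetric])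
          also have "X x powr (1 / s) = g x powr (1 / s) * w x powr (1 / s) * \<mu> powr (- (1 / s))"
            using g0[of x] w0 \<mu> by (simp add: X_def powr_mult powr_divide powr_minus_divide)
          finally have "X x powr q x = \<mu> powr (- (1 / s)) * (g x powr (1 / s) * h x)"
            by (simp add: h_def mult_ac)
          also have "\<dots> \<le> \<mu> powr (- (1 / s)) * (g x powr (1 / s) * W x)"
            using elim by (intro mult_left_mono) auto
          finally show ?case by (simp add: ennreal_mult'[symmetric] ennreal_leI)
        qed
      qed
      also have "\<dots> = ennreal (\<mu> powr (- (1 / s))) * (\<integral>\<^sup>+x. ennreal (g x powr (1 / s) * W x) \<partial>lebesgue)"
        by (rule nn_integral_cmult) measurable
      also have "\<dots> \<le> ennreal (\<mu> powr (- (1 / s))) * ennreal E" by (intro mult_left_mono key) simp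
      finally show ?thesis using X2 by (rule order_trans[rotated])
    qed
    also have "\<dots> \<le> ennreal (\<mu> powr (- (1 / s))) * ennreal (\<bar>E\<bar> + 1)"
      by (intro mult_left_mono ennreal_leI) auto
    also have "\<dots> = ennreal (\<mu> powr (- (1 / s)) * (\<bar>E\<bar> + 1))" by (simp add: ennreal_mult')
    finally have "2 powr (- q2) \<le> \<mu> powr (- (1 / s)) * (\<bar>E\<bar> + 1)" by (simp add: add_nonneg_nonneg)
    then have "\<mu> powr (1 / s) \<le> 2 powr q2 * (\<bar>E\<bar> + 1)"
      using \<mu> by (simp add: powr_minus field_simps)
    then have "(\<mu> powr (1 / s)) powr s \<le> C"
      unfolding C_def using s by (intro powr_mono2) auto
    then show "\<mu> \<le> C" using \<mu> s by (simp add: powr_powr)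
  qed
qed

text \<open>The modular of \<open>g w / 2\<^sup>k\<close> tends to \<open>0\<close>, because \<open>g\<close> is bounded and supported in finitely many cubes on
  which \<open>w\<^sup>q\<close> is integrable. At the least \<open>k\<close> for which it is at most \<open>1\<close> it is still at least
  \<open>2^(-q2)\<close>, unless \<open>k = 0\<close>, and the bound for such critical scales applies to \<open>2\<^sup>k\<close>.\<close>

lemma strong_bound_finite:
  fixes \<omega> :: "real ^ 'n \<Rightarrow> ennreal" and p q w :: "real ^ 'n \<Rightarrow> real" and a s \<kappa> :: real
  assumes a: "0 < a" and s: "1 < s" and q1: "1 < s * q1" and \<kappa>: "1 < \<kappa>"
    and q[measurable]: "q \<in> borel_measurable lebesgue" and qpos: "\<And>x. 0 < q x"
    and qb: "AE x in lebesgue. q1 \<le> q x \<and> q x \<le> q2"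
    and \<omega>[measurable]: "\<omega> \<in> borel_measurable lebesgue"
    and w[measurable]: "w \<in> borel_measurable lebesgue"
    and w\<omega>: "AE x in lebesgue. 0 < w x \<and> \<omega> x = ennreal (w x)"
    and p: "\<And>x. 1 / p x = 1 / q x + a"
    and bd: "maximal_bounded_on (\<lambda>x. conj_exponent (\<lambda>y. s * q y) x / \<kappa>) (\<lambda>x. ennreal_rpow (\<omega> x) (- (\<kappa> / s)))"
    and loc: "\<And>Q. Q \<in> cubes \<Longrightarrow> (\<integral>\<^sup>+x\<in>Q. ennreal (w x powr q x) \<partial>lebesgue) < \<infinity>"
  obtains C :: real where "0 < C"
    "\<And>(J :: nat set) z l c. finite J \<Longrightarrow> (\<And>j. j \<in> J \<Longrightarrow> 0 < l j) \<Longrightarrow> (\<And>j. j \<in> J \<Longrightarrow> 0 \<le> c j) \<Longrightarrow>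
      (\<integral>\<^sup>+x. ennreal (((\<Sum>j\<in>J. c j * indicator (cbox (z j) (z j + vec (l j))) x) * w x) powr p x) \<partial>lebesgue) \<le> 1 \<Longrightarrow>
      (\<integral>\<^sup>+x. ennreal (((\<Sum>j\<in>J. c j * (l j ^ CARD('n)) powr a * indicator (cbox (z j) (z j + vec (l j))) x) * w x / C) powr q x) \<partial>lebesgue) \<le> 1"
proof -
  have "0 < s * q1" using q1 by linarith
  then have q1pos: "0 < q1" using s by (simp add: zero_less_mult_iff)
  from scaling_bound_of_critical_modular[OF a s q1 \<kappa> q qb \<omega> w w\<omega> p bd]
  obtain C0 :: real where C0: "0 < C0"
    "\<And>(J :: nat set) z l c \<mu>. finite J \<Longrightarrow> (\<And>j. j \<in> J \<Longrightarrow> 0 < l j) \<Longrightarrow> (\<And>j. j \<in> J \<Longrightarrow> 0 \<le> c j) \<Longrightarrow> 0 < \<mu> \<Longrightarrow>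
      (\<integral>\<^sup>+x. ennreal (((\<Sum>j\<in>J. c j * indicator (cbox (z j) (z j + vec (l j))) x) * w x) powr p x) \<partial>lebesgue) \<le> 1 \<Longrightarrow>
      (\<integral>\<^sup>+x. ennreal (((\<Sum>j\<in>J. c j * (l j ^ CARD('n)) powr a * indicator (cbox (z j) (z j + vec (l j))) x) * w x / \<mu>) powr q x) \<partial>lebesgue) \<le> 1 \<Longrightarrow>
      ennreal (2 powr (- q2)) \<le> (\<integral>\<^sup>+x. ennreal (((\<Sum>j\<in>J. c j * (l j ^ CARD('n)) powr a * indicator (cbox (z j) (z j + vec (l j))) x) * w x / \<mu>) powr q x) \<partial>lebesgue) \<Longrightarrow>
      \<mu> \<le> C0"
    by blast
  define C where "C = max 1 C0"
  show thesis
  proof (rule that)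
    show "0 < C" by (simp add: C_def)
    fix J :: "nat set" and z :: "nat \<Rightarrow> real ^ 'n" and l c :: "nat \<Rightarrow> real"
    assume J: "finite J" and l: "\<And>j. j \<in> J \<Longrightarrow> 0 < l j" and c: "\<And>j. j \<in> J \<Longrightarrow> 0 \<le> c j"
      and fp: "(\<integral>\<^sup>+x. ennreal (((\<Sum>j\<in>J. c j * indicator (cbox (z j) (z j + vec (l j))) x) * w x) powr p x) \<partial>lebesgue) \<le> 1"
    let ?Q = "\<lambda>j. cbox (z j) (z j + vec (l j))"
    define d where "d j = c j * (l j ^ CARD('n)) powr a" for j
    define g where "g x = (\<Sum>j\<in>J. d j * indicator (?Q j) x)" for x
    define m where "m \<mu> = (\<integral>\<^sup>+x. ennreal ((g x * w x / \<mu>) powr q x) \<partial>lebesgue)" for \<mu>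
    have [measurable]: "g \<in> borel_measurable lebesgue" unfolding g_def by measurable
    have d0: "0 \<le> d j" if "j \<in> J" for j using c[OF that] by (simp add: d_def)
    have g0: "0 \<le> g x" for x unfolding g_def using d0 by (intro sum_nonneg mult_nonneg_nonneg) auto
    have crit: "\<mu> \<le> C0" if "0 < \<mu>" "m \<mu> \<le> 1" "ennreal (2 powr (- q2)) \<le> m \<mu>" for \<mu>
      using C0(2)[OF J l c that(1) fp] that(2,3) unfolding m_def g_def d_def by blast
    have mono: "m \<mu>' \<le> m \<mu>" if "0 < \<mu>" "\<mu> \<le> \<mu>'" for \<mu> \<mu>'
      unfolding m_def
    proof (rule nn_integral_mono_AE)
      show "AE x in lebesgue. ennreal ((g x * w x / \<mu>') powr q x) \<le> ennreal ((g x * w x / \<mu>) powr q x)"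
        using w\<omega>
      proof eventually_elim
        case (elim x)
        then have "g x * w x / \<mu>' \<le> g x * w x / \<mu>" "0 \<le> g x * w x / \<mu>'"
          using that g0[of x] by (auto intro!: divide_left_mono mult_nonneg_nonneg divide_nonneg_nonneg)
        then show ?case using qpos[of x] by (intro ennreal_leI powr_mono2) auto
      qed
    qed
    have halve: "ennreal (2 powr (- q2)) * m \<mu> \<le> m (2 * \<mu>)" if "0 < \<mu>" for \<mu>
    proof -
      have "ennreal (2 powr (- q2)) * m \<mu> = (\<integral>\<^sup>+x. ennreal (2 powr (- q2)) * ennreal ((g x * w x / \<mu>) powr q x) \<partial>lebesgue)"
        unfolding m_def by (rule nn_integral_cmult[symmetric]) measurable
      also have "\<dots> \<le> m (2 * \<mu>)"
        unfolding m_def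
      proof (rule nn_integral_mono_AE)
        show "AE x in lebesgue. ennreal (2 powr (- q2)) * ennreal ((g x * w x / \<mu>) powr q x)
            \<le> ennreal ((g x * w x / (2 * \<mu>)) powr q x)"
          using qb w\<omega>
        proof eventually_elim
          case (elim x)
          let ?X = "g x * w x / \<mu>"
          have "2 powr (- q2) * ?X powr q x \<le> 2 powr (- q x) * ?X powr q x"
            using elim by (intro mult_right_mono powr_mono) auto
          also have "2 powr (- q x) * Y powr q x = (Y / 2) powr q x" for Y :: real
            by (simp add: powr_divide powr_minus_divide)
          also have "?X / 2 = g x * w x / (2 * \<mu>)" by simp
          finally show ?case by (simp add: ennreal_mult'[symmetric] ennreal_leI)
        qed
      qed
      finally show ?thesis .
    qed
    have small: "\<exists>k::nat. m (2 ^ k) \<le> 1"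
    proof -
      define B where "B = sum d J + 1"
      have B: "0 < B" unfolding B_def using d0 by (intro add_nonneg_pos sum_nonneg) auto
      have gB: "g x \<le> B" for x
        using cube_sum_le[of J d ?Q x] d0 by (simp add: g_def B_def)
      define I where "I = (\<Sum>j\<in>J. \<integral>\<^sup>+x\<in>?Q j. ennreal (w x powr q x) \<partial>lebesgue)"
      have "I < \<infinity>" unfolding I_def infinity_ennreal_def
      proof (subst ennreal_sum_less_top[OF J], intro ballI)
        fix j assume "j \<in> J"
        then have "?Q j \<in> cubes" using l unfolding cubes_def by blast
        then show "(\<integral>\<^sup>+x\<in>?Q j. ennreal (w x powr q x) \<partial>lebesgue) < top" using loc by simp
      qed
      then obtain i where i: "0 \<le> i" "I = ennreal i" by (cases I) auto
      have est: "m \<mu> \<le> ennreal ((B / \<mu>) powr q1 * i)" if "B \<le> \<mu>" for \<mu>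
      proof -
        have \<mu>: "0 < \<mu>" using B that by simp
        have "m \<mu> \<le> (\<integral>\<^sup>+x. (\<Sum>j\<in>J. ennreal ((B / \<mu>) powr q1) * (ennreal (w x powr q x) * indicator (?Q j) x)) \<partial>lebesgue)"
          unfolding m_def
        proof (rule nn_integral_mono_AE)
          show "AE x in lebesgue. ennreal ((g x * w x / \<mu>) powr q x)
            \<le> (\<Sum>j\<in>J. ennreal ((B / \<mu>) powr q1) * (ennreal (w x powr q x) * indicator (?Q j) x))"
            using qb w\<omega>
          proof eventually_elim
            case (elim x)
            show ?case
            proof (cases "\<exists>j\<in>J. x \<in> ?Q j")
              case True
              then obtain j where j: "j \<in> J" "x \<in> ?Q j" by blast
              have "g x * w x / \<mu> \<le> B / \<mu> * w x"
                using gB[of x] elim \<mu> by (simp add: divide_right_mono mult_right_mono)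
              then have "(g x * w x / \<mu>) powr q x \<le> (B / \<mu> * w x) powr q x"
                using g0[of x] elim \<mu> qpos[of x] by (intro powr_mono2) auto
              also have "\<dots> = (B / \<mu>) powr q x * w x powr q x"
                by (rule powr_mult)
              also have "\<dots> \<le> (B / \<mu>) powr q1 * w x powr q x"
                using B \<mu> elim that by (intro mult_right_mono powr_mono') auto
              finally have "ennreal ((g x * w x / \<mu>) powr q x)
                  \<le> ennreal ((B / \<mu>) powr q1) * (ennreal (w x powr q x) * indicator (?Q j) x)"
                using j by (simp add: ennreal_mult'[symmetric] ennreal_leI)
              also have "\<dots> \<le> (\<Sum>j\<in>J. ennreal ((B / \<mu>) powr q1) * (ennreal (w x powr q x) * indicator (?Q j) x))"
                using J j by (intro member_le_sum) auto
              finally show ?thesis .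
            next
              case False
              then have "g x = 0" unfolding g_def by (intro sum.neutral) auto
              then show ?thesis by simp
            qed
          qed
        qed
        also have "\<dots> = (\<Sum>j\<in>J. \<integral>\<^sup>+x. ennreal ((B / \<mu>) powr q1) * (ennreal (w x powr q x) * indicator (?Q j) x) \<partial>lebesgue)"
          by (rule nn_integral_sum[where P = J and
                f = "\<lambda>j x. ennreal ((B / \<mu>) powr q1) * (ennreal (w x powr q x) * indicator (?Q j) x)"]) measurable
        also have "\<dots> = (\<Sum>j\<in>J. ennreal ((B / \<mu>) powr q1) * (\<integral>\<^sup>+x\<in>?Q j. ennreal (w x powr q x) \<partial>lebesgue))"
        proof (intro sum.cong refl)
          fix j
          show "(\<integral>\<^sup>+x. ennreal ((B / \<mu>) powr q1) * (ennreal (w x powr q x) * indicator (?Q j) x) \<partial>lebesgue)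
              = ennreal ((B / \<mu>) powr q1) * (\<integral>\<^sup>+x\<in>?Q j. ennreal (w x powr q x) \<partial>lebesgue)"
            by (rule nn_integral_cmult) measurable
        qed
        also have "\<dots> = ennreal ((B / \<mu>) powr q1) * I" by (simp add: I_def sum_distrib_left)
        also have "\<dots> = ennreal ((B / \<mu>) powr q1 * i)" using i by (simp add: ennreal_mult')
        finally show ?thesis .
      qed
      obtain k where k: "B * (i + 1) powr (1 / q1) < 2 ^ k" using real_arch_pow[of 2] by auto
      have i1: "1 \<le> (i + 1) powr (1 / q1)" using i q1pos by (intro ge_one_powr_ge_zero) auto
      then have "B * 1 \<le> B * (i + 1) powr (1 / q1)" using B by (intro mult_left_mono) auto
      then have Bk: "B \<le> 2 ^ k" using k by simp
      have "0 < (i + 1) powr (1 / q1)" using i1 by linarith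
      then have "B / 2 ^ k \<le> 1 / (i + 1) powr (1 / q1)" using k by (simp add: pos_le_divide_eq pos_divide_le_eq)
      then have "(B / 2 ^ k) powr q1 \<le> (1 / (i + 1) powr (1 / q1)) powr q1"
        using B q1pos by (intro powr_mono2) auto
      also have "\<dots> = 1 / (i + 1)" using i q1pos by (simp add: powr_divide powr_powr)
      finally have "(B / 2 ^ k) powr q1 * i \<le> 1 / (i + 1) * i" using i by (intro mult_right_mono) auto
      also have "\<dots> \<le> 1" using i by (simp add: divide_le_eq)
      finally have "m (2 ^ k) \<le> ennreal 1" using est[OF Bk] by (meson ennreal_leI order_trans)
      then show ?thesis by auto
    qed
    define k where "k = (LEAST k. m (2 ^ k) \<le> 1)"
    have k: "m (2 ^ k) \<le> 1" unfolding k_def using small by (rule LeastI_ex)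
    have "2 ^ k \<le> C"
    proof (cases k)
      case 0
      then show ?thesis by (simp add: C_def)
    next
      case (Suc k')
      then have "\<not> m (2 ^ k') \<le> 1" using not_less_Least[of k' "\<lambda>k. m (2 ^ k) \<le> 1"] by (simp add: k_def)
      then have "ennreal (2 powr (- q2)) * 1 \<le> ennreal (2 powr (- q2)) * m (2 ^ k')"
        by (intro mult_left_mono) auto
      also have "\<dots> \<le> m (2 ^ k)" using halve[of "2 ^ k'"] Suc by simp
      finally have "2 ^ k \<le> C0" using k by (intro crit) auto
      then show ?thesis by (simp add: C_def)
    qed
    then have "m C \<le> 1" using mono[of "2 ^ k" C] k by (meson order_trans zero_less_numeral zero_less_power)
    then show "(\<integral>\<^sup>+x. ennreal (((\<Sum>j\<in>J. c j * (l j ^ CARD('n)) powr a * indicator (?Q j) x) * w x / C) powr q x) \<partial>lebesgue) \<le> 1"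
      by (simp only: m_def g_def d_def)
  qed
qed

lemma infsum_ennreal_eq_SUP_initial:
  fixes h :: "nat \<Rightarrow> ennreal"
  shows "infsum h J = (SUP k. sum h (J \<inter> {..<k}))"
proof (rule antisym)
  have eq: "infsum h J = (SUP F\<in>{F. finite F \<and> F \<subseteq> J}. sum h F)"
    by (rule nonneg_infsum_complete) simp
  show "infsum h J \<le> (SUP k. sum h (J \<inter> {..<k}))"
    unfolding eq
  proof (rule SUP_least)
    fix F assume F: "F \<in> {F. finite F \<and> F \<subseteq> J}"
    then obtain k where "\<forall>j\<in>F. j < k" using finite_nat_set_iff_bounded[of F] by auto
    then have "sum h F \<le> sum h (J \<inter> {..<k})" using F by (intro sum_mono2) auto
    also have "\<dots> \<le> (SUP k. sum h (J \<inter> {..<k}))" by (rule SUP_upper) simp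
    finally show "sum h F \<le> (SUP k. sum h (J \<inter> {..<k}))" .
  qed
  show "(SUP k. sum h (J \<inter> {..<k})) \<le> infsum h J"
    unfolding eq by (intro SUP_least SUP_upper) auto
qed

lemma ennreal_le_cmult_Inf:
  assumes C: "0 < C" and "\<And>y. y \<in> S \<Longrightarrow> x \<le> ennreal C * y"
  shows "x \<le> ennreal C * Inf S"
proof -
  have inv: "ennreal (1 / C) * ennreal C = 1" using C by (simp add: ennreal_mult'[symmetric])
  have "ennreal (1 / C) * x \<le> Inf S"
  proof (rule Inf_greatest)
    fix y assume "y \<in> S"
    then have "ennreal (1 / C) * x \<le> ennreal (1 / C) * (ennreal C * y)" using assms by (intro mult_left_mono) auto
    then show "ennreal (1 / C) * x \<le> y" by (simp only: mult.assoc[symmetric] inv mult_1)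
  qed
  then have "ennreal C * (ennreal (1 / C) * x) \<le> ennreal C * Inf S" by (intro mult_left_mono) auto
  then show ?thesis by (simp only: mult.assoc[symmetric] mult.commute[of "ennreal C"] inv mult_1)
qed

text \<open>The power \<open>r\<close> of the weight and the division of the exponent by \<open>r\<close> cancel, up to a bounded
  factor from the normalising constant of the norm.\<close>

lemma local_integrability_of_char_norm:
  fixes \<omega> :: "real ^ 'n \<Rightarrow> ennreal"
  assumes r: "0 < r" and qb: "AE x in lebesgue. 0 < q x \<and> q x \<le> q2"
    and [measurable]: "q \<in> borel_measurable lebesgue" "\<omega> \<in> borel_measurable lebesgue"
    and w\<omega>: "AE x in lebesgue. 0 < w x \<and> \<omega> x = ennreal (w x)"
    and Q[measurable]: "Q \<in> sets lebesgue"
    and fin: "weighted_norm (\<lambda>x. q x / r) (\<lambda>x. ennreal_rpow (\<omega> x) r) (indicator Q) < \<infinity>"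
  shows "(\<integral>\<^sup>+x\<in>Q. ennreal (w x powr q x) \<partial>lebesgue) < \<infinity>"
proof -
  obtain l where l: "0 < l" "(\<integral>\<^sup>+x. ennreal_rpow (indicator Q x * ennreal_rpow (\<omega> x) r / ennreal l) (q x / r) \<partial>lebesgue) \<le> 1"
    using fin unfolding weighted_norm_def Lp_norm_def Inf_less_iff by blast
  have "(\<integral>\<^sup>+x\<in>Q. ennreal (w x powr q x) \<partial>lebesgue)
    \<le> (\<integral>\<^sup>+x. ennreal (max 1 l powr (q2 / r)) *
          ennreal_rpow (indicator Q x * ennreal_rpow (\<omega> x) r / ennreal l) (q x / r) \<partial>lebesgue)"
  proof (rule nn_integral_mono_AE)
    show "AE x in lebesgue. ennreal (w x powr q x) * indicator Q x \<le> ennreal (max 1 l powr (q2 / r)) *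
          ennreal_rpow (indicator Q x * ennreal_rpow (\<omega> x) r / ennreal l) (q x / r)"
      using qb w\<omega>
    proof eventually_elim
      case (elim x)
      show ?case
      proof (cases "x \<in> Q")
        case True
        have "indicator Q x * ennreal_rpow (\<omega> x) r / ennreal l = ennreal (w x powr r / l)"
          using True elim l(1) by (simp add: ennreal_rpow_ennreal divide_ennreal_real ennreal_mult'[symmetric])
        then have eq: "ennreal_rpow (indicator Q x * ennreal_rpow (\<omega> x) r / ennreal l) (q x / r)
            = ennreal ((w x powr r / l) powr (q x / r))"
          using elim l(1) by (simp add: ennreal_rpow_ennreal)
        have "l powr (q x / r) \<le> max 1 l powr (q x / r)" using l(1) r elim by (intro powr_mono2) auto
        also have "\<dots> \<le> max 1 l powr (q2 / r)" using r elim by (intro powr_mono divide_right_mono) auto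
        finally have "w x powr q x * l powr (q x / r) \<le> w x powr q x * max 1 l powr (q2 / r)"
          by (intro mult_left_mono) auto
        then have "w x powr q x \<le> (w x powr q x * max 1 l powr (q2 / r)) / l powr (q x / r)"
          using l(1) by (subst pos_le_divide_eq) auto
        moreover have "(w x powr r / l) powr (q x / r) = w x powr q x / l powr (q x / r)"
          using r l(1) by (simp add: powr_divide powr_powr)
        ultimately have "w x powr q x \<le> max 1 l powr (q2 / r) * (w x powr r / l) powr (q x / r)"
          by (simp add: mult.commute)
        then show ?thesis unfolding eq using True by (simp add: ennreal_mult'[symmetric] ennreal_leI)
      qed simp
    qed
  qed
  also have "\<dots> = ennreal (max 1 l powr (q2 / r)) *
      (\<integral>\<^sup>+x. ennreal_rpow (indicator Q x * ennreal_rpow (\<omega> x) r / ennreal l) (q x / r) \<partial>lebesgue)"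
    by (rule nn_integral_cmult) measurable
  also have "\<dots> \<le> ennreal (max 1 l powr (q2 / r)) * 1" by (intro mult_left_mono l(2)) simp
  also have "\<dots> < \<infinity>" by simp
  finally show ?thesis .
qed

theorem lemma13:
  fixes \<alpha> :: real
    and p q :: "(real ^ 'n) \<Rightarrow> real"
    and \<omega> :: "(real ^ 'n) \<Rightarrow> ennreal"
  assumes "0 < \<alpha>" and "\<alpha> < real CARD('n)"
    and "q \<in> borel_measurable lebesgue" and "\<And>x. 0 < q x"
    and "0 < ess_inf q" and "ess_inf q \<le> ess_sup q" and "ess_sup q < \<infinity>"
    and "\<omega> \<in> weight_class q"
    and "\<And>x. 1 / p x = 1 / q x + \<alpha> / real CARD('n)"
  shows "\<exists>C::real. 0 < C \<and>
    (\<forall>(J :: nat set) (Q :: nat \<Rightarrow> (real ^ 'n) set) (c :: nat \<Rightarrow> real).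
       (\<forall>j\<in>J. Q j \<in> cubes \<and> 0 < c j) \<longrightarrow>
       weighted_norm q \<omega>
         (\<lambda>x. \<Sum>\<^sub>\<infinity>j\<in>J. ennreal (c j * measure lebesgue (Q j) powr (\<alpha> / real CARD('n))) *
                indicator (Q j) x)
       \<le> ennreal C *
         weighted_norm p \<omega> (\<lambda>x. \<Sum>\<^sub>\<infinity>j\<in>J. ennreal (c j) * indicator (Q j) x))"
proof -
  define a where "a = \<alpha> / real CARD('n)"
  have a: "0 < a" using assms(1) by (simp add: a_def)
  note q [measurable] = assms(3)
  have p: "1 / p x = 1 / q x + a" for x using assms(9) by (simp add: a_def)
  have ppos: "0 < p x" for x
  proof -
    have "0 < 1 / p x" using p[of x] assms(4)[of x] a by (simp add: add_pos_pos)
    then show ?thesis by simp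
  qed
  obtain q1 where q1: "ess_inf q = ereal q1" using assms(5,6,7) by (cases "ess_inf q") auto
  have q1pos: "0 < q1" using assms(5) q1 by simp
  obtain q2 where q2: "ess_sup q = ereal q2" using assms(5,6,7) q1 by (cases "ess_sup q") auto
  have qb: "AE x in lebesgue. q1 \<le> q x \<and> q x \<le> q2"
  proof -
    have "esssup lebesgue (\<lambda>x. - ereal (q x)) = ereal (- q1)"
      using q1 unfolding ess_inf_def by (metis ereal_uminus_uminus uminus_ereal.simps(1))
    then have "AE x in lebesgue. - ereal (q x) \<le> ereal (- q1)"
      using esssup_AE[of "\<lambda>x. - ereal (q x)" lebesgue] by simp
    moreover have "AE x in lebesgue. ereal (q x) \<le> ereal q2"
      using esssup_AE[of "\<lambda>x. ereal (q x)" lebesgue] q2 by (simp add: ess_sup_def)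
    ultimately show ?thesis by eventually_elim auto
  qed
  have weight: "is_weight \<omega>" using assms(8) by (simp add: weight_class_def)
  then have \<omega>[measurable]: "\<omega> \<in> borel_measurable lebesgue" by (simp add: is_weight_def)
  define w where "w x = enn2real (\<omega> x)" for x
  have w[measurable]: "w \<in> borel_measurable lebesgue" unfolding w_def by measurable
  have w\<omega>: "AE x in lebesgue. 0 < w x \<and> \<omega> x = ennreal (w x)"
  proof -
    have "AE x in lebesgue. 0 < \<omega> x \<and> \<omega> x < \<infinity>" using weight unfolding is_weight_def by blast
    then show ?thesis by (rule eventually_mono) (auto simp: w_def enn2real_positive_iff)
  qed
  obtain r where r: "0 < r" "\<And>Q. Q \<in> cubes \<Longrightarrow>
      weighted_norm (\<lambda>x. q x / r) (\<lambda>x. ennreal_rpow (\<omega> x) r) (indicator Q) < \<infinity>"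
    using assms(8) unfolding weight_class_def by blast
  have loc: "(\<integral>\<^sup>+x\<in>Q. ennreal (w x powr q x) \<partial>lebesgue) < \<infinity>" if "Q \<in> cubes" for Q
  proof (rule local_integrability_of_char_norm[where \<omega> = \<omega> and ?q2.0 = q2])
    show "AE x in lebesgue. 0 < q x \<and> q x \<le> q2" using qb assms(4) by (auto elim: eventually_mono)
  qed (use r that w\<omega> cubes_sets in auto)
  obtain \<kappa> s where \<kappa>: "1 < \<kappa>" and s: "max 1 (1 / ess_inf q) < ereal s"
    and bd: "maximal_bounded_on (\<lambda>x. conj_exponent (\<lambda>y. s * q y) x / \<kappa>) (\<lambda>x. ennreal_rpow (\<omega> x) (- (\<kappa> / s)))"
    using assms(8) unfolding weight_class_def by blast
  have s1: "1 < s" using s by (simp add: one_ereal_def)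
  have "1 / q1 < s" using s q1pos by (simp add: q1 one_ereal_def)
  then have sq1: "1 < s * q1" using q1pos by (simp add: divide_less_eq mult.commute)
  obtain C :: real where C: "0 < C"
    "\<And>(J :: nat set) z l c. finite J \<Longrightarrow> (\<And>j. j \<in> J \<Longrightarrow> 0 < l j) \<Longrightarrow> (\<And>j. j \<in> J \<Longrightarrow> 0 \<le> c j) \<Longrightarrow>
      (\<integral>\<^sup>+x. ennreal (((\<Sum>j\<in>J. c j * indicator (cbox (z j) (z j + vec (l j))) x) * w x) powr p x) \<partial>lebesgue) \<le> 1 \<Longrightarrow>
      (\<integral>\<^sup>+x. ennreal (((\<Sum>j\<in>J. c j * (l j ^ CARD('n)) powr a * indicator (cbox (z j) (z j + vec (l j))) x) * w x / C) powr q x) \<partial>lebesgue) \<le> 1"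
    using strong_bound_finite[OF a s1 sq1 \<kappa> q assms(4) qb \<omega> w w\<omega> p bd loc] by blast
  show ?thesis
  proof (intro exI[of _ C] conjI allI impI)
    show "0 < C" by (rule C(1))
    fix J :: "nat set" and Q :: "nat \<Rightarrow> (real ^ 'n) set" and c :: "nat \<Rightarrow> real"
    assume JQ: "\<forall>j\<in>J. Q j \<in> cubes \<and> 0 < c j"
    then have "\<forall>j\<in>J. \<exists>zl. 0 < snd zl \<and> Q j = cbox (fst zl) (fst zl + vec (snd zl))"
      by (force simp: cubes_def)
    then obtain zl where zl: "\<And>j. j \<in> J \<Longrightarrow> 0 < snd (zl j) \<and> Q j = cbox (fst (zl j)) (fst (zl j) + vec (snd (zl j)))"
      by (metis bchoice)
    define z l where "z j = fst (zl j)" and "l j = snd (zl j)" for j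
    have l: "0 < l j" and Q: "Q j = cbox (z j) (z j + vec (l j))" if "j \<in> J" for j
      using zl[OF that] by (auto simp: z_def l_def)
    have c: "0 < c j" if "j \<in> J" for j using JQ that by blast
    have mQ: "measure lebesgue (Q j) = l j ^ CARD('n)" if "j \<in> J" for j
      using emeasure_cube[OF l[OF that], of "z j"] l[OF that] unfolding Q[OF that]
      by (simp add: measure_def del: ennreal_power)
    let ?F = "\<lambda>x. \<Sum>\<^sub>\<infinity>j\<in>J. ennreal (c j) * indicator (Q j) x"
    let ?G = "\<lambda>x. \<Sum>\<^sub>\<infinity>j\<in>J. ennreal (c j * measure lebesgue (Q j) powr a) * indicator (Q j) x"
    define f where "f k x = (\<Sum>j\<in>J \<inter> {..<k}. c j * indicator (cbox (z j) (z j + vec (l j))) x)" for k x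
    define g where "g k x = (\<Sum>j\<in>J \<inter> {..<k}. c j * (l j ^ CARD('n)) powr a * indicator (cbox (z j) (z j + vec (l j))) x)" for k x
    have [measurable]: "f k \<in> borel_measurable lebesgue" "g k \<in> borel_measurable lebesgue" for k
      unfolding f_def g_def by measurable
    have f0: "0 \<le> f k x" and g0: "0 \<le> g k x" for k x
      unfolding f_def g_def using c by (intro sum_nonneg mult_nonneg_nonneg; simp add: less_imp_le)+
    have real_sum: "(\<Sum>j\<in>J \<inter> {..<k}. ennreal (d j) * indicator (Q j) x)
        = ennreal (\<Sum>j\<in>J \<inter> {..<k}. d j * indicator (cbox (z j) (z j + vec (l j))) x)"
      if "\<And>j. j \<in> J \<Longrightarrow> 0 \<le> d j" for d k x
    proof -
      have "(\<Sum>j\<in>J \<inter> {..<k}. ennreal (d j) * indicator (Q j) x)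
        = (\<Sum>j\<in>J \<inter> {..<k}. ennreal (d j * indicator (cbox (z j) (z j + vec (l j))) x))"
        using Q by (intro sum.cong) (auto split: split_indicator)
      also have "\<dots> = ennreal (\<Sum>j\<in>J \<inter> {..<k}. d j * indicator (cbox (z j) (z j + vec (l j))) x)"
        using that by (intro sum_ennreal mult_nonneg_nonneg) auto
      finally show ?thesis .
    qed
    have F: "?F x = (SUP k. ennreal (f k x))" for x
      unfolding infsum_ennreal_eq_SUP_initial f_def using c by (subst real_sum) (auto simp: less_imp_le)
    have G: "?G x = (SUP k. ennreal (g k x))" for x
    proof -
      have "?G x = (\<Sum>\<^sub>\<infinity>j\<in>J. ennreal (c j * (l j ^ CARD('n)) powr a) * indicator (Q j) x)"
        by (intro infsum_cong) (simp add: mQ)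
      then show ?thesis
        unfolding infsum_ennreal_eq_SUP_initial g_def using c by (subst (asm) real_sum) (auto simp: less_imp_le)
    qed
    have "Lp_norm q (\<lambda>x. ?G x * \<omega> x) \<le> ennreal C * y"
      if y: "y \<in> {ennreal t |t. 0 < t \<and> (\<integral>\<^sup>+ x. ennreal_rpow (?F x * \<omega> x / ennreal t) (p x) \<partial>lebesgue) \<le> 1}" for y
    proof -
      obtain t where t: "y = ennreal t" "0 < t" "(\<integral>\<^sup>+ x. ennreal_rpow (?F x * \<omega> x / ennreal t) (p x) \<partial>lebesgue) \<le> 1"
        using y by blast
      have fk: "(\<integral>\<^sup>+x. ennreal ((f k x / t * w x) powr p x) \<partial>lebesgue) \<le> 1" for k
      proof (rule order_trans[OF nn_integral_mono_AE t(3)])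
        show "AE x in lebesgue. ennreal ((f k x / t * w x) powr p x) \<le> ennreal_rpow (?F x * \<omega> x / ennreal t) (p x)"
          using w\<omega>
        proof eventually_elim
          case (elim x)
          have "ennreal (f k x / t * w x) = ennreal (f k x) * \<omega> x / ennreal t"
            using elim t(2) f0[of k x] by (simp add: divide_ennreal_real ennreal_mult'[symmetric])
          also have "\<dots> \<le> ?F x * \<omega> x / ennreal t"
            unfolding F divide_ennreal_def by (intro mult_right_mono SUP_upper) auto
          finally have "ennreal_rpow (ennreal (f k x / t * w x)) (p x) \<le> ennreal_rpow (?F x * \<omega> x / ennreal t) (p x)"
            by (intro ennreal_rpow_mono ppos)
          then show ?case
            using elim t(2) f0[of k x] ppos[of x] by (simp add: ennreal_rpow_ennreal_nonneg)
        qed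
      qed
      have gk: "(\<integral>\<^sup>+x. ennreal ((g k x * w x / (C * t)) powr q x) \<partial>lebesgue) \<le> 1" for k
      proof -
        have ft: "f k x / t = (\<Sum>j\<in>J \<inter> {..<k}. c j / t * indicator (cbox (z j) (z j + vec (l j))) x)" for x
          by (simp only: f_def sum_divide_distrib times_divide_eq_left)
        have gt: "g k x / t = (\<Sum>j\<in>J \<inter> {..<k}. c j / t * (l j ^ CARD('n)) powr a * indicator (cbox (z j) (z j + vec (l j))) x)" for x
          by (simp only: g_def sum_divide_distrib times_divide_eq_left)
        have "(\<integral>\<^sup>+x. ennreal ((g k x / t * w x / C) powr q x) \<partial>lebesgue) \<le> 1"
          unfolding gt using fk[of k, unfolded ft] l c t(2) by (intro C(2)) (auto simp: less_imp_le)
        then show ?thesis by (simp add: field_simps)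
      qed
      have "modular q (\<lambda>x. ?G x * \<omega> x / ennreal (C * t)) = (\<integral>\<^sup>+x. (SUP k. ennreal ((g k x * w x / (C * t)) powr q x)) \<partial>lebesgue)"
        unfolding modular_def
      proof (rule nn_integral_cong_AE)
        show "AE x in lebesgue. ennreal_rpow (?G x * \<omega> x / ennreal (C * t)) (q x) = (SUP k. ennreal ((g k x * w x / (C * t)) powr q x))"
          using w\<omega>
        proof eventually_elim
          case (elim x)
          have "?G x * \<omega> x / ennreal (C * t) = (SUP k. ennreal (g k x) * \<omega> x / ennreal (C * t))"
            unfolding G divide_ennreal_def mult.assoc by (rule SUP_mult_right_ennreal)
          also have "\<dots> = (SUP k. ennreal (g k x * w x / (C * t)))"
            using elim t(2) C(1) g0[of _ x] by (simp add: divide_ennreal_real ennreal_mult'[symmetric])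
          finally show ?case
            using elim t(2) C(1) g0[of _ x] assms(4)[of x] by (simp add: ennreal_rpow_SUP ennreal_rpow_ennreal_nonneg)
        qed
      qed
      also have "\<dots> = (SUP k. \<integral>\<^sup>+x. ennreal ((g k x * w x / (C * t)) powr q x) \<partial>lebesgue)"
      proof (rule nn_integral_monotone_convergence_SUP)
        show "incseq (\<lambda>k x. ennreal ((g k x * w x / (C * t)) powr q x))"
        proof (intro incseq_SucI le_funI ennreal_leI powr_mono2)
          fix k x
          have w0: "0 \<le> w x" by (simp add: w_def)
          show "0 \<le> g k x * w x / (C * t)" using w0 g0[of k x] C(1) t(2) by simp
          have "g k x \<le> g (Suc k) x" unfolding g_def using c by (intro sum_mono2 mult_nonneg_nonneg) (auto simp: less_imp_le)
          then show "g k x * w x / (C * t) \<le> g (Suc k) x * w x / (C * t)"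
            using w0 C(1) t(2) by (intro divide_right_mono mult_right_mono) auto
        qed (simp add: assms(4) less_imp_le)
      qed measurable
      also have "\<dots> \<le> 1" by (intro SUP_least gk)
      finally have "Lp_norm q (\<lambda>x. ?G x * \<omega> x) \<le> ennreal (C * t)"
        using C(1) t(2) by (intro Lp_norm_le) auto
      then show ?thesis using C(1) t by (simp add: ennreal_mult')
    qed
    then have "Lp_norm q (\<lambda>x. ?G x * \<omega> x) \<le> ennreal C * Lp_norm p (\<lambda>x. ?F x * \<omega> x)"
      unfolding Lp_norm_def[of p] by (intro ennreal_le_cmult_Inf C(1))
    then show "weighted_norm q \<omega> (\<lambda>x. \<Sum>\<^sub>\<infinity>j\<in>J. ennreal (c j * measure lebesgue (Q j) powr (\<alpha> / real CARD('n))) *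
                indicator (Q j) x)
       \<le> ennreal C * weighted_norm p \<omega> (\<lambda>x. \<Sum>\<^sub>\<infinity>j\<in>J. ennreal (c j) * indicator (Q j) x)"
      by (simp only: weighted_norm_def a_def)
  qed
qed

end
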